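(* Let $L,M,N$ be positive integers varying so that $M+N\to\infty$, and assume $\lim_{M+N\to\infty}M/N=0$ and $\lim_{M+N\to\infty}L/N=\tau\in(0,\infty)$. Given $q\in(0,1]$, choose $u_N=|u_N|e^{i\theta}$, $\theta\in(-\pi,\pi]$, such that $$\Big(1+\frac{L}{qN}\Big)|u_N|^2-1=0.$$ Let $\rho=\sqrt\tau/(1-|u_N|^2)$ and set $$z_j=u_N^M\Big(1+\frac{v_j}{\rho u_N\sqrt{MN}}\Big)^M,\qquad j=1,\ldots,n.$$ Then the $n$-point correlation functions $R^{(n)}_{M,N}$ of the eigenvalues of $\Pi_M=X_M\cdots X_1$ (a product of i.i.d. truncated unitary matrices) satisfy $$\lim_{M+N\to\infty}\Big(\frac{M}{\rho^2|u_N|^2N}\Big)^n|z_1\cdots z_n|^2R^{(n)}_{M,N}(z_1,\ldots,z_n)=\begin{cases}\det\big[\mathrm K^{(\mathrm{bulk})}_{\mathrm{Gin}}(v_i,v_j)\big]_{i,j=1}^n,& q\in(0,1),\\[1ex]\det\big[\mathrm K^{(\mathrm{edge})}_{\mathrm{Gin}}(v_i,v_j)\big]_{i,j=1}^n,& q=1,\end{cases}$$ uniformly for $v_1,\ldots,v_n$ in a compact subset of $\mathbb C$.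
   Context: $n\ge1$ is a fixed integer. Model: $X_1,\ldots,X_M$ are i.i.d. truncated unitary matrices, each being the upper left $N\times N$ corner of a Haar-distributed random unitary $(N+L)\times(N+L)$ matrix, and $\Pi_M=X_M\cdots X_1$. The eigenvalues of $\Pi_M$ form a determinantal point process in $\mathbb C$ (with respect to Lebesgue measure), with correlation functions $R^{(n)}_{M,N}(z_1,\ldots,z_n)=\det[K_{M,N}(z_i,z_j)]_{i,j=1}^n$, where $$K_{M,N}(z_1,z_2)=\frac1\pi\sqrt{w(z_1)w(z_2)}\sum_{j=0}^{N-1}\frac{\Gamma^M(L+j+1)}{\Gamma^M(j+1)}(z_1\overline z_2)^j,\qquad w(z)=\int_{-c-i\infty}^{-c+i\infty}\frac{ds}{2\pi i}\,\frac{\Gamma^M(-s)}{\Gamma^M(L-s)}|z|^{2s}$$ for some $c>0$. Ginibre kernels, with $\theta=\arg u_N$ and $\mathrm{erfc}(x)=\frac{2}{\sqrt\pi}\int_x^\infty e^{-t^2}dt$ (extended to an entire function): $$\mathrm K^{(\mathrm{bulk})}_{\mathrm{Gin}}(v_1,v_2)=\frac1\pi e^{-\frac12(|v_1|^2+|v_2|^2-2v_1\overline v_2)},$$ $$\mathrm K^{(\mathrm{edge})}_{\mathrm{Gin}}(v_1,v_2)=\frac{1}{2\pi}e^{-\frac12(|v_1|^2+|v_2|^2-2v_1\overline v_2)}\,\mathrm{erfc}\Big(\tfrac{1}{\sqrt2}\big(e^{-i\theta}v_1+e^{i\theta}\overline v_2\big)\Big).$$ *)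

theory Defs
  imports
    "HOL-Probability.Probability"
    "HOL-Complex_Analysis.Complex_Analysis"
    "Jordan_Normal_Form.Char_Poly"
    "Jordan_Normal_Form.Schur_Decomposition"
begin

section \<open>Products of truncated unitary matrices\<close>

text \<open>Borel sigma-algebra on the complex \<open>d \<times> d\<close> matrices, generated by the entries.\<close>

definition mat_borel :: "nat \<Rightarrow> complex mat measure" where
  "mat_borel d = vimage_algebra (carrier_mat d d)
     (\<lambda>A. \<lambda>ij\<in>{..<d} \<times> {..<d}. A $$ ij)
     (\<Pi>\<^sub>M ij\<in>{..<d} \<times> {..<d}. (borel :: complex measure))"

definition unitary_mats :: "nat \<Rightarrow> complex mat set" where
  "unitary_mats d = {U \<in> carrier_mat d d. mat_adjoint U * U = 1\<^sub>m d}"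

text \<open>Haar measure on the unitary group, as a measure on all matrices: the left-invariant
  probability measure carried by the unitary matrices.\<close>

definition is_haar_unitary :: "nat \<Rightarrow> complex mat measure \<Rightarrow> bool" where
  "is_haar_unitary d H \<longleftrightarrow>
     prob_space H \<and> sets H = sets (mat_borel d) \<and>
     (AE U in H. U \<in> unitary_mats d) \<and>
     (\<forall>V\<in>unitary_mats d. distr H (mat_borel d) (\<lambda>U. V * U) = H)"

definition corner :: "nat \<Rightarrow> complex mat \<Rightarrow> complex mat" where
  "corner N U = Matrix.mat N N (\<lambda>ij. U $$ ij)"

definition truncated_unitary :: "'w measure \<Rightarrow> nat \<Rightarrow> nat \<Rightarrow> ('w \<Rightarrow> complex mat) \<Rightarrow> bool" where
  "truncated_unitary P N L X \<longleftrightarrow>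
     X \<in> measurable P (mat_borel N) \<and>
     (\<exists>H. is_haar_unitary (N + L) H \<and>
          distr P (mat_borel N) X = distr H (mat_borel N) (corner N))"

definition iid_truncated_unitary ::
    "'w measure \<Rightarrow> nat \<Rightarrow> nat \<Rightarrow> nat \<Rightarrow> (nat \<Rightarrow> 'w \<Rightarrow> complex mat) \<Rightarrow> bool" where
  "iid_truncated_unitary P N L M X \<longleftrightarrow>
     prob_space P \<and>
     (\<forall>i\<in>{1..M}. truncated_unitary P N L (X i)) \<and>
     prob_space.indep_vars P (\<lambda>_. mat_borel N) X {1..M}"

primrec mat_product :: "nat \<Rightarrow> (nat \<Rightarrow> complex mat) \<Rightarrow> nat \<Rightarrow> complex mat" where
  "mat_product N X 0 = 1\<^sub>m N"
| "mat_product N X (Suc m) = X (Suc m) * mat_product N X m"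

definition eigenvalues_mset :: "complex mat \<Rightarrow> complex multiset" where
  "eigenvalues_mset A = proots (char_poly A)"

section \<open>Correlation functions\<close>

text \<open>Sum of \<open>f\<close> over all \<open>n\<close>-tuples of points of the configuration \<open>A\<close> taken at pairwise distinct
  indices; it does not depend on the enumeration chosen.\<close>

definition distinct_tuple_sum ::
    "nat \<Rightarrow> complex multiset \<Rightarrow> ((nat \<Rightarrow> complex) \<Rightarrow> ennreal) \<Rightarrow> ennreal" where
  "distinct_tuple_sum n A f =
     (let xs = (SOME xs. mset xs = A)
      in \<Sum>\<iota> | \<iota> \<in> {..<n} \<rightarrow>\<^sub>E {..<length xs} \<and> inj_on \<iota> {..<n}. f (\<lambda>i\<in>{..<n}. xs ! \<iota> i))"

text \<open>Points of \<open>\<complex>\<^sup>n\<close> are extensional functions on \<open>{..<n}\<close>; \<open>lborel\<close> on the type \<open>complex\<close> is planar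
  Lebesgue measure.\<close>

definition lborel_tuples :: "nat \<Rightarrow> (nat \<Rightarrow> complex) measure" where
  "lborel_tuples n = (\<Pi>\<^sub>M i\<in>{..<n}. lborel)"

definition is_correlation_function ::
    "'w measure \<Rightarrow> ('w \<Rightarrow> complex multiset) \<Rightarrow> nat \<Rightarrow> ((nat \<Rightarrow> complex) \<Rightarrow> real) \<Rightarrow> bool" where
  "is_correlation_function P \<Xi> n R \<longleftrightarrow>
     R \<in> borel_measurable (lborel_tuples n) \<and>
     (\<forall>z\<in>space (lborel_tuples n). 0 \<le> R z) \<and>
     (\<forall>f\<in>borel_measurable (lborel_tuples n).
        (\<integral>\<^sup>+\<omega>. distinct_tuple_sum n (\<Xi> \<omega>) f \<partial>P) =
        (\<integral>\<^sup>+z. f z * ennreal (R z) \<partial>lborel_tuples n))"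

definition kernel_det :: "nat \<Rightarrow> (complex \<Rightarrow> complex \<Rightarrow> complex) \<Rightarrow> (nat \<Rightarrow> complex) \<Rightarrow> complex" where
  "kernel_det n K z = Determinant.det (Matrix.mat n n (\<lambda>(i, j). K (z i) (z j)))"

section \<open>The correlation kernel\<close>

text \<open>The integral along the vertical line is a symmetric improper integral: for \<open>L = M = 1\<close> it does
  not converge absolutely. It is independent of the abscissa \<open>- c\<close>, \<open>c > 0\<close>.\<close>

definition weight :: "real \<Rightarrow> nat \<Rightarrow> nat \<Rightarrow> complex \<Rightarrow> complex" where
  "weight c L M z =
     Lim at_top (\<lambda>T :: real.
       contour_integral (linepath (Complex (- c) (- T)) (Complex (- c) T))
         (\<lambda>s. 1 / (2 * of_real pi * \<i>) * (Gamma (- s) ^ M / Gamma (of_nat L - s) ^ M)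
                * of_real (cmod z) powr (2 * s)))"

definition K_trunc :: "real \<Rightarrow> nat \<Rightarrow> nat \<Rightarrow> nat \<Rightarrow> complex \<Rightarrow> complex \<Rightarrow> complex" where
  "K_trunc c L M N z1 z2 =
     1 / of_real pi * csqrt (weight c L M z1 * weight c L M z2) *
     (\<Sum>j<N. Gamma (of_nat (L + j + 1)) ^ M / Gamma (of_nat (j + 1)) ^ M * (z1 * cnj z2) ^ j)"

section \<open>Ginibre kernels\<close>

definition erfc_real :: "real \<Rightarrow> real" where
  "erfc_real x = 2 / sqrt pi * integral {x..} (\<lambda>t. exp (- (t\<^sup>2)))"

definition erfc :: "complex \<Rightarrow> complex" where
  "erfc = (THE f. f holomorphic_on UNIV \<and> (\<forall>x :: real. f (of_real x) = of_real (erfc_real x)))"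

lemma erfc_well_defined:
  "\<exists>!f. f holomorphic_on UNIV \<and> (\<forall>x :: real. f (of_real x) = (of_real (erfc_real x) :: complex))"
proof (rule ex_ex1I)
  let ?g = "\<lambda>t :: real. exp (- (t\<^sup>2))"
  have "(\<lambda>z :: complex. exp (- (z\<^sup>2))) holomorphic_on UNIV"
    by (intro holomorphic_intros)
  then obtain F where F: "\<And>z :: complex. (F has_field_derivative exp (- (z\<^sup>2))) (at z)"
    using holomorphic_convex_primitive'[of UNIV "\<lambda>z :: complex. exp (- (z\<^sup>2))"] by auto
  have lint: "set_integrable lebesgue A ?g" if "A \<in> sets lebesgue" for A
  proof -
    have "integrable lborel ?g"
      using has_bochner_integral_even_function[OF gaussian_moment_even_pos[where k=0]]
      by (auto simp: has_bochner_integral_iff)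
    then have "set_integrable lebesgue UNIV ?g"
      by (simp add: set_integrable_def integrable_completion)
    then show ?thesis
      using that by (rule set_integrable_subset) auto
  qed
  have int: "?g integrable_on {x..}" for x
    by (rule set_lebesgue_integral_eq_integral(1)[OF lint]) simp
  have step: "of_real (integral {x..} ?g) + F (of_real x) = of_real (integral {y..} ?g) + F (of_real y)"
    if "x \<le> y" for x y
  proof -
    have "((\<lambda>t. complex_of_real (?g t)) has_integral F (of_real y) - F (of_real x)) {x..y}"
    proof (rule fundamental_theorem_of_calculus[OF that])
      fix t :: real
      have "((\<lambda>s. F (of_real s)) has_vector_derivative exp (- ((of_real t)\<^sup>2))) (at t within {x..y})"
        using has_vector_derivative_real_field[OF F] by blast
      then show "((\<lambda>s. F (of_real s)) has_vector_derivative complex_of_real (?g t)) (at t within {x..y})"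
        by (simp add: exp_of_real flip: of_real_power of_real_minus)
    qed
    moreover have "(?g has_integral integral {x..y} ?g) {x..y}"
      by (intro integrable_integral integrable_continuous_interval continuous_intros)
    then have "((\<lambda>t. complex_of_real (?g t)) has_integral of_real (integral {x..y} ?g)) {x..y}"
      by (rule has_integral_of_real)
    ultimately have 1: "of_real (integral {x..y} ?g) = F (of_real y) - F (of_real x)"
      by (rule has_integral_unique[symmetric])
    have "((\<lambda>t. ?g t) has_integral integral {x..y} ?g + integral {y..} ?g) ({x..y} \<union> {y..})"
    proof (rule has_integral_Un)
      show "(?g has_integral integral {x..y} ?g) {x..y}" by fact
      show "(?g has_integral integral {y..} ?g) {y..}" using int by (rule integrable_integral)
      have "{x..y} \<inter> {y..} \<subseteq> {y}" by auto
      then show "negligible ({x..y} \<inter> {y..})"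
        using negligible_sing negligible_subset by blast
    qed
    moreover have "{x..y} \<union> {y..} = {x..}" using that by auto
    ultimately have "integral {x..} ?g = integral {x..y} ?g + integral {y..} ?g"
      by (simp add: integral_unique)
    then show ?thesis using 1 by simp
  qed
  define C where "C = of_real (integral {0..} ?g) + F 0"
  have C: "of_real (integral {x..} ?g) = C - F (of_real x)" for x
    using step[of x 0] step[of 0 x] by (cases "x \<le> 0") (auto simp: C_def algebra_simps)
  have "F holomorphic_on UNIV"
    using F by (auto simp: holomorphic_on_open)
  then have "(\<lambda>z. of_real (2 / sqrt pi) * (C - F z)) holomorphic_on UNIV"
    by (intro holomorphic_intros)
  moreover have "of_real (2 / sqrt pi) * (C - F (of_real x)) = of_real (erfc_real x)" for x
    by (simp add: erfc_real_def flip: C)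
  ultimately show "\<exists>f. f holomorphic_on UNIV \<and> (\<forall>x. f (of_real x) = (of_real (erfc_real x) :: complex))"
    by blast
next
  fix f g :: "complex \<Rightarrow> complex"
  assume f: "f holomorphic_on UNIV \<and> (\<forall>x :: real. f (of_real x) = of_real (erfc_real x))"
    and g: "g holomorphic_on UNIV \<and> (\<forall>x :: real. g (of_real x) = of_real (erfc_real x))"
  have lim: "0 islimpt (\<real> :: complex set)"
    unfolding islimpt_approachable
  proof (intro allI impI)
    fix e :: real assume "e > 0"
    then show "\<exists>x'\<in>\<real>. x' \<noteq> 0 \<and> dist x' (0 :: complex) < e"
      by (intro bexI[of _ "of_real (e/2)"]) (auto simp: norm_divide)
  qed
  show "f = g"
  proof
    fix w :: complex
    have "f w - g w = 0"
      by (rule analytic_continuation[of "\<lambda>z. f z - g z" UNIV "\<real>" 0])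
         (use f g lim in \<open>auto intro!: holomorphic_intros elim!: Reals_cases\<close>)
    then show "f w = g w" by simp
  qed
qed

definition K_bulk :: "complex \<Rightarrow> complex \<Rightarrow> complex" where
  "K_bulk v1 v2 = 1 / of_real pi *
     exp (- (1/2) * (of_real ((cmod v1)\<^sup>2) + of_real ((cmod v2)\<^sup>2) - 2 * v1 * cnj v2))"

definition K_edge :: "real \<Rightarrow> complex \<Rightarrow> complex \<Rightarrow> complex" where
  "K_edge \<theta> v1 v2 = 1 / (2 * of_real pi) *
     exp (- (1/2) * (of_real ((cmod v1)\<^sup>2) + of_real ((cmod v2)\<^sup>2) - 2 * v1 * cnj v2)) *
     erfc (1 / of_real (sqrt 2) *
       (exp (- \<i> * of_real \<theta>) * v1 + exp (\<i> * of_real \<theta>) * cnj v2))"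

end

theory Submission
  imports Defs "HOL-Real_Asymp.Real_Asymp"
begin

text \<open>The ratio \<open>\<Gamma>(p + L) / \<Gamma>(p)\<close> is the Pochhammer symbol \<open>A(p) = p (p + 1) \<cdots> (p + L - 1)\<close>, so
  no Stirling formula is needed. Writing \<open>z = u\<^sup>M e\<^sup>b\<close>, both the weight and the kernel sum are governed by
  \<open>A(m + \<zeta>)\<^sup>M |u|\<^sup>2\<^sup>M\<^sup>\<zeta>\<close>, with \<open>\<zeta>\<close> imaginary in the weight (where the reciprocal enters, after moving the contour to \<open>Re s = -m\<close>) and a real
  integer in the sum. The saddle point is \<open>m = \<lfloor>q N\<rfloor>\<close>; on the scale \<open>\<zeta> = \<surd>(N / M) t\<close>, which tends to infinity
  because \<open>M / N\<close> tends to \<open>0\<close>, the function becomes a Gaussian, and dominated convergence turns both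
  into Gaussian integrals. For \<open>q < 1\<close> the saddle lies inside the range of summation and the integral is
  over the whole line; for \<open>q = 1\<close> it lies at its end, the integral is over a half line, and \<open>erfc\<close>
  appears. What remains besides the Ginibre kernel are phases that cancel in the determinant.\<close>

section \<open>The complementary error function\<close>

text \<open>The scales balance as follows. The logarithmic derivative of A at m is close to ln((m +
  L) / m), so the linear term at the saddle cancels to leading order when |u|^2 = 1 / (1 + L / (q
  N)), which is the equation imposed on u. With M s^2 = N the quadratic term is of order one, the
  cubic ones are of order s / N, and rounding q N to an integer costs O(1 / s). Taylor expansion
  says nothing when the displacement is comparable to N, so domination rests on global bounds:
  Bernoulli's inequality on the vertical line, a quadratic bound for the logarithm on the degrees.
  To get uniformity without tracking errors, every limit is taken along arbitrary convergent
  sequences of arguments, and compactness does the rest. The factor |z_1 ... z_n|^2 comes from an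
  offset by one: the square roots of the weights contribute |z|^(-m), whereas the saddle degree is m
  - 1, because the coefficient of degree j is A(j + 1)^M. As \<open>weight\<close> is complex
  valued, its square root is controlled by letting the normalised product of two weights tend to a
  positive number.\<close>

lemma integrable_gaussian:
  fixes \<kappa> :: real
  assumes "\<kappa> > 0"
  shows "integrable lborel (\<lambda>t::real. exp (- \<kappa> * t\<^sup>2))"
proof -
  have "integrable lborel (\<lambda>t::real. exp (- t\<^sup>2))"
    using has_bochner_integral_even_function[OF gaussian_moment_even_pos[where k=0]]
    by (auto simp: has_bochner_integral_iff)
  from lborel_integrable_real_affine[OF this, of "sqrt \<kappa>" 0] show ?thesis
    using assms by (simp add: power_mult_distrib)
qed

text \<open>The Lebesgue form of the Henstock-Kurzweil integral in the definition, which makes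
  dominated convergence available.\<close>

lemma erfc_real_lborel:
  "erfc_real x = 2 / sqrt pi * (\<integral>t. indicator {x..} t *\<^sub>R exp (- t\<^sup>2) \<partial>lborel)"
proof -
  have "set_integrable lborel {x..} (\<lambda>t::real. exp (- t\<^sup>2))"
    using integrable_gaussian[of 1] unfolding set_integrable_def
    by (intro integrable_mult_indicator) auto
  from set_borel_integral_eq_integral(2)[OF this] show ?thesis
    by (simp add: erfc_real_def set_lebesgue_integral_def)
qed

lemma erfc_real_at_top: "(erfc_real \<longlongrightarrow> 0) at_top"
proof -
  have "((\<lambda>x::real. \<integral>t. indicator {x..} t *\<^sub>R exp (- t\<^sup>2) \<partial>lborel) \<longlongrightarrow> (\<integral>t. (0::real) \<partial>(lborel :: real measure))) at_top"
  proof (rule integral_dominated_convergence_at_top[where w="\<lambda>t. exp (- t\<^sup>2)" and f="\<lambda>_. 0"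
        and s="\<lambda>x t. indicator {x..} t *\<^sub>R exp (- t\<^sup>2)"])
    show "AE t::real in lborel. ((\<lambda>x. indicator {x..} t *\<^sub>R exp (- t\<^sup>2)) \<longlongrightarrow> (0::real)) at_top"
    proof (rule AE_I2)
      fix t :: real
      show "((\<lambda>x. indicator {x..} t *\<^sub>R exp (- t\<^sup>2)) \<longlongrightarrow> 0) at_top"
        by (rule tendsto_eventually, use eventually_gt_at_top[of t] in eventually_elim) auto
    qed
    show "\<forall>\<^sub>F x in at_top. AE t::real in lborel. norm (indicator {x..} t *\<^sub>R exp (- t\<^sup>2)) \<le> exp (- t\<^sup>2)"
      by (auto simp: indicator_def intro!: always_eventually)
  qed (use integrable_gaussian[of 1] in auto)
  from tendsto_mult_left[OF this, of "2 / sqrt pi"] show ?thesis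
    by (simp add: erfc_real_lborel[abs_def])
qed

lemma erfc_real_at_bot: "(erfc_real \<longlongrightarrow> 2) at_bot"
proof -
  have "((\<lambda>x. \<integral>t. indicator {- x..} t *\<^sub>R exp (- t\<^sup>2) \<partial>lborel) \<longlongrightarrow> (\<integral>t. exp (- t\<^sup>2) \<partial>(lborel :: real measure))) at_top"
  proof (rule integral_dominated_convergence_at_top[where w="\<lambda>t. exp (- t\<^sup>2)"])
    show "AE t::real in lborel. ((\<lambda>x. indicator {- x..} t *\<^sub>R exp (- t\<^sup>2)) \<longlongrightarrow> exp (- t\<^sup>2)) at_top"
    proof (rule AE_I2)
      fix t :: real
      show "((\<lambda>x. indicator {- x..} t *\<^sub>R exp (- t\<^sup>2)) \<longlongrightarrow> exp (- t\<^sup>2)) at_top"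
        by (rule tendsto_eventually, use eventually_gt_at_top[of "-t"] in eventually_elim) auto
    qed
    show "\<forall>\<^sub>F x in at_top. AE t::real in lborel. norm (indicator {-x..} t *\<^sub>R exp (- t\<^sup>2)) \<le> exp (- t\<^sup>2)"
      by (auto simp: indicator_def intro!: always_eventually)
  qed (use integrable_gaussian[of 1] in auto)
  moreover have "(\<integral>t. exp (- t\<^sup>2) \<partial>(lborel :: real measure)) = sqrt pi"
    using has_bochner_integral_even_function[OF gaussian_moment_even_pos[where k=0]]
    by (auto simp: has_bochner_integral_iff)
  ultimately show ?thesis
    using tendsto_mult_left[of _ "sqrt pi" at_top "2 / sqrt pi"]
    by (auto simp: erfc_real_lborel[abs_def] filterlim_at_bot_mirror)
qed

text \<open>A definite description gives no handle off the real axis. An explicit candidate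
  \<open>E\<close> is built from a primitive \<open>F\<close> of exp(-z^2), and uniqueness of the
  entire extension identifies it with \<open>erfc\<close>; values and derivative are then those of
  \<open>E\<close>.\<close>

lemma
  shows erfc_of_real: "erfc (of_real x) = of_real (erfc_real x)"
    and erfc_has_field_derivative:
      "(erfc has_field_derivative - (2 / of_real (sqrt pi)) * exp (- (z\<^sup>2))) (at z)"
proof -
  have "(\<lambda>z :: complex. exp (- (z\<^sup>2))) holomorphic_on UNIV"
    by (intro holomorphic_intros)
  then obtain F where F: "\<And>z :: complex. (F has_field_derivative exp (- (z\<^sup>2))) (at z)"
    using holomorphic_convex_primitive'[of UNIV "\<lambda>z :: complex. exp (- (z\<^sup>2))"] by auto
  let ?J = "\<lambda>x. complex_of_real (\<integral>t. indicator {x..} t *\<^sub>R exp (- t\<^sup>2) \<partial>lborel)"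
  have int: "integrable lborel (\<lambda>t::real. indicator A t *\<^sub>R exp (- t\<^sup>2))" if "A \<in> sets borel" for A
    using integrable_gaussian[of 1] that by (intro integrable_mult_indicator) auto
  have step: "?J x + F (of_real x) = ?J y + F (of_real y)" if "x \<le> y" for x y
  proof -
    have "(\<integral>t. indicator {x..y} t *\<^sub>R complex_of_real (exp (- t\<^sup>2)) \<partial>lborel) = F (of_real y) - F (of_real x)"
    proof (rule integral_FTC_atLeastAtMost[OF that])
      fix t :: real
      have "((\<lambda>s. F (of_real s)) has_vector_derivative exp (- ((of_real t)\<^sup>2))) (at t within {x..y})"
        using has_vector_derivative_real_field[OF F] by blast
      then show "((\<lambda>s. F (of_real s)) has_vector_derivative complex_of_real (exp (- t\<^sup>2))) (at t within {x..y})"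
        by (simp add: exp_of_real flip: of_real_power of_real_minus)
    qed (intro continuous_intros)
    moreover have "(\<integral>t. indicator {x..y} t *\<^sub>R complex_of_real (exp (- t\<^sup>2)) \<partial>lborel)
       = of_real (\<integral>t. indicator {x..y} t *\<^sub>R exp (- t\<^sup>2) \<partial>lborel)"
      by (simp add: scaleR_conv_of_real flip: integral_complex_of_real of_real_mult)
    \<comment> \<open>The two intervals share the point \<open>y\<close>, so the integrands agree
      only almost everywhere.\<close>
    moreover have "(\<integral>t. indicator {x..} t *\<^sub>R exp (- t\<^sup>2) \<partial>lborel)
       = (\<integral>t. indicator {x..y} t *\<^sub>R exp (- t\<^sup>2) + indicator {y..} t *\<^sub>R exp (- t\<^sup>2) \<partial>lborel)"
      by (intro integral_cong_AE AE_I[of _ _ "{y}"]) (use that in \<open>auto simp: indicator_def split: if_splits\<close>)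
    then have "(\<integral>t. indicator {x..} t *\<^sub>R exp (- t\<^sup>2) \<partial>lborel)
       = (\<integral>t. indicator {x..y} t *\<^sub>R exp (- t\<^sup>2) \<partial>lborel) + (\<integral>t. indicator {y..} t *\<^sub>R exp (- t\<^sup>2) \<partial>lborel)"
      using int by (simp add: Bochner_Integration.integral_add)
    ultimately show ?thesis by simp
  qed
  define C where "C = ?J 0 + F 0"
  have J: "?J x = C - F (of_real x)" for x
    using step[of x 0] step[of 0 x] by (cases "x \<le> 0") (auto simp: C_def algebra_simps)
  define E where "E z = 2 / of_real (sqrt pi) * (C - F z)" for z
  have E': "(E has_field_derivative - (2 / of_real (sqrt pi)) * exp (- (z\<^sup>2))) (at z)" for z
    unfolding E_def by (auto intro!: derivative_eq_intros F)
  have "E holomorphic_on UNIV"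
    using E' by (auto simp: holomorphic_on_open)
  moreover have E_real: "E (of_real x) = of_real (erfc_real x)" for x
    by (simp add: erfc_real_lborel E_def flip: J)
  ultimately have "erfc = E"
    unfolding erfc_def using erfc_well_defined by (intro the1_equality) auto
  with E' E_real show "erfc (of_real x) = of_real (erfc_real x)"
    "(erfc has_field_derivative - (2 / of_real (sqrt pi)) * exp (- (z\<^sup>2))) (at z)"
    by auto
qed

text \<open>Mean value estimate on the disc of radius |B| around t. For z = t + w in it, Re(-z^2) is
  at most 2 |B|^2 - t^2 / 2, because (t + 2 Re w)^2 is nonnegative. Horizontal lines thus inherit
  the limits of \<open>erfc\<close> along the real axis, which are the boundary values in the
  Gaussian integrals with complex linear term.\<close>

lemma erfc_shift_bound:
  "norm (erfc (B + of_real t) - erfc (of_real t))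
     \<le> 2 / sqrt pi * exp (2 * (norm B)\<^sup>2 - t\<^sup>2 / 2) * norm B"
proof -
  have "norm (erfc (of_real t + B) - erfc (of_real t))
     \<le> 2 / sqrt pi * exp (2 * (norm B)\<^sup>2 - t\<^sup>2 / 2) * norm (of_real t + B - of_real t)"
  proof (rule field_differentiable_bound[where S="cball (of_real t) (norm B)"])
    fix z :: complex assume "z \<in> cball (of_real t) (norm B)"
    then have 1: "norm (z - of_real t) \<le> norm B" by (simp add: dist_norm norm_minus_commute)
    define w where "w = z - of_real t"
    have w: "(Re w)\<^sup>2 + (Im w)\<^sup>2 \<le> (norm B)\<^sup>2"
      using 1 by (metis cmod_power2 norm_ge_zero power_mono w_def)
    have "t\<^sup>2 / 2 - (Re w)\<^sup>2 \<le> (t + Re w)\<^sup>2"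
      using zero_le_power2[of "t + 2 * Re w"] by (simp add: power2_eq_square algebra_simps)
    then have "(Im w)\<^sup>2 - (t + Re w)\<^sup>2 \<le> 2 * (norm B)\<^sup>2 - t\<^sup>2 / 2"
      using w zero_le_power2[of "norm B"] by linarith
    moreover have "Re (- (z\<^sup>2)) = (Im w)\<^sup>2 - (t + Re w)\<^sup>2"
      by (simp add: w_def power2_eq_square algebra_simps)
    ultimately have "norm (exp (- (z\<^sup>2))) \<le> exp (2 * (norm B)\<^sup>2 - t\<^sup>2 / 2)"
      by (simp only: norm_exp_eq_Re exp_le_cancel_iff)
    then have "2 / sqrt pi * norm (exp (- (z\<^sup>2))) \<le> 2 / sqrt pi * exp (2 * (norm B)\<^sup>2 - t\<^sup>2 / 2)"
      by (intro mult_left_mono) auto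
    then show "norm (- (2 / of_real (sqrt pi)) * exp (- (z\<^sup>2))) \<le> 2 / sqrt pi * exp (2 * (norm B)\<^sup>2 - t\<^sup>2 / 2)"
      by (simp add: norm_mult norm_divide del: norm_exp_eq_Re)
  next
    fix z :: complex
    show "(erfc has_field_derivative - (2 / of_real (sqrt pi)) * exp (- (z\<^sup>2))) (at z within cball (of_real t) (norm B))"
      by (rule has_field_derivative_at_within[OF erfc_has_field_derivative])
  qed (auto simp: dist_norm)
  then show ?thesis by (simp add: add.commute)
qed

lemma
  shows erfc_shift_at_top: "((\<lambda>t::real. erfc (B + of_real t)) \<longlongrightarrow> 0) at_top"
    and erfc_shift_at_bot: "((\<lambda>t::real. erfc (B + of_real t)) \<longlongrightarrow> 2) at_bot"
proof -
  have eq: "(\<lambda>t::real. erfc (B + of_real t))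
      = (\<lambda>t. (erfc (B + of_real t) - erfc (of_real t)) + of_real (erfc_real t))"
    by (simp add: erfc_of_real)
  have "((\<lambda>t::real. 2 / sqrt pi * exp (2 * (norm B)\<^sup>2 - t\<^sup>2 / 2) * norm B) \<longlongrightarrow> 0) at_top"
    by real_asymp
  then have 1: "((\<lambda>t::real. erfc (B + of_real t) - erfc (of_real t)) \<longlongrightarrow> 0) at_top"
    by (rule Lim_null_comparison[rotated]) (intro always_eventually allI erfc_shift_bound)
  have "((\<lambda>t::real. 2 / sqrt pi * exp (2 * (norm B)\<^sup>2 - t\<^sup>2 / 2) * norm B) \<longlongrightarrow> 0) at_bot"
    by real_asymp
  then have 2: "((\<lambda>t::real. erfc (B + of_real t) - erfc (of_real t)) \<longlongrightarrow> 0) at_bot"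
    by (rule Lim_null_comparison[rotated]) (intro always_eventually allI erfc_shift_bound)
  show "((\<lambda>t::real. erfc (B + of_real t)) \<longlongrightarrow> 0) at_top"
    unfolding eq using tendsto_add[OF 1 tendsto_of_real[OF erfc_real_at_top]] by simp
  show "((\<lambda>t::real. erfc (B + of_real t)) \<longlongrightarrow> 2) at_bot"
    unfolding eq using tendsto_add[OF 2 tendsto_of_real[OF erfc_real_at_bot]] by simp
qed

lemma integrable_gaussian_exp_linear:
  fixes \<kappa> :: real and A :: complex
  assumes "\<kappa> > 0"
  shows "integrable lborel (\<lambda>t::real. exp (- of_real (\<kappa> * t\<^sup>2) + of_real t * A))"
proof (rule Bochner_Integration.integrable_bound)
  show "integrable lborel (\<lambda>t. exp ((Re A)\<^sup>2 / (2 * \<kappa>)) * exp (- (\<kappa> / 2) * t\<^sup>2))"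
    using integrable_gaussian[of "\<kappa>/2"] assms by (intro integrable_mult_right) simp
  show "AE t in lborel. norm (exp (- of_real (\<kappa> * t\<^sup>2) + of_real t * A))
      \<le> norm (exp ((Re A)\<^sup>2 / (2 * \<kappa>)) * exp (- (\<kappa> / 2) * t\<^sup>2))"
  proof (rule AE_I2)
    fix t
    have "0 \<le> (\<kappa> * t - Re A)\<^sup>2 / (2 * \<kappa>)" using assms by simp
    also have "\<dots> = (Re A)\<^sup>2 / (2 * \<kappa>) + \<kappa> / 2 * t\<^sup>2 - t * Re A"
      using assms by (simp add: field_simps power2_eq_square)
    finally have "- (\<kappa> * t\<^sup>2) + t * Re A \<le> (Re A)\<^sup>2 / (2 * \<kappa>) + - (\<kappa> / 2) * t\<^sup>2"
      by simp
    then show "norm (exp (- of_real (\<kappa> * t\<^sup>2) + of_real t * A))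
      \<le> norm (exp ((Re A)\<^sup>2 / (2 * \<kappa>)) * exp (- (\<kappa> / 2) * t\<^sup>2))"
      by (simp flip: exp_add)
  qed
qed simp

text \<open>Completing the square turns the integrand into a multiple of the derivative of
  \<open>erfc\<close> along a horizontal line. Both integrals are therefore boundary differences of
  the single primitive \<open>H\<close>, and a complex \<open>A\<close> requires no shift of
  contour. \<open>K\<close> contains the factor 1/2 because \<open>erfc\<close> runs between 2 and 0
  along such a line.\<close>

lemma
  fixes \<sigma> :: real and A :: complex
  assumes "\<sigma> > 0"
  shows gaussian_integral_exp_linear:
      "(\<integral>t. exp (- of_real (t\<^sup>2 / (2 * \<sigma>\<^sup>2)) + of_real t * A) \<partial>lborel)
         = of_real (\<sigma> * sqrt (2 * pi)) * exp ((of_real \<sigma> * A)\<^sup>2 / 2)" (is "?full")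
    and gaussian_half_integral_exp_linear:
      "(\<integral>t. indicator {..<0} t *\<^sub>R exp (- of_real (t\<^sup>2 / (2 * \<sigma>\<^sup>2)) + of_real t * A) \<partial>lborel)
         = of_real (\<sigma> * sqrt (2 * pi)) * exp ((of_real \<sigma> * A)\<^sup>2 / 2)
           * (erfc (of_real \<sigma> * A / of_real (sqrt 2)) / 2)" (is "?half")
proof -
  define \<beta> where "\<beta> = of_real \<sigma> * A / of_real (sqrt 2)"
  define h where "h t = exp (- of_real (t\<^sup>2 / (2 * \<sigma>\<^sup>2)) + of_real t * A)" for t :: real
  define K where "K = of_real (\<sigma> * sqrt (2 * pi)) * exp ((of_real \<sigma> * A)\<^sup>2 / 2) / 2"
  define H where "H t = K * erfc (\<beta> - of_real (t / (sqrt 2 * \<sigma>)))" for t :: real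
  have s2: "complex_of_real (sqrt 2) * of_real (sqrt 2) = 2"
    by (simp flip: of_real_mult)
  have hint: "integrable lborel h"
    using integrable_gaussian_exp_linear[of "1 / (2 * \<sigma>\<^sup>2)" A] assms unfolding h_def by simp
  have ex: "exp ((of_real \<sigma> * A)\<^sup>2 / 2) * exp (- ((\<beta> - of_real (t / (sqrt 2 * \<sigma>)))\<^sup>2)) = h t" for t
  proof -
    have "(of_real \<sigma> * A)\<^sup>2 / 2 + - ((\<beta> - of_real (t / (sqrt 2 * \<sigma>)))\<^sup>2)
        = - of_real (t\<^sup>2 / (2 * \<sigma>\<^sup>2)) + of_real t * A"
      using assms s2 unfolding \<beta>_def power2_eq_square by (simp add: field_simps)
    then show ?thesis unfolding h_def by (metis exp_add)
  qed
  have Hd: "(H has_vector_derivative h t) (at t)" for t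
  proof -
    have "((\<lambda>w. K * erfc (\<beta> - w / of_real (sqrt 2 * \<sigma>))) has_field_derivative
       K * ((- (2 / of_real (sqrt pi)) * exp (- ((\<beta> - of_real t / of_real (sqrt 2 * \<sigma>))\<^sup>2))) * (- (1 / of_real (sqrt 2 * \<sigma>))))) (at (of_real t))"
      using assms by (auto intro!: derivative_eq_intros DERIV_chain2[OF erfc_has_field_derivative] simp: divide_simps)
    moreover have "K * ((- (2 / of_real (sqrt pi)) * exp (- ((\<beta> - of_real t / of_real (sqrt 2 * \<sigma>))\<^sup>2))) * (- (1 / of_real (sqrt 2 * \<sigma>))))
       = exp ((of_real \<sigma> * A)\<^sup>2 / 2) * exp (- ((\<beta> - of_real (t / (sqrt 2 * \<sigma>)))\<^sup>2))"
      using assms unfolding K_def by (simp add: real_sqrt_mult field_simps)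
    ultimately show ?thesis
      unfolding H_def ex using has_vector_derivative_real_field[where a=t and s=UNIV] by fastforce
  qed
  have hc: "isCont h t" for t unfolding h_def by (intro continuous_intros) (use assms in auto)
  have top: "(H \<longlongrightarrow> K * 2) at_top"
  proof -
    have "filterlim (\<lambda>t. - (t / (sqrt 2 * \<sigma>))) at_bot at_top"
      using assms by real_asymp
    from tendsto_mult_left[OF filterlim_compose[OF erfc_shift_at_bot[of \<beta>] this], of K]
    show ?thesis by (simp add: H_def[abs_def])
  qed
  have bot: "(H \<longlongrightarrow> 0) at_bot"
  proof -
    have "filterlim (\<lambda>t. - (t / (sqrt 2 * \<sigma>))) at_top at_bot"
      using assms by real_asymp
    from tendsto_mult_left[OF filterlim_compose[OF erfc_shift_at_top[of \<beta>] this], of K]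
    show ?thesis by (simp add: H_def[abs_def])
  qed
  have zero: "(H \<longlongrightarrow> K * erfc \<beta>) (at_left 0)"
    using has_vector_derivative_continuous[OF Hd[of 0]]
    unfolding continuous_within by (auto intro: tendsto_within_subset simp: H_def)
  have "(LBINT t=-\<infinity>..\<infinity>. h t) = K * 2 - 0"
    by (rule interval_integral_FTC_integrable[where F=H])
       (use Hd hc hint top bot in \<open>auto simp: ereal_tendsto_simps set_integrable_def\<close>)
  then show ?full
    by (simp add: interval_lebesgue_integral_def set_lebesgue_integral_def h_def K_def)
  have "set_integrable lborel {..<0} h"
    unfolding set_integrable_def by (intro integrable_mult_indicator hint) auto
  then have "(LBINT t=-\<infinity>..0. h t) = K * erfc \<beta> - 0"
    using ereal_tendsto_simps1(1)[of H _ 0]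
    by (intro interval_integral_FTC_integrable[where F=H])
       (use Hd hc top bot zero in \<open>auto simp: ereal_tendsto_simps zero_ereal_def einterval_eq\<close>)
  then show ?half
    by (simp add: interval_lebesgue_integral_def set_lebesgue_integral_def h_def K_def \<beta>_def zero_ereal_def einterval_eq)
qed

section \<open>The weight as a vertical line integral\<close>

text \<open>Moving a point of the right half plane to the right cannot decrease its modulus. The
  resulting decay |p|^(-L M) of the weight integrand gives absolute convergence on vertical lines
  once \<open>L * M \<ge> 2\<close>.\<close>

lemma norm_pochhammer_ge:
  fixes p :: complex
  assumes "Re p \<ge> 0"
  shows "norm p ^ n \<le> norm (pochhammer p n)"
proof -
  have *: "norm p \<le> norm (p + of_nat i)" for i
    using assms by (intro power2_le_imp_le[OF _ norm_ge_zero]) (auto simp: cmod_power2 intro!: power_mono)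
  have "(\<Prod>i\<in>{0..<n}. norm p) \<le> (\<Prod>i\<in>{0..<n}. norm (p + of_nat i))"
    by (intro prod_mono) (simp add: *)
  then show ?thesis
    by (simp add: pochhammer_prod prod_norm)
qed

lemma pochhammer_nonzero:
  fixes p :: complex
  assumes "Re p > 0"
  shows "pochhammer p n \<noteq> 0"
proof -
  have "p \<noteq> 0" using assms by auto
  then have "0 < norm p ^ n" by simp
  also have "\<dots> \<le> norm (pochhammer p n)" using assms by (intro norm_pochhammer_ge) simp
  finally show ?thesis by auto
qed

lemma integrable_Cauchy_density:
  fixes \<kappa> :: real
  assumes "\<kappa> > 0"
  shows "integrable lborel (\<lambda>t::real. 1 / (1 + \<kappa> * t\<^sup>2))"
proof -
  have "integrable lborel (\<lambda>t::real. inverse (1 + t\<^sup>2))"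
    using integrable_inverse_1_plus_square by (simp add: set_integrable_def)
  from lborel_integrable_real_affine[OF this, of "sqrt \<kappa>" 0] show ?thesis
    using assms by (simp add: power_mult_distrib divide_inverse)
qed

text \<open>The integrand is \<open>\<Gamma>(p)\<^sup>M / \<Gamma>(p + L)\<^sup>M |z|\<^sup>-\<^sup>2\<^sup>p\<close> at \<open>p = -s\<close>, so the abscissa may be moved anywhere in
  the right half plane.\<close>

lemma weight_eq_integral:
  assumes "c > 0" "L * M \<ge> 2" "y \<ge> 1" "z \<noteq> 0"
  shows "weight c L M z = 1 / (2 * of_real pi) *
      (\<integral>t. exp (- 2 * (of_real y + \<i> * of_real t) * of_real (ln (cmod z)))
          / pochhammer (of_real y + \<i> * of_real t) L ^ M \<partial>lborel)"
proof -
  define r where "r = ln (cmod z)"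
  define g where "g p = exp (- 2 * p * of_real r) / pochhammer p L ^ M" for p :: complex
  define H where "H = {p :: complex. 0 < Re p}"
  have "g holomorphic_on H"
    unfolding g_def H_def pochhammer_prod
    by (intro holomorphic_intros) (auto simp: pochhammer_nonzero simp flip: pochhammer_prod)
  \<comment> \<open>A primitive on the whole right half plane turns every line integral into a
    difference of values of \<open>G\<close>. Moving the contour then means that the differences at
    the two abscissas have the same limit as T grows.\<close>
  then obtain G where G: "\<And>p. p \<in> H \<Longrightarrow> (G has_field_derivative g p) (at p within H)"
    using holomorphic_convex_primitive'[of H g] unfolding H_def
    by (metis convex_halfspace_Re_gt open_halfspace_Re_gt)
  have G: "(G has_field_derivative g p) (at p)" if "Re p > 0" for p
    using G[of p] that at_within_open[of p H] by (simp add: H_def open_halfspace_Re_gt)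
  have g_bound: "norm (g p) \<le> exp (2 * Re p * \<bar>r\<bar>) / norm p ^ 2" if "Re p > 0" "norm p \<ge> 1" for p
  proof -
    have "- Re p * r \<le> Re p * \<bar>r\<bar>"
      using that by (cases "r \<ge> 0") auto
    then have "norm (exp (- 2 * p * of_real r)) \<le> exp (2 * Re p * \<bar>r\<bar>)"
      by (simp add: mult.commute)
    moreover have "norm p ^ 2 \<le> norm p ^ (L * M)"
      using that assms(2) by (intro power_increasing) auto
    then have "norm p ^ 2 \<le> norm (pochhammer p L ^ M)"
      using power_mono[OF norm_pochhammer_ge[of p L], of M] that by (simp add: norm_power power_mult)
    moreover have "0 < norm p ^ 2" using that by auto
    ultimately show ?thesis
      unfolding g_def norm_divide by (intro frac_le) auto
  qed
  \<comment> \<open>The horizontal sides of the contour, the upper one for \<open>e = 1\<close> and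
    the lower one for \<open>e = -1\<close>: quadratic decay of \<open>g\<close> against the fixed
    length |c - y|.\<close>
  have vanish: "((\<lambda>T. G (Complex c (e * T)) - G (Complex y (e * T))) \<longlongrightarrow> 0) at_top" if "\<bar>e\<bar> = 1" for e :: real
  proof (rule Lim_null_comparison)
    show "((\<lambda>T. exp (2 * (c + y) * \<bar>r\<bar>) / T ^ 2 * \<bar>c - y\<bar>) \<longlongrightarrow> 0) at_top"
      by real_asymp
    show "\<forall>\<^sub>F T in at_top. norm (G (Complex c (e * T)) - G (Complex y (e * T)))
        \<le> exp (2 * (c + y) * \<bar>r\<bar>) / T ^ 2 * \<bar>c - y\<bar>"
      using eventually_ge_at_top[of 1]
    proof eventually_elim
      case (elim T)
      let ?S = "{p. 0 < Re p \<and> Re p \<le> c + y \<and> Im p = e * T}"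
      have "norm (G (Complex c (e * T)) - G (Complex y (e * T)))
        \<le> exp (2 * (c + y) * \<bar>r\<bar>) / T ^ 2 * norm (Complex c (e * T) - Complex y (e * T))"
      proof (rule field_differentiable_bound[where S="?S" and f'=g])
        have eq: "?S = {p. 0 < Re p} \<inter> {p. Re p \<le> c + y} \<inter> {p. Im p \<le> e * T} \<inter> {p. Im p \<ge> e * T}"
          by auto
        show "convex ?S"
          unfolding eq by (intro convex_Int convex_halfspace_Re_gt convex_halfspace_Re_le convex_halfspace_Im_le convex_halfspace_Im_ge)
      next
        fix p assume p: "p \<in> ?S"
        show "(G has_field_derivative g p) (at p within ?S)"
          by (rule has_field_derivative_at_within[OF G]) (use p in auto)
        have T: "T \<le> norm p"
          using abs_Im_le_cmod[of p] p that elim by (auto simp: abs_mult)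
        have "norm (g p) \<le> exp (2 * Re p * \<bar>r\<bar>) / norm p ^ 2"
          using p T elim by (intro g_bound) auto
        also have "\<dots> \<le> exp (2 * (c + y) * \<bar>r\<bar>) / T ^ 2"
          using p T elim by (intro frac_le) (auto intro!: mult_right_mono power_mono)
        finally show "norm (g p) \<le> exp (2 * (c + y) * \<bar>r\<bar>) / T ^ 2" .
      qed (use assms in auto)
      also have "norm (Complex c (e * T) - Complex y (e * T)) = \<bar>c - y\<bar>"
        by (simp add: cmod_def)
      finally show ?case .
    qed
  qed
  define h where "h t = g (of_real y + \<i> * of_real t)" for t :: real
  have G': "((\<lambda>t. G (of_real y + \<i> * of_real t)) has_vector_derivative \<i> * h t) (at t)" for t
  proof -
    have "((\<lambda>w. G (of_real y + \<i> * w)) has_field_derivative g (of_real y + \<i> * of_real t) * \<i>) (at (of_real t))"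
      by (rule DERIV_chain2[OF G]) (use assms in \<open>auto intro!: derivative_eq_intros\<close>)
    from has_vector_derivative_real_field[where a=t and s=UNIV, OF this[THEN has_field_derivative_at_within]]
    show ?thesis by (simp add: h_def mult.commute)
  qed
  have "continuous_on H g" using \<open>g holomorphic_on H\<close> by (rule holomorphic_on_imp_continuous_on)
  then have h_cont: "continuous_on UNIV h"
    unfolding h_def by (rule continuous_on_compose2) (use assms in \<open>auto simp: H_def intro!: continuous_intros\<close>)
  then have [measurable]: "h \<in> borel_measurable borel"
    by (rule borel_measurable_continuous_onI)
  have h_int: "integrable lborel h"
  proof (rule Bochner_Integration.integrable_bound)
    show "integrable lborel (\<lambda>t. exp (2 * y * \<bar>r\<bar>) * (1 / (1 + 1 * t\<^sup>2)))"
      by (intro integrable_mult_right integrable_Cauchy_density) simp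
    show "AE t in lborel. norm (h t) \<le> norm (exp (2 * y * \<bar>r\<bar>) * (1 / (1 + 1 * t\<^sup>2)))"
    proof (rule AE_I2)
      fix t :: real
      let ?p = "of_real y + \<i> * complex_of_real t"
      have n: "norm ?p ^ 2 = y\<^sup>2 + t\<^sup>2" by (simp add: cmod_power2)
      \<comment> \<open>\<open>y \<ge> 1\<close> keeps the whole line outside the open unit disc,
        where \<open>g_bound\<close> applies.\<close>
      have y: "1 \<le> y\<^sup>2" using assms by simp
      then have "1 \<le> norm ?p ^ 2" unfolding n using zero_le_power2[of t] by linarith
      then have "1 \<le> norm ?p" using power2_le_imp_le[of 1 "norm ?p"] by simp
      then have "norm (h t) \<le> exp (2 * y * \<bar>r\<bar>) / (y\<^sup>2 + t\<^sup>2)"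
        using g_bound[of ?p] assms n by (simp add: h_def)
      also have "\<dots> \<le> exp (2 * y * \<bar>r\<bar>) / (1 + t\<^sup>2)"
        using y by (intro divide_left_mono) (auto intro!: mult_pos_pos add_pos_nonneg)
      finally show "norm (h t) \<le> norm (exp (2 * y * \<bar>r\<bar>) * (1 / (1 + 1 * t\<^sup>2)))"
        by simp
    qed
  qed simp
  have "((\<lambda>T. \<integral>t. indicator {- T..T} t *\<^sub>R (\<i> * h t) \<partial>lborel) \<longlongrightarrow> (\<integral>t. \<i> * h t \<partial>lborel)) at_top"
  proof (rule integral_dominated_convergence_at_top[where w="\<lambda>t. norm (h t)"])
    show "AE t in lborel. ((\<lambda>T. indicator {- T..T} t *\<^sub>R (\<i> * h t)) \<longlongrightarrow> \<i> * h t) at_top"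
    proof (rule AE_I2)
      fix t :: real
      show "((\<lambda>T. indicator {- T..T} t *\<^sub>R (\<i> * h t)) \<longlongrightarrow> \<i> * h t) at_top"
        by (rule tendsto_eventually, use eventually_ge_at_top[of "\<bar>t\<bar>"] in eventually_elim) (simp add: indicator_def abs_le_iff)
    qed
    show "\<forall>\<^sub>F T in at_top. AE t in lborel. norm (indicator {- T..T} t *\<^sub>R (\<i> * h t)) \<le> norm (h t)"
      by (auto simp: indicator_def norm_mult intro!: always_eventually)
  qed (use h_int in auto)
  moreover have "\<forall>\<^sub>F T in at_top. (\<integral>t. indicator {- T..T} t *\<^sub>R (\<i> * h t) \<partial>lborel)
      = G (Complex y T) - G (Complex y (- T))"
    using eventually_ge_at_top[of 0]
  proof eventually_elim
    case (elim T)
    have "(\<integral>t. indicator {- T..T} t *\<^sub>R (\<i> * h t) \<partial>lborel)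
       = G (of_real y + \<i> * of_real T) - G (of_real y + \<i> * of_real (- T))"
      using elim h_cont
      by (intro integral_FTC_atLeastAtMost has_vector_derivative_at_within[OF G'] continuous_intros)
        (auto intro: continuous_on_subset)
    then show ?case by (simp add: complex_eq_iff[symmetric] Complex_eq)
  qed
  ultimately have lim_y: "((\<lambda>T. G (Complex y T) - G (Complex y (- T))) \<longlongrightarrow> (\<integral>t. \<i> * h t \<partial>lborel)) at_top"
    by (rule Lim_transform_eventually)
  have lim_c: "((\<lambda>T. G (Complex c T) - G (Complex c (- T))) \<longlongrightarrow> (\<integral>t. \<i> * h t \<partial>lborel)) at_top"
    using tendsto_add[OF lim_y tendsto_diff[OF vanish[of 1] vanish[of "-1"]]] by simp
  have "weight c L M z = 1 / (2 * of_real pi * \<i>) * (\<integral>t. \<i> * h t \<partial>lborel)"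
    unfolding weight_def
  proof (rule tendsto_Lim)
    show "((\<lambda>T. contour_integral (linepath (Complex (- c) (- T)) (Complex (- c) T))
         (\<lambda>s. 1 / (2 * of_real pi * \<i>) * (Gamma (- s) ^ M / Gamma (of_nat L - s) ^ M)
                * of_real (cmod z) powr (2 * s)))
       \<longlongrightarrow> 1 / (2 * of_real pi * \<i>) * (\<integral>t. \<i> * h t \<partial>lborel)) at_top"
    proof (rule Lim_transform_eventually[OF tendsto_mult_left[OF lim_c]], rule always_eventually, rule allI)
      fix T
      let ?l = "linepath (Complex (- c) (- T)) (Complex (- c) T)"
      have Re_line: "Re s = - c" if s: "s \<in> path_image ?l" for s
      proof -
        obtain u where s_eq: "s = (1 - u) *\<^sub>R Complex (- c) (- T) + u *\<^sub>R Complex (- c) T"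
          using s by (auto simp only: closed_segment_def path_image_linepath)
        show ?thesis unfolding s_eq by (simp add: algebra_simps)
      qed
      have "contour_integral ?l (\<lambda>s. 1 / (2 * of_real pi * \<i>) * (Gamma (- s) ^ M / Gamma (of_nat L - s) ^ M)
                * of_real (cmod z) powr (2 * s))
         = contour_integral ?l (\<lambda>s. 1 / (2 * of_real pi * \<i>) * g (- s))"
      proof (rule contour_integral_eq)
        fix s assume "s \<in> path_image ?l"
        then have "Re s = - c" by (rule Re_line)
        then have s: "Re (- s) > 0" using assms by simp
        then have "- s \<notin> \<int>\<^sub>\<le>\<^sub>0"
          using nonpos_Ints_subset_nonpos_Reals by (auto simp: complex_nonpos_Reals_iff)
        from pochhammer_Gamma[OF this, of L] s
        have "pochhammer (- s) L = Gamma (of_nat L - s) / Gamma (- s)" by simp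
        moreover have "of_real (cmod z) powr (2 * s) = exp (- 2 * (- s) * of_real r)"
          using assms by (simp add: powr_def r_def Ln_of_real)
        ultimately show "1 / (2 * of_real pi * \<i>) * (Gamma (- s) ^ M / Gamma (of_nat L - s) ^ M)
                * of_real (cmod z) powr (2 * s) = 1 / (2 * of_real pi * \<i>) * g (- s)"
          by (simp add: g_def power_divide)
      qed
      \<comment> \<open>With p = -s the upward line at -c is traversed downwards at c; the minus
        sign in the primitive of \<open>g (- s)\<close> restores the orientation.\<close>
      also have "\<dots> = - (1 / (2 * of_real pi * \<i>)) * G (- Complex (- c) T) - - (1 / (2 * of_real pi * \<i>)) * G (- Complex (- c) (- T))"
      proof (rule contour_integral_unique)
        have "((\<lambda>s. 1 / (2 * of_real pi * \<i>) * g (- s)) has_contour_integral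
            (\<lambda>s. - (1 / (2 * of_real pi * \<i>)) * G (- s)) (pathfinish ?l) - (\<lambda>s. - (1 / (2 * of_real pi * \<i>)) * G (- s)) (pathstart ?l)) ?l"
        proof (rule contour_integral_primitive[where S="{s. Re s < 0}"])
          fix s :: complex assume "s \<in> {s. Re s < 0}"
          then have "((\<lambda>s. G (- s)) has_field_derivative g (- s) * (- 1)) (at s)"
            by (intro DERIV_chain2[OF G]) (auto intro!: derivative_eq_intros)
          from DERIV_cmult[OF this, of "- (1 / (2 * of_real pi * \<i>))"]
          have "((\<lambda>s. - (1 / (2 * of_real pi * \<i>)) * G (- s)) has_field_derivative 1 / (2 * of_real pi * \<i>) * g (- s)) (at s)"
            by simp
          then show "((\<lambda>s. - (1 / (2 * of_real pi * \<i>)) * G (- s)) has_field_derivative 1 / (2 * of_real pi * \<i>) * g (- s)) (at s within {s. Re s < 0})"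
            by (rule has_field_derivative_at_within)
        next
          show "path_image ?l \<subseteq> {s. Re s < 0}"
            using assms by (auto simp: Re_line)
        qed auto
        then show "((\<lambda>s. 1 / (2 * of_real pi * \<i>) * g (- s)) has_contour_integral
           - (1 / (2 * of_real pi * \<i>)) * G (- Complex (- c) T) - - (1 / (2 * of_real pi * \<i>)) * G (- Complex (- c) (- T))) ?l"
          by simp
      qed
      also have "\<dots> = 1 / (2 * of_real pi * \<i>) * (G (Complex c T) - G (Complex c (- T)))"
      proof -
        have eq: "- Complex (- c) T = Complex c (- T)" "- Complex (- c) (- T) = Complex c T"
          by (auto simp: complex_eq_iff)
        show ?thesis unfolding eq right_diff_distrib by simp
      qed
      finally show "1 / (2 * of_real pi * \<i>) * (G (Complex c T) - G (Complex c (- T))) =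
        contour_integral ?l (\<lambda>s. 1 / (2 * of_real pi * \<i>) * (Gamma (- s) ^ M / Gamma (of_nat L - s) ^ M)
                * of_real (cmod z) powr (2 * s))" by simp
    qed
  qed simp
  also have "(\<integral>t. \<i> * h t \<partial>lborel) = \<i> * (\<integral>t. h t \<partial>lborel)"
    by (rule integral_mult_right_zero)
  finally show ?thesis
    by (simp add: h_def g_def r_def)
qed

section \<open>Limits, sums and determinants\<close>

text \<open>Taylor's formula on the disc of radius 1/2, where |1 + z| is at least 1/2, so the third
  derivative 2 / (1 + z)^3 is bounded by 16; the constant 8 is 16 / 2!.\<close>

lemma Ln_approx_quadratic:
  fixes w :: complex
  assumes "norm w \<le> 1/2"
  shows "norm (Ln (1 + w) - (w - w\<^sup>2 / 2)) \<le> 8 * norm w ^ 3"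
proof -
  define f where "f i z = (if i = 0 then Ln (1 + z) else if i = 1 then 1 / (1 + z)
      else if i = 2 then - 1 / (1 + z)\<^sup>2 else 2 / (1 + z) ^ 3)" for i :: nat and z :: complex
  have half: "1/2 \<le> norm (1 + z)" if "z \<in> cball 0 (1/2)" for z :: complex
    using norm_diff_ineq[of 1 z] that by simp
  have nz: "1 + z \<noteq> 0" if "z \<in> cball 0 (1/2)" for z :: complex
    using half[OF that] by auto
  have "norm (f 0 w - (\<Sum>i\<le>2. f i 0 * (w - 0) ^ i / fact i)) \<le> 16 * norm (w - 0) ^ Suc 2 / fact 2"
  proof (rule complex_Taylor[where S="cball 0 (1/2)"])
    fix i :: nat and z :: complex assume i: "i \<le> 2" and z: "z \<in> cball 0 (1/2)"
    have nr: "1 + z \<notin> \<real>\<^sub>\<le>\<^sub>0"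
      using abs_Re_le_cmod[of z] z by (auto simp: complex_nonpos_Reals_iff)
    consider "i = 0" | "i = 1" | "i = 2" using i by linarith
    then show "(f i has_field_derivative f (Suc i) z) (at z within cball 0 (1/2))"
    proof cases
      case 1
      have "((\<lambda>z. Ln (1 + z)) has_field_derivative inverse (1 + z) * 1) (at z within cball 0 (1/2))"
        by (rule DERIV_chain2[where g="\<lambda>z. 1 + z", OF has_field_derivative_Ln]) (use nr in \<open>auto intro!: derivative_eq_intros\<close>)
      then show ?thesis using 1 by (simp add: f_def[abs_def] inverse_eq_divide)
    next
      case 2
      have "((\<lambda>z. inverse (1 + z)) has_field_derivative - (inverse (1 + z) * 1 * inverse (1 + z))) (at z within cball 0 (1/2))"
        by (rule DERIV_inverse') (use nz[OF z] in \<open>auto intro!: derivative_eq_intros\<close>)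
      then show ?thesis using 2 by (simp add: f_def[abs_def] inverse_eq_divide power2_eq_square)
    next
      case 3
      have "((\<lambda>z. inverse (1 + z) ^ 2) has_field_derivative of_nat 2 * (- (inverse (1 + z) * 1 * inverse (1 + z)) * inverse (1 + z) ^ (2 - Suc 0))) (at z within cball 0 (1/2))"
        by (rule DERIV_power, rule DERIV_inverse') (use nz[OF z] in \<open>auto intro!: derivative_eq_intros\<close>)
      from DERIV_minus[OF this] show ?thesis
        using 3 by (simp add: f_def[abs_def] inverse_eq_divide power3_eq_cube power2_eq_square)
    qed
  next
    fix z :: complex assume z: "z \<in> cball 0 (1/2)"
    have "(1/2) ^ 3 \<le> norm (1 + z) ^ 3" by (intro power_mono half z) simp
    then have "2 / norm (1 + z) ^ 3 \<le> 2 / (1/2) ^ 3"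
      by (intro divide_left_mono) (use nz[OF z] in auto)
    then show "norm (f (Suc 2) z) \<le> 16"
      by (simp add: f_def norm_divide norm_power norm_mult power3_eq_cube)
  qed (use assms in auto)
  moreover have "(\<Sum>i\<le>2. f i 0 * (w - 0) ^ i / fact i) = w - w\<^sup>2 / 2"
  proof -
    have "{..2::nat} = {0, 1, 2}" by auto
    then show ?thesis by (simp add: f_def)
  qed
  moreover have "f 0 w = Ln (1 + w)" by (simp add: f_def)
  moreover have "16 * norm (w - 0) ^ Suc 2 / fact 2 = 8 * norm w ^ 3"
    by simp
  ultimately show ?thesis by simp
qed

text \<open>The exponent minus the logarithm has derivative x (Y - x) / ((1 + x) (1 + Y)), which has
  the sign of x on (-1, Y], so its minimum is at 0. Unlike a Taylor expansion, this keeps a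
  quadratic gain over the whole range of degrees. The cutoff \<open>Y\<close> enters because ln(1 +
  y) eventually exceeds y minus any fixed positive multiple of y^2.\<close>

lemma one_plus_le_exp_quadratic:
  fixes y Y :: real
  assumes "- 1 < y" "y \<le> Y" "0 \<le> Y"
  shows "1 + y \<le> exp (y - y\<^sup>2 / (2 * (1 + Y)))"
proof -
  define g where "g y = y - y\<^sup>2 / (2 * (1 + Y)) - ln (1 + y)" for y
  have g': "(g has_real_derivative x * (Y - x) / ((1 + x) * (1 + Y))) (at x)" if "- 1 < x" for x
  proof -
    have "1 - x / (1 + Y) - 1 / (1 + x) = x * (Y - x) / ((1 + x) * (1 + Y))"
      using that assms by (simp add: divide_simps) (simp add: algebra_simps)
    then show ?thesis
      unfolding g_def using that assms
      by (auto intro!: derivative_eq_intros simp: divide_simps) (simp_all add: algebra_simps)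
  qed
  have "g 0 \<le> g y"
  proof (cases "y \<ge> 0")
    case True
    then show ?thesis
    proof (rule DERIV_nonneg_imp_nondecreasing)
      fix x assume "0 \<le> x" "x \<le> y"
      then have "- 1 < x" "0 \<le> x * (Y - x) / ((1 + x) * (1 + Y))"
        using assms by auto
      then show "\<exists>d. (g has_real_derivative d) (at x) \<and> 0 \<le> d"
        using g' by blast
    qed
  next
    case False
    then have "y \<le> 0" by simp
    then show ?thesis
    proof (rule DERIV_nonpos_imp_nonincreasing)
      fix x assume "y \<le> x" "x \<le> 0"
      then have "- 1 < x" "x * (Y - x) / ((1 + x) * (1 + Y)) \<le> 0"
        using assms by (auto intro!: divide_nonpos_pos mult_nonpos_nonneg mult_pos_pos)
      then show "\<exists>d. (g has_real_derivative d) (at x) \<and> d \<le> 0"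
        using g' by blast
    qed
  qed
  then have "ln (1 + y) \<le> y - y\<^sup>2 / (2 * (1 + Y))" by (simp add: g_def)
  then have "exp (ln (1 + y)) \<le> exp (y - y\<^sup>2 / (2 * (1 + Y)))" by simp
  then show ?thesis using assms by simp
qed

text \<open>Telescoping with ln(1 + x) \<le> x from one side and ln(1 - x) \<le> -x from the other.
  The upper bound is shifted to the left by one, hence \<open>a > 1\<close>.\<close>

lemma harmonic_segment_bounds:
  fixes a :: real and n :: nat
  assumes "a > 1"
  shows "ln (a + n) - ln a \<le> (\<Sum>l<n. 1 / (a + l))"
    and "(\<Sum>l<n. 1 / (a + l)) \<le> ln (a + n - 1) - ln (a - 1)"
proof -
  show "ln (a + n) - ln a \<le> (\<Sum>l<n. 1 / (a + l))"
  proof (induction n)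
    case (Suc n)
    have "ln (a + Suc n) - ln (a + n) = ln (1 + 1 / (a + n))"
      using assms by (subst ln_divide_pos[symmetric]) (auto simp: field_simps)
    also have "\<dots> \<le> 1 / (a + n)"
      using assms by (intro ln_add_one_self_le_self) auto
    finally show ?case using Suc by simp
  qed simp
  show "(\<Sum>l<n. 1 / (a + l)) \<le> ln (a + n - 1) - ln (a - 1)"
  proof (induction n)
    case (Suc n)
    have "ln (a + n - 1) - ln (a + n) = ln (1 - 1 / (a + n))"
      using assms by (subst ln_divide_pos[symmetric]) (auto simp: field_simps)
    also have "\<dots> \<le> (1 - 1 / (a + n)) - 1"
      using assms by (intro ln_le_minus_one) auto
    finally have "1 / (a + n) \<le> ln (a + n) - ln (a + n - 1)" by simp
    then show ?case using Suc by (simp add: algebra_simps)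
  qed simp
qed

lemma inverse_square_segment_bounds:
  fixes a :: real and n :: nat
  assumes "a > 1"
  shows "1 / a - 1 / (a + n) \<le> (\<Sum>l<n. 1 / (a + l)\<^sup>2)"
    and "(\<Sum>l<n. 1 / (a + l)\<^sup>2) \<le> 1 / (a - 1) - 1 / (a + n - 1)"
proof -
  show "1 / a - 1 / (a + n) \<le> (\<Sum>l<n. 1 / (a + l)\<^sup>2)"
  proof (induction n)
    case (Suc n)
    have "1 / (a + n) - 1 / (a + Suc n) = 1 / ((a + n) * (a + Suc n))"
      using assms by (simp add: divide_simps)
    also have "\<dots> \<le> 1 / ((a + n) * (a + n))"
      using assms by (intro divide_left_mono mult_left_mono mult_pos_pos) auto
    finally show ?case using Suc by (simp add: power2_eq_square)
  qed simp
  show "(\<Sum>l<n. 1 / (a + l)\<^sup>2) \<le> 1 / (a - 1) - 1 / (a + n - 1)"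
  proof (induction n)
    case (Suc n)
    have "1 / ((a + n) * (a + n)) \<le> 1 / ((a + n - 1) * (a + n))"
      using assms by (intro divide_left_mono mult_right_mono mult_pos_pos) auto
    also have "\<dots> = 1 / (a + n - 1) - 1 / (a + n)"
      using assms by (simp add: divide_simps)
    finally show ?case using Suc by (simp add: power2_eq_square algebra_simps)
  qed simp
qed

text \<open>Reduces the local behaviour of A to a product of factors near 1, whose logarithms can be
  expanded and summed.\<close>

lemma pochhammer_ratio:
  fixes a :: complex
  assumes "Re a > 0"
  shows "pochhammer (a + \<zeta>) n / pochhammer a n = (\<Prod>l<n. 1 + \<zeta> / (a + of_nat l))"
proof -
  have nz: "a + of_nat l \<noteq> 0" for l
  proof
    assume "a + of_nat l = 0"
    then have "Re (a + of_nat l) = 0" by simp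
    then show False using assms by simp
  qed
  show ?thesis
    unfolding pochhammer_prod prod_dividef[symmetric] atLeast0LessThan
    using nz by (intro prod.cong) (auto simp: divide_simps)
qed

section \<open>Passage from sums to integrals\<close>

lemma dominated_convergence_eventually:
  fixes f :: "'a \<Rightarrow> 'b::{banach, second_countable_topology}"
  assumes "f \<in> borel_measurable M" "\<And>k. g k \<in> borel_measurable M" "integrable M w"
    and "AE t in M. (\<lambda>k. g k t) \<longlonglongrightarrow> f t"
    and "\<forall>\<^sub>F k in sequentially. \<forall>t. norm (g k t) \<le> w t"
  shows "(\<lambda>k. \<integral>t. g k t \<partial>M) \<longlonglongrightarrow> (\<integral>t. f t \<partial>M)"
proof -
  obtain K where K: "\<And>k t. k \<ge> K \<Longrightarrow> norm (g k t) \<le> w t"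
    using assms(5) by (auto simp: eventually_sequentially)
  have "(\<lambda>k. \<integral>t. g (k + K) t \<partial>M) \<longlonglongrightarrow> (\<integral>t. f t \<partial>M)"
  proof (rule integral_dominated_convergence[OF assms(1,2,3)])
    show "AE t in M. (\<lambda>k. g (k + K) t) \<longlonglongrightarrow> f t"
      using assms(4) by eventually_elim (rule LIMSEQ_ignore_initial_segment)
  qed (use K in auto)
  then show ?thesis by (rule LIMSEQ_offset)
qed

text \<open>The sum becomes the integral of a step function in the variable t = x / s. All these
  integrals are over the same line, so dominated convergence treats the sum over degrees just like
  the weight.\<close>

lemma
  fixes f :: "int \<Rightarrow> complex" and s :: real
  assumes s: "s > 0" and fin: "finite I"
  shows integral_floor_scale:
      "(\<integral>t. (if \<lfloor>s * t\<rfloor> \<in> I then f \<lfloor>s * t\<rfloor> else 0) \<partial>lborel) = (\<Sum>x\<in>I. f x) / of_real s"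
    and measurable_floor_scale:
      "(\<lambda>t. if \<lfloor>s * t\<rfloor> \<in> I then f \<lfloor>s * t\<rfloor> else 0) \<in> borel_measurable borel"
proof -
  define J where "J x = {of_int x / s..<(of_int x + 1) / s}" for x :: int
  have J: "t \<in> J x \<longleftrightarrow> \<lfloor>s * t\<rfloor> = x" for t x
    using s by (auto simp: J_def floor_eq_iff field_simps)
  have "(if \<lfloor>s * t\<rfloor> \<in> I then f \<lfloor>s * t\<rfloor> else 0) = (\<Sum>x\<in>I. indicator (J x) t *\<^sub>R f x)" for t
  proof -
    have "indicator (J x) t *\<^sub>R f x = (if \<lfloor>s * t\<rfloor> = x then f x else 0)" for x
      by (simp add: indicator_def J)
    then show ?thesis using fin by (simp only: sum.delta')
  qed
  then have eq: "(\<lambda>t. if \<lfloor>s * t\<rfloor> \<in> I then f \<lfloor>s * t\<rfloor> else 0) = (\<lambda>t. \<Sum>x\<in>I. indicator (J x) t *\<^sub>R f x)"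
    by (rule ext)
  have *: "has_bochner_integral lborel (\<lambda>t. indicator (J x) t *\<^sub>R f x) (f x / of_real s)" for x
  proof -
    have "of_int x / s \<le> (of_int x + 1) / s" using s by (intro divide_right_mono) auto
    then have "measure lborel (J x) = 1 / s" "emeasure lborel (J x) < \<infinity>" "J x \<in> sets lborel"
      by (auto simp: J_def diff_divide_distrib add_divide_distrib)
    then show ?thesis
      using has_bochner_integral_indicator[of "J x" lborel "f x"] by (simp add: scaleR_conv_of_real divide_inverse mult.commute)
  qed
  show "(\<integral>t. (if \<lfloor>s * t\<rfloor> \<in> I then f \<lfloor>s * t\<rfloor> else 0) \<partial>lborel) = (\<Sum>x\<in>I. f x) / of_real s"
    unfolding eq sum_divide_distrib using * by (intro has_bochner_integral_integral_eq has_bochner_integral_sum)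
  show "(\<lambda>t. if \<lfloor>s * t\<rfloor> \<in> I then f \<lfloor>s * t\<rfloor> else 0) \<in> borel_measurable borel"
    unfolding eq by (simp add: J_def)
qed

lemma csqrt_scale:
  assumes "a > 0"
  shows "csqrt (of_real (a\<^sup>2) * x) = of_real a * csqrt x"
proof (rule csqrt_unique)
  show "(of_real a * csqrt x)\<^sup>2 = of_real (a\<^sup>2) * x"
    by (simp add: power_mult_distrib)
  show "0 < Re (of_real a * csqrt x) \<or> Re (of_real a * csqrt x) = 0 \<and> 0 \<le> Im (of_real a * csqrt x)"
    using csqrt_principal[of x] assms by auto
qed

lemma K_trunc_eq_pochhammer:
  "K_trunc c L M N z1 z2 = 1 / of_real pi * csqrt (weight c L M z1 * weight c L M z2) *
     (\<Sum>j<N. pochhammer (of_nat (j + 1)) L ^ M * (z1 * cnj z2) ^ j)"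
proof -
  have "pochhammer (of_nat (j + 1)) L = Gamma (of_nat (L + j + 1) :: complex) / Gamma (of_nat (j + 1))" for j
    using pochhammer_Gamma[of "of_nat (j + 1) :: complex" L]
    by (simp only: of_nat_in_nonpos_Ints_iff) (simp add: add_ac)
  then show ?thesis
    unfolding K_trunc_def by (simp add: power_divide)
qed

text \<open>Convergence along every convergent sequence of arguments is uniform on a compact set:
  otherwise the points violating it have a convergent subsequence, along which both \<open>f\<close>
  and \<open>l\<close> tend to the same value.\<close>

lemma uniform_limit_compactI:
  fixes f :: "nat \<Rightarrow> 'a::metric_space \<Rightarrow> 'b::metric_space"
  assumes "compact S" "continuous_on S l"
    and lim: "\<And>a x. (\<And>k. a k \<in> S) \<Longrightarrow> x \<in> S \<Longrightarrow> a \<longlonglongrightarrow> x \<Longrightarrow> (\<lambda>k. f k (a k)) \<longlonglongrightarrow> l x"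
  shows "uniform_limit S f l sequentially"
proof (rule uniform_limitI, rule ccontr)
  fix e :: real
  assume "e > 0" and "\<not> (\<forall>\<^sub>F k in sequentially. \<forall>x\<in>S. dist (f k x) (l x) < e)"
  from not_eventually_sequentiallyD[OF this(2)]
  obtain r :: "nat \<Rightarrow> nat" where r: "strict_mono r" "\<And>i. \<exists>x\<in>S. \<not> dist (f (r i) x) (l x) < e" by auto
  then obtain x where x: "\<And>i. x i \<in> S" "\<And>i. \<not> dist (f (r i) (x i)) (l (x i)) < e"
    by metis
  obtain y h where y: "y \<in> S" "strict_mono h" "(x \<circ> h) \<longlonglongrightarrow> y"
    using \<open>compact S\<close> x(1) unfolding compact_def by metis
  define R where "R = r \<circ> h"
  have R: "strict_mono R" unfolding R_def using r(1) y(2) by (rule strict_mono_o)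
  \<comment> \<open>The hypothesis \<open>lim\<close> asks for a full sequence, so the indices
    outside the subsequence are filled with the limit point \<open>y\<close>.\<close>
  define a where "a k = (if k \<in> range R then x (h (inv_into UNIV R k)) else y)" for k
  have aR: "a (R i) = x (h i)" for i
    using strict_mono_imp_inj_on[OF R] by (simp add: a_def)
  have "a \<longlonglongrightarrow> y"
  proof (rule metric_LIMSEQ_I)
    fix d :: real assume "d > 0"
    then obtain I where I: "\<And>i. i \<ge> I \<Longrightarrow> dist (x (h i)) y < d"
      using metric_LIMSEQ_D[OF y(3)] by auto
    show "\<exists>no. \<forall>k\<ge>no. dist (a k) y < d"
    proof (intro exI allI impI)
      fix k assume k: "R I \<le> k"
      show "dist (a k) y < d"
      proof (cases "k \<in> range R")
        case True
        then obtain i where "k = R i" by blast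
        then show ?thesis using k I[of i] R by (simp add: aR strict_mono_less_eq)
      qed (use \<open>d > 0\<close> in \<open>simp add: a_def\<close>)
    qed
  qed
  moreover have "a k \<in> S" for k
    using x(1) y(1) by (simp add: a_def)
  ultimately have "(\<lambda>k. f k (a k)) \<longlonglongrightarrow> l y"
    using y(1) by (intro lim)
  from LIMSEQ_subseq_LIMSEQ[OF this R] have 1: "(\<lambda>i. f (R i) (x (h i))) \<longlonglongrightarrow> l y"
    by (simp add: o_def aR)
  have "(\<lambda>i. l (x (h i))) \<longlonglongrightarrow> l y"
    using continuous_on_tendsto_compose[OF assms(2) y(3)] y(1) x(1) by (simp add: o_def)
  from tendsto_dist[OF 1 this] have "(\<lambda>i. dist (f (R i) (x (h i))) (l (x (h i)))) \<longlonglongrightarrow> 0" by simp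
  then have "\<forall>\<^sub>F i in sequentially. dist (f (R i) (x (h i))) (l (x (h i))) < e"
    using \<open>e > 0\<close> by (rule order_tendstoD(2))
  then show False
    using x(2) by (auto simp: R_def eventually_sequentially)
qed

text \<open>Boundedness of the product is carried through the induction because multiplying two
  uniform limits requires both limits to be bounded.\<close>

lemma uniform_limit_prod:
  fixes f :: "'a \<Rightarrow> 'i \<Rightarrow> 'b \<Rightarrow> 'c::{real_normed_algebra, comm_ring_1}"
  assumes "finite I"
    and "\<And>i. i \<in> I \<Longrightarrow> uniform_limit S (\<lambda>k. f k i) (l i) F"
    and "\<And>i. i \<in> I \<Longrightarrow> bounded (l i ` S)"
  shows "uniform_limit S (\<lambda>k x. \<Prod>i\<in>I. f k i x) (\<lambda>x. \<Prod>i\<in>I. l i x) F \<and> bounded ((\<lambda>x. \<Prod>i\<in>I. l i x) ` S)"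
  using assms
proof (induction I rule: finite_induct)
  case empty
  then show ?case by (auto intro: uniform_limit_const finite_imp_bounded simp: image_constant_conv)
next
  case (insert i I)
  then have 1: "uniform_limit S (\<lambda>k. f k i) (l i) F" "bounded (l i ` S)"
    and 2: "uniform_limit S (\<lambda>k x. \<Prod>i\<in>I. f k i x) (\<lambda>x. \<Prod>i\<in>I. l i x) F" "bounded ((\<lambda>x. \<Prod>i\<in>I. l i x) ` S)"
    by auto
  have "bounded ((\<lambda>x. l i x * (\<Prod>i\<in>I. l i x)) ` S)"
  proof -
    obtain A B where A: "\<And>x. x \<in> S \<Longrightarrow> norm (l i x) \<le> A" and B: "\<And>x. x \<in> S \<Longrightarrow> norm (\<Prod>i\<in>I. l i x) \<le> B"
      using 1(2) 2(2) unfolding bounded_iff by blast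
    have "norm (l i x * (\<Prod>i\<in>I. l i x)) \<le> A * B" if "x \<in> S" for x
      using order_trans[OF norm_ge_zero A[OF that]]
      by (intro order_trans[OF norm_mult_ineq] mult_mono A B that) auto
    then show ?thesis unfolding bounded_iff by blast
  qed
  then show ?case
    using uniform_lim_mult[OF 1(1) 2(1) 1(2) 2(2)] insert.hyps by simp
qed

lemma uniform_limit_sum:
  fixes f :: "'a \<Rightarrow> 'i \<Rightarrow> 'b \<Rightarrow> 'c::real_normed_vector"
  assumes "\<And>i. i \<in> I \<Longrightarrow> uniform_limit S (\<lambda>k. f k i) (l i) F"
  shows "uniform_limit S (\<lambda>k x. \<Sum>i\<in>I. f k i x) (\<lambda>x. \<Sum>i\<in>I. l i x) F"
  using assms
  by (induction I rule: infinite_finite_induct) (auto intro: uniform_limit_const uniform_limit_add)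

section \<open>Determinants under limits and under conjugation\<close>

lemma det_mat:
  "Determinant.det (Matrix.mat n n (\<lambda>(i, j). A i j)) = (\<Sum>p | p permutes {0..<n}. signof p * (\<Prod>i = 0..<n. A i (p i)))"
  by (subst det_def'[of _ n]) (auto intro!: sum.cong prod.cong simp: permutes_in_image)

lemma uniform_limit_det:
  fixes E :: "'a \<Rightarrow> 'b \<Rightarrow> nat \<Rightarrow> nat \<Rightarrow> complex"
  assumes "\<And>i j. i < n \<Longrightarrow> j < n \<Longrightarrow> uniform_limit S (\<lambda>k v. E k v i j) (\<lambda>v. G v i j) F"
    and "\<And>i j. i < n \<Longrightarrow> j < n \<Longrightarrow> bounded ((\<lambda>v. G v i j) ` S)"
  shows "uniform_limit S (\<lambda>k v. Determinant.det (Matrix.mat n n (\<lambda>(i, j). E k v i j)))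
           (\<lambda>v. Determinant.det (Matrix.mat n n (\<lambda>(i, j). G v i j))) F"
  unfolding det_mat
proof (intro uniform_limit_sum)
  fix p assume p: "p \<in> {p. p permutes {0..<n}}"
  have "uniform_limit S (\<lambda>k v. \<Prod>i = 0..<n. E k v i (p i)) (\<lambda>v. \<Prod>i = 0..<n. G v i (p i)) F"
    using p by (intro uniform_limit_prod[THEN conjunct1] assms) (auto simp: permutes_in_image)
  then show "uniform_limit S (\<lambda>k v. signof p * (\<Prod>i = 0..<n. E k v i (p i))) (\<lambda>v. signof p * (\<Prod>i = 0..<n. G v i (p i))) F"
    by (rule bounded_linear.uniform_limit[OF bounded_linear_mult_right])
qed

text \<open>Conjugation by a diagonal matrix of phases, together with a diagonal scaling. In the
  Leibniz expansion every index occurs once as a row and once as a column, so each \<phi> meets its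
  conjugate and each \<open>x i\<close> appears squared.\<close>

lemma det_conjugate_phases:
  fixes A :: "nat \<Rightarrow> nat \<Rightarrow> complex"
  assumes "\<And>i. i < n \<Longrightarrow> cmod (\<phi> i) = 1"
  shows "Determinant.det (Matrix.mat n n (\<lambda>(i, j). of_real (C * x i * x j) * A i j * \<phi> i * cnj (\<phi> j)))
    = of_real (C ^ n * (\<Prod>i<n. x i)\<^sup>2) * Determinant.det (Matrix.mat n n (\<lambda>(i, j). A i j))"
  unfolding det_mat sum_distrib_left
proof (intro sum.cong refl)
  fix p assume "p \<in> {p. p permutes {0..<n}}"
  then have p: "p permutes {0..<n}" by simp
  have 1: "(\<Prod>i = 0..<n. complex_of_real (x (p i))) = (\<Prod>i = 0..<n. of_real (x i))"
    "(\<Prod>i = 0..<n. cnj (\<phi> (p i))) = (\<Prod>i = 0..<n. cnj (\<phi> i))"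
    using prod.permute[OF p, of "\<lambda>i. complex_of_real (x i)"] prod.permute[OF p, of "\<lambda>i. cnj (\<phi> i)"]
    by (simp_all add: o_def)
  have 2: "(\<Prod>i = 0..<n. \<phi> i) * (\<Prod>i = 0..<n. cnj (\<phi> i)) = 1"
    using assms by (simp add: complex_norm_square[symmetric] flip: prod.distrib)
  have "(\<Prod>i = 0..<n. of_real (C * x i * x (p i)) * A i (p i) * \<phi> i * cnj (\<phi> (p i)))
      = of_real C ^ n * (\<Prod>i = 0..<n. of_real (x i)) * (\<Prod>i = 0..<n. complex_of_real (x (p i)))
        * ((\<Prod>i = 0..<n. \<phi> i) * (\<Prod>i = 0..<n. cnj (\<phi> (p i)))) * (\<Prod>i = 0..<n. A i (p i))"
    by (simp add: prod.distrib)
  also have "\<dots> = of_real (C ^ n * (\<Prod>i<n. x i)\<^sup>2) * (\<Prod>i = 0..<n. A i (p i))"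
    unfolding 1 2 by (simp add: power2_eq_square atLeast0LessThan)
  finally show "signof p * (\<Prod>i = 0..<n. of_real (C * x i * x (p i)) * A i (p i) * \<phi> i * cnj (\<phi> (p i)))
      = of_real (C ^ n * (\<Prod>i<n. x i)\<^sup>2) * (signof p * (\<Prod>i = 0..<n. A i (p i)))"
    by (simp add: mult_ac)
qed

section \<open>Continuity of the limiting kernels\<close>

lemma continuous_on_erfc: "continuous_on UNIV erfc"
  using erfc_has_field_derivative by (intro continuous_at_imp_continuous_on ballI DERIV_isCont)

lemma continuous_on_K_bulk: "continuous_on UNIV (\<lambda>(v1, v2). K_bulk v1 v2)"
  unfolding K_bulk_def case_prod_unfold by (intro continuous_intros)

lemma continuous_on_K_edge: "continuous_on UNIV (\<lambda>(v1, v2). K_edge \<theta> v1 v2)"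
  unfolding K_edge_def case_prod_unfold
  by (intro continuous_intros continuous_on_compose2[OF continuous_on_erfc]) auto

section \<open>Saddle point asymptotics of the kernel\<close>

locale ginibre_scaling =
  fixes L M N :: "nat \<Rightarrow> nat" and \<tau> q :: real
  assumes L_pos: "\<And>k. L k \<ge> 1" and M_pos: "\<And>k. M k \<ge> 1" and N_pos: "\<And>k. N k \<ge> 1"
    and MN_top: "filterlim (\<lambda>k. M k + N k) at_top sequentially"
    and MN_lim: "(\<lambda>k. real (M k) / real (N k)) \<longlonglongrightarrow> 0"
    and LN_lim: "(\<lambda>k. real (L k) / real (N k)) \<longlonglongrightarrow> \<tau>"
    and \<tau>_pos: "\<tau> > 0" and q_pos: "0 < q" and q_le: "q \<le> 1"
begin

text \<open>\<open>m\<close> is the saddle point, common to the weight and to the sum over the degree, \<open>s\<close> (up to the constant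
  \<open>\<sigma>\<close>) is the width of the saddle, and \<open>exp (- lam) = |u|\<^sup>2\<close>.\<close>

definition "s k = sqrt (real (N k) / real (M k))"
definition "m k = nat \<lfloor>q * real (N k)\<rfloor>"
definition "lam k = ln (1 + real (L k) / (q * real (N k)))"
definition "\<sigma> = sqrt (q * (\<tau> + q) / \<tau>)"
text \<open>\<open>S1\<close> and \<open>S2\<close> are the first derivative and the negated second
  derivative of log A at \<open>m\<close>.\<close>

definition "S1 k = (\<Sum>l<L k. 1 / (real (m k) + real l))"
definition "S2 k = (\<Sum>l<L k. 1 / (real (m k) + real l)\<^sup>2)"

section \<open>Limits of the scales\<close>

lemma pos [simp]: "L k > 0" "M k > 0" "N k > 0"
  using L_pos[of k] M_pos[of k] N_pos[of k] by auto

lemma \<sigma>_pos: "\<sigma> > 0"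
  using \<tau>_pos q_pos by (simp add: \<sigma>_def)

lemma \<sigma>_sq: "\<sigma>\<^sup>2 = q * (\<tau> + q) / \<tau>"
  using \<tau>_pos q_pos by (simp add: \<sigma>_def)

lemma s_pos: "s k > 0"
  using M_pos[of k] N_pos[of k] by (simp add: s_def)

lemma s_sq: "real (M k) * (s k)\<^sup>2 = real (N k)"
  using M_pos[of k] by (simp add: s_def)

lemma N_top: "filterlim (\<lambda>k. real (N k)) at_top sequentially"
proof -
  have "filterlim (\<lambda>k. real (M k + N k)) at_top sequentially"
    using filterlim_compose[OF filterlim_real_sequentially MN_top] .
  then have "filterlim (\<lambda>k. 1/2 * real (M k + N k)) at_top sequentially"
    by (rule filterlim_tendsto_pos_mult_at_top[OF tendsto_const, rotated]) simp
  moreover have "\<forall>\<^sub>F k in sequentially. 1/2 * real (M k + N k) \<le> real (N k)"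
    using order_tendstoD(2)[OF MN_lim, of 1]
  proof (rule eventually_mono)
    fix k assume "real (M k) / real (N k) < 1"
    then have "real (M k) < real (N k)" using N_pos[of k] by (simp add: field_simps)
    then show "1/2 * real (M k + N k) \<le> real (N k)" by simp
  qed simp
  ultimately show ?thesis by (rule filterlim_at_top_mono)
qed

lemma s_top: "filterlim s at_top sequentially"
proof -
  have "filterlim (\<lambda>k. inverse (real (M k) / real (N k))) at_top sequentially"
    using MN_lim M_pos N_pos by (intro filterlim_inverse_at_top always_eventually) (auto simp: Suc_le_eq)
  then show ?thesis
    unfolding s_def by (intro filterlim_compose[OF sqrt_at_top]) (simp add: inverse_eq_divide)
qed

lemma inverse_s_lim: "(\<lambda>k. 1 / s k) \<longlonglongrightarrow> 0"
  using tendsto_inverse_0_at_top[OF s_top] by (simp add: inverse_eq_divide)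

lemma m_bounds: "q * real (N k) - 1 < real (m k)" "real (m k) \<le> q * real (N k)"
  using q_pos by (auto simp: m_def)

lemma m_le_N: "m k \<le> N k"
proof -
  have "real (m k) \<le> q * real (N k)" by (rule m_bounds)
  also have "\<dots> \<le> 1 * real (N k)" using q_le by (intro mult_right_mono) auto
  finally show ?thesis by simp
qed

lemma m_N_lim: "(\<lambda>k. real (m k) / real (N k)) \<longlonglongrightarrow> q"
proof (rule tendsto_sandwich)
  show "(\<lambda>k. q - 1 / real (N k)) \<longlonglongrightarrow> q"
    using tendsto_diff[OF tendsto_const tendsto_inverse_0_at_top[OF N_top], of q] by (simp add: inverse_eq_divide)
  show "\<forall>\<^sub>F k in sequentially. q - 1 / real (N k) \<le> real (m k) / real (N k)"
  proof (rule always_eventually, rule allI)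
    fix k show "q - 1 / real (N k) \<le> real (m k) / real (N k)"
      using divide_right_mono[OF less_imp_le[OF m_bounds(1)[of k]], of "real (N k)"] by (simp add: diff_divide_distrib)
  qed
  show "\<forall>\<^sub>F k in sequentially. real (m k) / real (N k) \<le> q"
  proof (rule always_eventually, rule allI)
    fix k show "real (m k) / real (N k) \<le> q"
      using m_bounds(2)[of k] N_pos[of k] by (simp add: field_simps)
  qed
qed (rule tendsto_const)

lemma m_top: "filterlim (\<lambda>k. real (m k)) at_top sequentially"
proof -
  have "filterlim (\<lambda>k. real (m k) / real (N k) * real (N k)) at_top sequentially"
    by (rule filterlim_tendsto_pos_mult_at_top[OF m_N_lim q_pos N_top])
  moreover have "real (m k) / real (N k) * real (N k) = real (m k)" for k
    using N_pos[of k] by simp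
  ultimately show ?thesis by simp
qed

lemma s_N_lim: "(\<lambda>k. s k / real (N k)) \<longlonglongrightarrow> 0"
proof (rule Lim_null_comparison[OF always_eventually inverse_s_lim], rule allI)
  fix k
  have "s k / real (N k) = 1 / (s k * real (M k))"
    using s_sq[of k] s_pos[of k] M_pos[of k] by (simp add: field_simps power2_eq_square flip: s_sq)
  also have "\<dots> \<le> 1 / s k"
    using s_pos[of k] M_pos[of k] by (intro divide_left_mono) auto
  finally show "norm (s k / real (N k)) \<le> 1 / s k" using s_pos[of k] by simp
qed

lemma s_m_lim: "(\<lambda>k. s k / real (m k)) \<longlonglongrightarrow> 0"
proof -
  have "(\<lambda>k. (s k / real (N k)) / (real (m k) / real (N k))) \<longlonglongrightarrow> 0 / q"
    using q_pos by (intro tendsto_intros s_N_lim m_N_lim) auto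
  moreover have "(s k / real (N k)) / (real (m k) / real (N k)) = s k / real (m k)" for k
    using N_pos[of k] by simp
  ultimately show ?thesis by simp
qed

lemma m_minus_1_lim: "(\<lambda>k. (real (m k) - 1) / real (N k)) \<longlonglongrightarrow> q"
  using tendsto_diff[OF m_N_lim tendsto_inverse_0_at_top[OF N_top]] by (simp add: inverse_eq_divide diff_divide_distrib)

lemma eventually_m_gt_1: "\<forall>\<^sub>F k in sequentially. real (m k) > 1"
  using m_top[unfolded filterlim_at_top_dense] by blast

text \<open>The saddle point equation with its error. \<open>lam\<close> is what \<open>S1\<close>
  becomes when the sum is replaced by an integral and \<open>m\<close> by q N. Both replacements
  decrease it; on the other side, the shift by one in the integral comparison and the rounding of q
  N each contribute at most 1 to the numerator 2.\<close>

lemma S1_bounds: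
  assumes "real (m k) > 1"
  shows "0 \<le> S1 k - lam k" "S1 k - lam k \<le> 2 / (real (m k) - 1)"
proof -
  have qN: "q * real (N k) > 0" using q_pos N_pos[of k] by simp
  have lam: "lam k = ln (q * real (N k) + real (L k)) - ln (q * real (N k))"
    unfolding lam_def using qN
    by (subst ln_divide_pos[symmetric]) (auto simp: add_divide_distrib add_pos_nonneg)
  have "lam k \<le> ln (1 + real (L k) / real (m k))"
  proof -
    have "real (L k) / (q * real (N k)) \<le> real (L k) / real (m k)"
      using assms m_bounds[of k] by (intro divide_left_mono) auto
    then show ?thesis
      unfolding lam_def using qN by (intro ln_mono) (auto intro!: add_pos_nonneg)
  qed
  also have "\<dots> = ln (real (m k) + real (L k)) - ln (real (m k))"
    using assms by (subst ln_divide_pos[symmetric]) (auto simp: field_simps add_pos_nonneg)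
  also have "\<dots> \<le> S1 k"
    unfolding S1_def using harmonic_segment_bounds(1)[of "real (m k)" "L k"] assms by simp
  finally show "0 \<le> S1 k - lam k" by simp
  have "ln (real (m k) + real (L k) - 1) \<le> ln (q * real (N k) + real (L k))"
    using assms m_bounds[of k] by simp
  moreover have "ln (q * real (N k)) - ln (real (m k) - 1) \<le> 2 / (real (m k) - 1)"
  proof -
    have "ln (q * real (N k)) - ln (real (m k) - 1) = ln (q * real (N k) / (real (m k) - 1))"
      using assms qN by (simp add: ln_divide_pos)
    also have "\<dots> \<le> q * real (N k) / (real (m k) - 1) - 1"
      using assms qN by (intro ln_le_minus_one) auto
    also have "\<dots> \<le> 2 / (real (m k) - 1)"
    proof -
      have "q * real (N k) / (real (m k) - 1) - 1 = (q * real (N k) - (real (m k) - 1)) / (real (m k) - 1)"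
        using assms by (simp add: diff_divide_distrib)
      also have "\<dots> \<le> 2 / (real (m k) - 1)"
        using assms m_bounds(1)[of k] by (intro divide_right_mono) auto
      finally show ?thesis .
    qed
    finally show ?thesis .
  qed
  moreover have "S1 k \<le> ln (real (m k) + real (L k) - 1) - ln (real (m k) - 1)"
    unfolding S1_def using harmonic_segment_bounds(2)[of "real (m k)" "L k"] assms by simp
  ultimately show "S1 k - lam k \<le> 2 / (real (m k) - 1)" unfolding lam by linarith
qed

text \<open>Since M s = N / s, the error 2 / (m - 1) is of order 1 / s after scaling: an integer
  saddle point is as good as the exact one.\<close>

lemma S1_lim: "(\<lambda>k. real (M k) * s k * (S1 k - lam k)) \<longlonglongrightarrow> 0"
proof (rule Lim_null_comparison)
  show "(\<lambda>k. 2 * (1 / ((real (m k) - 1) / real (N k))) * (1 / s k)) \<longlonglongrightarrow> 0"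
  proof -
    have "(\<lambda>k. 2 * (1 / ((real (m k) - 1) / real (N k))) * (1 / s k)) \<longlonglongrightarrow> 2 * (1 / q) * 0"
      using q_pos by (intro tendsto_intros m_minus_1_lim inverse_s_lim) auto
    then show ?thesis by simp
  qed
  show "\<forall>\<^sub>F k in sequentially. norm (real (M k) * s k * (S1 k - lam k))
      \<le> 2 * (1 / ((real (m k) - 1) / real (N k))) * (1 / s k)"
    using eventually_m_gt_1
  proof eventually_elim
    case (elim k)
    have "norm (real (M k) * s k * (S1 k - lam k)) = real (M k) * s k * (S1 k - lam k)"
      using S1_bounds(1)[OF elim] s_pos[of k] by simp
    also have "\<dots> \<le> real (M k) * s k * (2 / (real (m k) - 1))"
      using S1_bounds(2)[OF elim] s_pos[of k] by (intro mult_left_mono) auto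
    also have "\<dots> = 2 * (1 / ((real (m k) - 1) / real (N k))) * (1 / s k)"
      using s_pos[of k] elim by (simp add: power2_eq_square flip: s_sq)
    finally show ?case .
  qed
qed

text \<open>The curvature of the saddle: after scaling by N the sum is a Riemann sum for 1 / x^2
  from q to q + \<tau>, and that integral is 1 / q - 1 / (q + \<tau>). This is where \<sigma> comes
  from.\<close>

lemma S2_lim: "(\<lambda>k. real (N k) * S2 k) \<longlonglongrightarrow> 1 / \<sigma>\<^sup>2"
proof -
  have val: "1 / q - 1 / (q + \<tau>) = 1 / \<sigma>\<^sup>2"
    using \<tau>_pos q_pos by (simp add: \<sigma>_sq divide_simps)
  have scale: "1 / (a / n) - 1 / (a / n + b / n) = n * (1 / a - 1 / (a + b))" for a b n :: real
    by (simp add: right_diff_distrib flip: add_divide_distrib)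
  show ?thesis
  proof (rule tendsto_sandwich)
    show "(\<lambda>k. 1 / (real (m k) / real (N k)) - 1 / (real (m k) / real (N k) + real (L k) / real (N k))) \<longlonglongrightarrow> 1 / \<sigma>\<^sup>2"
      unfolding val[symmetric] using \<tau>_pos q_pos by (intro tendsto_intros m_N_lim LN_lim) auto
    show "(\<lambda>k. 1 / ((real (m k) - 1) / real (N k)) - 1 / ((real (m k) - 1) / real (N k) + real (L k) / real (N k))) \<longlonglongrightarrow> 1 / \<sigma>\<^sup>2"
      unfolding val[symmetric] using \<tau>_pos q_pos by (intro tendsto_intros m_minus_1_lim LN_lim) auto
    show "\<forall>\<^sub>F k in sequentially. 1 / (real (m k) / real (N k)) - 1 / (real (m k) / real (N k) + real (L k) / real (N k)) \<le> real (N k) * S2 k"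
      using eventually_m_gt_1
    proof eventually_elim
      case (elim k)
      have "1 / (real (m k) / real (N k)) - 1 / (real (m k) / real (N k) + real (L k) / real (N k))
          = real (N k) * (1 / real (m k) - 1 / (real (m k) + real (L k)))"
        by (rule scale)
      then show ?case
        using inverse_square_segment_bounds(1)[OF elim, of "L k"] unfolding S2_def
        by (simp add: mult_left_mono del: times_divide_eq_right)
    qed
    show "\<forall>\<^sub>F k in sequentially. real (N k) * S2 k \<le> 1 / ((real (m k) - 1) / real (N k)) - 1 / ((real (m k) - 1) / real (N k) + real (L k) / real (N k))"
      using eventually_m_gt_1
    proof eventually_elim
      case (elim k)
      have "1 / ((real (m k) - 1) / real (N k)) - 1 / ((real (m k) - 1) / real (N k) + real (L k) / real (N k))
          = real (N k) * (1 / (real (m k) - 1) - 1 / (real (m k) + real (L k) - 1))"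
        unfolding scale by (simp add: algebra_simps)
      then show ?case
        using inverse_square_segment_bounds(2)[OF elim, of "L k"] unfolding S2_def
        by (simp add: mult_left_mono del: times_divide_eq_right)
    qed
  qed
qed

text \<open>Both the vertical integral for the weight and the sum over the degree are Laplace integrals for
  the same function, so its expansion at \<open>m\<close> is needed once, for complex displacements \<open>\<zeta>\<close>.\<close>

lemma pochhammer_ratio_lim:
  fixes \<zeta> :: "nat \<Rightarrow> complex"
  assumes lim: "(\<lambda>k. \<zeta> k / of_real (s k)) \<longlonglongrightarrow> z"
  shows "(\<lambda>k. (pochhammer (of_nat (m k) + \<zeta> k) (L k) / pochhammer (of_nat (m k)) (L k)) ^ M k
            * exp (- of_real (real (M k) * lam k) * \<zeta> k))
         \<longlonglongrightarrow> exp (- (z\<^sup>2 / of_real (2 * \<sigma>\<^sup>2)))"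
proof -
  define w where "w k l = \<zeta> k / (of_nat (m k) + of_nat l)" for k l
  define E where "E k = (\<Sum>l<L k. Ln (1 + w k l) - (w k l - (w k l)\<^sup>2 / 2))" for k
  \<comment> \<open>The total exponent, regrouped so that each term has a visible limit: \<zeta>
    enters only through \<zeta> / s, the linear coefficient is the one of \<open>S1_lim\<close>, and
    M s^2 = N makes the quadratic one N S2.\<close>
  define X where "X k = \<zeta> k / of_real (s k) * of_real (real (M k) * s k * (S1 k - lam k))
     - (\<zeta> k / of_real (s k))\<^sup>2 * of_real (real (N k) * S2 k) / 2 + of_nat (M k) * E k" for k
  have "(\<lambda>k. norm (\<zeta> k / of_real (s k)) * (s k / real (m k))) \<longlonglongrightarrow> norm z * 0"
    by (intro tendsto_intros lim s_m_lim)
  then have "(\<lambda>k. norm (\<zeta> k / of_real (s k)) * (s k / real (m k))) \<longlonglongrightarrow> 0" by simp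
  then have ev: "\<forall>\<^sub>F k in sequentially. norm (\<zeta> k / of_real (s k)) * (s k / real (m k)) < 1/2"
    by (rule order_tendstoD) simp
  have small: "\<forall>\<^sub>F k in sequentially. real (m k) > 1 \<and> norm (\<zeta> k) / real (m k) < 1/2"
    using ev eventually_m_gt_1
  proof eventually_elim
    case (elim k) then show ?case using s_pos[of k] by (simp add: norm_divide)
  qed
  have w_le: "norm (w k l) \<le> norm (\<zeta> k) / real (m k)" if "real (m k) > 1" for k l
  proof -
    have "norm (w k l) = norm (\<zeta> k) / (real (m k) + real l)"
      unfolding w_def norm_divide by (simp flip: of_nat_add)
    also have "\<dots> \<le> norm (\<zeta> k) / real (m k)"
      using that by (intro divide_left_mono) auto
    finally show ?thesis .
  qed
  \<comment> \<open>There are M L cubic errors, each of order (s / N)^3. By M s^2 = N their sum is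
    of order (L / N) (s / N).\<close>
  have E_lim: "(\<lambda>k. of_nat (M k) * E k) \<longlonglongrightarrow> 0"
  proof (rule Lim_null_comparison)
    have "(\<lambda>k. 8 * norm (\<zeta> k / of_real (s k)) ^ 3 * (real (L k) / real (N k)) * (1 / (real (m k) / real (N k)) ^ 3) * (s k / real (N k)))
        \<longlonglongrightarrow> 8 * norm z ^ 3 * \<tau> * (1 / q ^ 3) * 0"
      using q_pos by (intro tendsto_intros lim LN_lim m_N_lim s_N_lim) auto
    then show "(\<lambda>k. 8 * norm (\<zeta> k / of_real (s k)) ^ 3 * (real (L k) / real (N k)) * (1 / (real (m k) / real (N k)) ^ 3) * (s k / real (N k)))
        \<longlonglongrightarrow> 0" by simp
    show "\<forall>\<^sub>F k in sequentially. norm (of_nat (M k) * E k)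
       \<le> 8 * norm (\<zeta> k / of_real (s k)) ^ 3 * (real (L k) / real (N k)) * (1 / (real (m k) / real (N k)) ^ 3) * (s k / real (N k))"
      using small
    proof eventually_elim
      case (elim k)
      have "norm (E k) \<le> (\<Sum>l<L k. 8 * (norm (\<zeta> k) / real (m k)) ^ 3)"
        unfolding E_def
      proof (rule sum_norm_le)
        fix l
        have "norm (Ln (1 + w k l) - (w k l - (w k l)\<^sup>2 / 2)) \<le> 8 * norm (w k l) ^ 3"
          using w_le[of k l] elim by (intro Ln_approx_quadratic) linarith
        also have "\<dots> \<le> 8 * (norm (\<zeta> k) / real (m k)) ^ 3"
          using w_le[of k l] elim by (intro mult_left_mono power_mono) auto
        finally show "norm (Ln (1 + w k l) - (w k l - (w k l)\<^sup>2 / 2)) \<le> 8 * (norm (\<zeta> k) / real (m k)) ^ 3" .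
      qed
      then have "norm (of_nat (M k) * E k) \<le> real (M k) * (real (L k) * (8 * (norm (\<zeta> k) / real (m k)) ^ 3))"
        by (simp add: norm_mult mult_left_mono)
      also have "\<dots> = 8 * norm (\<zeta> k / of_real (s k)) ^ 3 * (real (L k) / real (N k)) * (1 / (real (m k) / real (N k)) ^ 3) * (s k / real (N k))"
      proof -
        have "M' * (L' * (8 * (a / m') ^ 3)) = 8 * (a / s') ^ 3 * (L' / (M' * s'\<^sup>2)) * (1 / (m' / (M' * s'\<^sup>2)) ^ 3) * (s' / (M' * s'\<^sup>2))"
          if "s' > 0" "M' > 0" "m' > 0" for M' L' a m' s' :: real
          using that by (simp add: divide_simps power2_eq_square power3_eq_cube)
        from this[of "s k" "real (M k)" "real (m k)" "real (L k)" "norm (\<zeta> k)"] show ?thesis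
          using s_pos[of k] elim by (simp add: norm_divide s_sq)
      qed
      finally show ?case .
    qed
  qed
  have X_lim: "X \<longlonglongrightarrow> z * of_real 0 - z\<^sup>2 * of_real (1 / \<sigma>\<^sup>2) / 2 + 0"
    unfolding X_def by (intro tendsto_intros lim S1_lim S2_lim E_lim) auto
  have "\<forall>\<^sub>F k in sequentially. exp (X k) = (pochhammer (of_nat (m k) + \<zeta> k) (L k) / pochhammer (of_nat (m k)) (L k)) ^ M k
            * exp (- of_real (real (M k) * lam k) * \<zeta> k)"
    using small
  proof eventually_elim
    case (elim k)
    have "1 + w k l \<noteq> 0" for l
    proof
      assume "1 + w k l = 0"
      then have "w k l = - 1" by (simp add: add_eq_0_iff)
      then have "norm (w k l) = 1" by simp
      then show False using w_le[of k l] elim by linarith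
    qed
    then have "pochhammer (of_nat (m k) + \<zeta> k) (L k) / pochhammer (of_nat (m k)) (L k) = exp (\<Sum>l<L k. Ln (1 + w k l))"
      using elim by (subst pochhammer_ratio) (auto simp: exp_sum w_def)
    also have "(\<Sum>l<L k. Ln (1 + w k l)) = (\<Sum>l<L k. w k l) - (\<Sum>l<L k. (w k l)\<^sup>2) / 2 + E k"
      by (simp add: E_def sum_subtractf sum_divide_distrib)
    also have "(\<Sum>l<L k. w k l) = \<zeta> k * of_real (S1 k)"
      by (simp add: w_def S1_def sum_distrib_left)
    also have "(\<Sum>l<L k. (w k l)\<^sup>2) = (\<zeta> k)\<^sup>2 * of_real (S2 k)"
      by (simp add: w_def S2_def sum_distrib_left power_divide)
    finally have ratio: "pochhammer (of_nat (m k) + \<zeta> k) (L k) / pochhammer (of_nat (m k)) (L k)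
        = exp (\<zeta> k * of_real (S1 k) - (\<zeta> k)\<^sup>2 * of_real (S2 k) / 2 + E k)" .
    have "(pochhammer (of_nat (m k) + \<zeta> k) (L k) / pochhammer (of_nat (m k)) (L k)) ^ M k
            * exp (- of_real (real (M k) * lam k) * \<zeta> k)
        = exp (of_nat (M k) * (\<zeta> k * of_real (S1 k) - (\<zeta> k)\<^sup>2 * of_real (S2 k) / 2 + E k)
            + - of_real (real (M k) * lam k) * \<zeta> k)"
      unfolding ratio by (simp only: exp_add exp_of_nat_mult)
    also have "of_nat (M k) * (\<zeta> k * of_real (S1 k) - (\<zeta> k)\<^sup>2 * of_real (S2 k) / 2 + E k)
            + - of_real (real (M k) * lam k) * \<zeta> k = X k"
    proof -
      have "M' * (a * S1' - a\<^sup>2 * S2' / 2 + E') + - (M' * lam') * a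
          = a / s' * (M' * s' * (S1' - lam')) - (a / s')\<^sup>2 * (M' * s'\<^sup>2 * S2') / 2 + M' * E'"
        if "s' \<noteq> 0" for M' a S1' S2' E' lam' s' :: complex
        using that by (simp add: field_simps power2_eq_square)
      from this[of "of_real (s k)" "of_real (real (M k))" "\<zeta> k" "of_real (S1 k)" "of_real (S2 k)" "E k" "of_real (lam k)"]
      show ?thesis
        unfolding X_def s_sq[symmetric] using s_pos[of k] by simp
    qed
    finally show ?case ..
  qed
  moreover have "(\<lambda>k. exp (X k)) \<longlonglongrightarrow> exp (- (z\<^sup>2 / of_real (2 * \<sigma>\<^sup>2)))"
    using tendsto_exp[OF X_lim] by (simp add: mult.commute)
  ultimately show ?thesis by (rule Lim_transform_eventually[rotated])
qed

section \<open>Global bounds for dominated convergence\<close>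

lemma L_top: "filterlim (\<lambda>k. real (L k)) at_top sequentially"
proof -
  have "filterlim (\<lambda>k. real (L k) / real (N k) * real (N k)) at_top sequentially"
    by (rule filterlim_tendsto_pos_mult_at_top[OF LN_lim \<tau>_pos N_top])
  then show ?thesis by simp
qed

text \<open>Each factor of the inverted ratio has squared modulus 1 + (s t)^2 / (m + l)^2, which is
  at least 1 + a, the value at l = L. Hence the squared modulus of its M-th power is at least (1 +
  a)^(L M), and Bernoulli's inequality extracts a term linear in a, that is, quadratic in t. This is
  far weaker than the true decay but integrable.\<close>

lemma pochhammer_ratio_vertical_bound:
  obtains \<kappa> where "\<kappa> > 0"
    "\<forall>\<^sub>F k in sequentially. \<forall>t. norm ((pochhammer (of_nat (m k)) (L k) /
        pochhammer (of_nat (m k) + \<i> * of_real (s k * t)) (L k) :: complex) ^ M k) \<le> 1 / (1 + \<kappa> * t\<^sup>2)"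
proof -
  \<comment> \<open>Half of the limit \<tau> / (4 (q + \<tau>)^2) of the coefficient that the
    estimate produces.\<close>
  define \<kappa> where "\<kappa> = \<tau> / (8 * (q + \<tau>)\<^sup>2)"
  have "\<kappa> > 0" using \<tau>_pos q_pos by (simp add: \<kappa>_def)
  have "(\<lambda>k. real (L k) / real (N k) / (4 * (real (m k) / real (N k) + real (L k) / real (N k))\<^sup>2))
      \<longlonglongrightarrow> \<tau> / (4 * (q + \<tau>)\<^sup>2)"
    using \<tau>_pos q_pos by (intro tendsto_intros LN_lim m_N_lim) auto
  then have "\<forall>\<^sub>F k in sequentially. real (L k) / real (N k) / (4 * (real (m k) / real (N k) + real (L k) / real (N k))\<^sup>2) > \<kappa>"
    by (rule order_tendstoD) (use \<tau>_pos q_pos in \<open>simp add: \<kappa>_def divide_simps\<close>)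
  moreover have "\<forall>\<^sub>F k in sequentially. 2 < real (L k)"
    using L_top[unfolded filterlim_at_top_dense] by blast
  ultimately have "\<forall>\<^sub>F k in sequentially. \<forall>t. norm ((pochhammer (of_nat (m k)) (L k) /
        pochhammer (of_nat (m k) + \<i> * of_real (s k * t)) (L k) :: complex) ^ M k) \<le> 1 / (1 + \<kappa> * t\<^sup>2)"
    using eventually_m_gt_1
  proof eventually_elim
    case (elim k)
    show ?case
    proof
      fix t :: real
      define a where "a = (s k * t)\<^sup>2 / (real (m k) + real (L k))\<^sup>2"
      \<comment> \<open>A natural exponent for the square root of (1 + a)^(L M). The rounding is
        absorbed by L M \<le> 4 h, which holds since L M > 2.\<close>
      define h where "h = (L k * M k) div 2"
      define R :: complex where "R = pochhammer (of_nat (m k) + \<i> * of_real (s k * t)) (L k) / pochhammer (of_nat (m k)) (L k)"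
      have a: "a \<ge> 0" by (simp add: a_def)
      have R_eq: "R = (\<Prod>l<L k. 1 + \<i> * of_real (s k * t) / (of_nat (m k) + of_nat l))"
        unfolding R_def using elim by (intro pochhammer_ratio) simp
      have "(1 + a) ^ L k = (\<Prod>l<L k. 1 + a)" by simp
      also have "\<dots> \<le> (\<Prod>l<L k. (norm (1 + \<i> * complex_of_real (s k * t) / (of_nat (m k) + of_nat l)))\<^sup>2)"
      proof (rule prod_mono, intro conjI)
        fix l assume "l \<in> {..<L k}"
        have "1 + \<i> * complex_of_real (s k * t) / (of_nat (m k) + of_nat l) = Complex 1 (s k * t / (real (m k) + real l))"
          by (simp add: Complex_eq)
        then have "(norm (1 + \<i> * complex_of_real (s k * t) / (of_nat (m k) + of_nat l)))\<^sup>2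
            = 1 + (s k * t)\<^sup>2 / (real (m k) + real l)\<^sup>2"
          by (simp only: cmod_power2 complex.sel power_divide power_one)
        moreover have "a \<le> (s k * t)\<^sup>2 / (real (m k) + real l)\<^sup>2"
          unfolding a_def using elim \<open>l \<in> {..<L k}\<close>
          by (intro divide_left_mono power_mono mult_pos_pos zero_less_power) auto
        ultimately show "1 + a \<le> (norm (1 + \<i> * complex_of_real (s k * t) / (of_nat (m k) + of_nat l)))\<^sup>2" by simp
      qed (use a in simp)
      also have "\<dots> = (norm R)\<^sup>2"
        unfolding R_eq by (simp add: prod_power_distrib flip: prod_norm)
      finally have "((1 + a) ^ L k) ^ M k \<le> ((norm R)\<^sup>2) ^ M k"
        by (intro power_mono) (use a in auto)
      then have "(1 + a) ^ (L k * M k) \<le> (norm (R ^ M k))\<^sup>2"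
        by (simp add: norm_power power_mult mult.commute flip: power_mult)
      moreover have "((1 + a) ^ h)\<^sup>2 \<le> (1 + a) ^ (L k * M k)"
        using a by (simp add: h_def flip: power_mult) (intro power_increasing, auto)
      ultimately have "((1 + a) ^ h)\<^sup>2 \<le> (norm (R ^ M k))\<^sup>2" by (rule order_trans[rotated])
      then have "(1 + a) ^ h \<le> norm (R ^ M k)" by (rule power2_le_imp_le) simp
      moreover have "1 + real h * a \<le> (1 + a) ^ h"
        using a by (intro Bernoulli_inequality) simp
      moreover have "\<kappa> * t\<^sup>2 \<le> real h * a"
      proof -
        have "2 < L k" using elim(2) by linarith
        then have "2 < L k * M k" using pos(2)[of k] by (metis less_le_trans mult_le_mono2 mult.right_neutral Suc_leI One_nat_def)
        then have "L k * M k \<le> 4 * h" unfolding h_def by linarith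
        then have h: "real (L k) * real (M k) / 4 \<le> real h"
          by (metis of_nat_mult of_nat_le_iff of_nat_numeral divide_le_eq mult.commute zero_less_numeral)
        have "\<kappa> * t\<^sup>2 \<le> real (L k) / real (N k) / (4 * (real (m k) / real (N k) + real (L k) / real (N k))\<^sup>2) * t\<^sup>2"
          using elim by (intro mult_right_mono) auto
        also have "\<dots> = real (L k) * real (N k) / (4 * (real (m k) + real (L k))\<^sup>2) * t\<^sup>2"
          by (simp add: power_divide power2_eq_square flip: add_divide_distrib)
        also have "\<dots> = real (L k) * real (M k) / 4 * a"
          unfolding a_def by (simp add: power_mult_distrib flip: s_sq)
        also have "\<dots> \<le> real h * a"
          using h a by (intro mult_right_mono)
        finally show ?thesis .
      qed
      ultimately have le: "1 + \<kappa> * t\<^sup>2 \<le> norm (R ^ M k)" by linarith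
      have "norm ((pochhammer (of_nat (m k)) (L k) / pochhammer (of_nat (m k) + \<i> * of_real (s k * t)) (L k) :: complex) ^ M k)
          = 1 / norm (R ^ M k)"
        by (simp add: R_def norm_divide norm_power power_divide)
      also have "\<dots> \<le> 1 / (1 + \<kappa> * t\<^sup>2)"
      proof -
        have "0 < 1 + \<kappa> * t\<^sup>2" using \<open>\<kappa> > 0\<close> by (intro add_pos_nonneg) auto
        then show ?thesis using le by (intro divide_left_mono mult_pos_pos) linarith+
      qed
      finally show "norm ((pochhammer (of_nat (m k)) (L k) / pochhammer (of_nat (m k) + \<i> * of_real (s k * t)) (L k) :: complex) ^ M k)
          \<le> 1 / (1 + \<kappa> * t\<^sup>2)" .
    qed
  qed
  with \<open>\<kappa> > 0\<close> that show thesis by blast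
qed

text \<open>Displacements as large as \<open>m\<close> occur here, so each factor 1 + y is estimated
  by \<open>one_plus_le_exp_quadratic\<close>. Its lower limit -1 is respected because m + x \<ge>
  1, its upper limit because m + x \<le> N. Summing over l gives S1 and S2; the linear remainder M
  (S1 - lam) is eventually below 1 / s.\<close>

lemma pochhammer_ratio_horizontal_bound:
  obtains \<kappa> where "\<kappa> > 0"
    "\<forall>\<^sub>F k in sequentially. \<forall>x::int. 1 \<le> int (m k) + x \<longrightarrow> int (m k) + x \<le> int (N k) \<longrightarrow>
       norm ((pochhammer (of_nat (m k) + of_int x) (L k) / pochhammer (of_nat (m k)) (L k) :: complex) ^ M k
          * exp (- of_real (real (M k) * lam k) * of_int x))
       \<le> exp (\<bar>of_int x\<bar> / s k - \<kappa> * (of_int x / s k)\<^sup>2)"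
proof -
  \<comment> \<open>y is at most N / m, which tends to 1 / q; \<open>Y\<close> is twice that limit.
    Likewise \<kappa> uses half of the limit 1 / \<sigma>^2 of N S2.\<close>
  define Y where "Y = 2 / q"
  define \<kappa> where "\<kappa> = 1 / (2 * (1 + Y)) * (1 / (2 * \<sigma>\<^sup>2))"
  have Y: "Y > 0" using q_pos by (simp add: Y_def)
  have "\<kappa> > 0" using Y \<sigma>_pos by (simp add: \<kappa>_def)
  have "(\<lambda>k. 1 / (real (m k) / real (N k))) \<longlonglongrightarrow> 1 / q"
    using q_pos by (intro tendsto_intros m_N_lim) auto
  then have ev1: "\<forall>\<^sub>F k in sequentially. 1 / (real (m k) / real (N k)) < Y"
    by (rule order_tendstoD) (use q_pos in \<open>simp add: Y_def divide_strict_right_mono\<close>)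
  have ev2: "\<forall>\<^sub>F k in sequentially. real (M k) * s k * (S1 k - lam k) < 1"
    by (rule order_tendstoD[OF S1_lim]) simp
  have ev3: "\<forall>\<^sub>F k in sequentially. real (N k) * S2 k > 1 / (2 * \<sigma>\<^sup>2)"
    by (rule order_tendstoD[OF S2_lim]) (use \<sigma>_pos in \<open>simp add: divide_simps\<close>)
  have "\<forall>\<^sub>F k in sequentially. \<forall>x::int. 1 \<le> int (m k) + x \<longrightarrow> int (m k) + x \<le> int (N k) \<longrightarrow>
       norm ((pochhammer (of_nat (m k) + of_int x) (L k) / pochhammer (of_nat (m k)) (L k) :: complex) ^ M k
          * exp (- of_real (real (M k) * lam k) * of_int x))
       \<le> exp (\<bar>of_int x\<bar> / s k - \<kappa> * (of_int x / s k)\<^sup>2)"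
    using ev1 ev2 ev3 eventually_m_gt_1
  proof eventually_elim
    case (elim k)
    show ?case
    proof (intro allI impI)
      fix x :: int assume x: "1 \<le> int (m k) + x" "int (m k) + x \<le> int (N k)"
      define y where "y l = of_int x / (real (m k) + real l)" for l
      have "norm (pochhammer (of_nat (m k) + of_int x) (L k) / pochhammer (of_nat (m k)) (L k) :: complex)
          = (\<Prod>l<L k. norm (1 + of_int x / (of_nat (m k) + of_nat l) :: complex))"
        using elim by (subst pochhammer_ratio) (auto simp: prod_norm)
      also have "\<dots> \<le> (\<Prod>l<L k. exp (y l - (y l)\<^sup>2 / (2 * (1 + Y))))"
      proof (rule prod_mono, intro conjI)
        fix l
        have ml: "real (m k) + real l > 0" using elim by simp
        have "real_of_int x \<ge> 1 - real (m k)" using x by linarith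
        then have y1: "- 1 < y l"
          unfolding y_def using ml by (simp add: field_simps)
        have "of_int x \<le> real (N k)" using x by linarith
        then have "y l \<le> real (N k) / (real (m k) + real l)"
          unfolding y_def using ml by (intro divide_right_mono) auto
        also have "\<dots> \<le> real (N k) / real (m k)"
          using elim by (intro divide_left_mono) auto
        also have "\<dots> \<le> Y" using elim by simp
        finally have "1 + y l \<le> exp (y l - (y l)\<^sup>2 / (2 * (1 + Y)))"
          using y1 Y by (intro one_plus_le_exp_quadratic) auto
        moreover have "1 + of_int x / (of_nat (m k) + of_nat l) = complex_of_real (1 + y l)"
          by (simp add: y_def)
        then have "norm (1 + of_int x / (of_nat (m k) + of_nat l) :: complex) = 1 + y l"
          using y1 by (simp only: norm_of_real)
        ultimately show "norm (1 + of_int x / (of_nat (m k) + of_nat l) :: complex) \<le> exp (y l - (y l)\<^sup>2 / (2 * (1 + Y)))"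
          by simp
      qed simp
      also have "\<dots> = exp (of_int x * S1 k - (of_int x)\<^sup>2 * S2 k / (2 * (1 + Y)))"
        unfolding y_def S1_def S2_def
        by (simp add: sum_subtractf sum_distrib_left sum_divide_distrib power_divide flip: exp_sum)
      finally have "norm (pochhammer (of_nat (m k) + of_int x) (L k) / pochhammer (of_nat (m k)) (L k) :: complex) ^ M k
          \<le> exp (of_int x * S1 k - (of_int x)\<^sup>2 * S2 k / (2 * (1 + Y))) ^ M k"
        by (intro power_mono) auto
      then have "norm ((pochhammer (of_nat (m k) + of_int x) (L k) / pochhammer (of_nat (m k)) (L k) :: complex) ^ M k
          * exp (- of_real (real (M k) * lam k) * of_int x))
        \<le> exp (of_int x * S1 k - (of_int x)\<^sup>2 * S2 k / (2 * (1 + Y))) ^ M k * exp (- (real (M k) * lam k) * of_int x)"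
        by (simp add: norm_mult norm_power)
      also have "\<dots> = exp (real (M k) * (of_int x * S1 k - (of_int x)\<^sup>2 * S2 k / (2 * (1 + Y))) + - (real (M k) * lam k) * of_int x)"
        by (simp only: exp_add exp_of_nat_mult)
      also have "\<dots> \<le> exp (\<bar>of_int x\<bar> / s k - \<kappa> * (of_int x / s k)\<^sup>2)"
      proof -
        have 0: "S1 k - lam k \<ge> 0" using S1_bounds elim by simp
        have "real (M k) * (S1 k - lam k) \<le> 1 / s k"
          using elim s_pos[of k] by (simp add: field_simps)
        then have "\<bar>of_int x\<bar> * (real (M k) * (S1 k - lam k)) \<le> \<bar>of_int x\<bar> * (1 / s k)"
          by (intro mult_left_mono) auto
        moreover have "of_int x * (real (M k) * (S1 k - lam k)) \<le> \<bar>of_int x\<bar> * (real (M k) * (S1 k - lam k))"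
          using 0 by (intro mult_right_mono) auto
        ultimately have "of_int x * (real (M k) * (S1 k - lam k)) \<le> \<bar>of_int x\<bar> * (1 / s k)"
          by (rule order_trans[rotated])
        then have 1: "of_int x * (real (M k) * (S1 k - lam k)) \<le> \<bar>of_int x\<bar> / s k"
          by (simp only: times_divide_eq_right mult_1_right)
        have "\<kappa> * (of_int x / s k)\<^sup>2 = 1 / (2 * \<sigma>\<^sup>2) * ((of_int x / s k)\<^sup>2 / (2 * (1 + Y)))"
          by (simp add: \<kappa>_def)
        also have "\<dots> \<le> real (N k) * S2 k * ((of_int x / s k)\<^sup>2 / (2 * (1 + Y)))"
          using elim Y by (intro mult_right_mono) auto
        also have "\<dots> = real (M k) * ((of_int x)\<^sup>2 * S2 k / (2 * (1 + Y)))"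
          using s_pos[of k] by (simp add: power_divide flip: s_sq)
        finally have 2: "\<kappa> * (of_int x / s k)\<^sup>2 \<le> real (M k) * ((of_int x)\<^sup>2 * S2 k / (2 * (1 + Y)))" .
        have "real (M k) * (of_int x * S1 k - (of_int x)\<^sup>2 * S2 k / (2 * (1 + Y))) + - (real (M k) * lam k) * of_int x
           = of_int x * (real (M k) * (S1 k - lam k)) - real (M k) * ((of_int x)\<^sup>2 * S2 k / (2 * (1 + Y)))"
          by (simp add: right_diff_distrib mult_ac)
        then show ?thesis using 1 2 by simp
      qed
      finally show "norm ((pochhammer (of_nat (m k) + of_int x) (L k) / pochhammer (of_nat (m k)) (L k) :: complex) ^ M k
          * exp (- of_real (real (M k) * lam k) * of_int x))
       \<le> exp (\<bar>of_int x\<bar> / s k - \<kappa> * (of_int x / s k)\<^sup>2)" .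
    qed
  qed
  with \<open>\<kappa> > 0\<close> that show thesis by blast
qed

text \<open>On the line Re p = m the factors |z|^(-2 m) and A(m)^(-M) split off. With p = m + i s t
  what remains is the reciprocal ratio times the oscillation exp(-2 i t s Re b), and the limit is
  the Fourier transform of a Gaussian. The weight depends on z only through its modulus, so only the
  real part of the displacement \<open>b\<close> enters.\<close>

lemma weight_lim:
  fixes b z :: "nat \<Rightarrow> complex"
  assumes "c > 0" and b: "(\<lambda>k. of_real (s k) * b k) \<longlonglongrightarrow> \<beta>"
    and z: "\<forall>\<^sub>F k in sequentially. z k \<noteq> 0 \<and> 2 * ln (cmod (z k)) = - (real (M k) * lam k) + 2 * Re (b k)"
  shows "(\<lambda>k. weight c (L k) (M k) (z k) * pochhammer (of_nat (m k)) (L k) ^ M k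
             * of_real (cmod (z k)) ^ (2 * m k) / of_real (s k))
         \<longlonglongrightarrow> of_real (\<sigma> / sqrt (2 * pi) * exp (- 2 * \<sigma>\<^sup>2 * (Re \<beta>)\<^sup>2))"
proof -
  define g where "g k t = (pochhammer (of_nat (m k)) (L k) / pochhammer (of_nat (m k) + \<i> * of_real (s k * t)) (L k)) ^ M k
      * exp (of_real (real (M k) * lam k) * (\<i> * of_real (s k * t))) * exp (of_real t * (- 2 * \<i> * of_real (s k * Re (b k))))"
    for k and t :: real
  define f where "f t = exp (- of_real (t\<^sup>2 / (2 * \<sigma>\<^sup>2)) + of_real t * (- 2 * \<i> * of_real (Re \<beta>)))" for t :: real
  obtain \<kappa> where \<kappa>: "\<kappa> > 0"
    "\<forall>\<^sub>F k in sequentially. \<forall>t. norm ((pochhammer (of_nat (m k)) (L k) /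
        pochhammer (of_nat (m k) + \<i> * of_real (s k * t)) (L k) :: complex) ^ M k) \<le> 1 / (1 + \<kappa> * t\<^sup>2)"
    by (rule pochhammer_ratio_vertical_bound)
  have Re_b: "(\<lambda>k. s k * Re (b k)) \<longlonglongrightarrow> Re \<beta>"
    using tendsto_Re[OF b] by simp
  have "(\<lambda>k. \<integral>t. g k t \<partial>lborel) \<longlonglongrightarrow> (\<integral>t. f t \<partial>lborel)"
  proof (rule dominated_convergence_eventually[where w="\<lambda>t. 1 / (1 + \<kappa> * t\<^sup>2)"])
    show "f \<in> borel_measurable lborel" unfolding f_def by measurable
    show "g k \<in> borel_measurable lborel" for k unfolding g_def pochhammer_prod by measurable
    show "integrable lborel (\<lambda>t. 1 / (1 + \<kappa> * t\<^sup>2))" using \<kappa>(1) by (rule integrable_Cauchy_density)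
    show "\<forall>\<^sub>F k in sequentially. \<forall>t. norm (g k t) \<le> 1 / (1 + \<kappa> * t\<^sup>2)"
      using \<kappa>(2) by eventually_elim (simp add: g_def norm_mult)
    show "AE t in lborel. (\<lambda>k. g k t) \<longlonglongrightarrow> f t"
    proof (rule AE_I2)
      fix t :: real
      have "(\<lambda>k. (\<i> * of_real (s k * t)) / of_real (s k)) \<longlonglongrightarrow> \<i> * of_real t"
        using s_pos by (simp add: less_imp_neq[symmetric])
      \<comment> \<open>For the imaginary displacement i t the square is -t^2: the ratio grows like
        exp(t^2 / (2 \<sigma>^2)), and its reciprocal is the decaying Gaussian.\<close>
      from tendsto_inverse[OF pochhammer_ratio_lim[OF this]]
      have "(\<lambda>k. inverse ((pochhammer (of_nat (m k) + \<i> * of_real (s k * t)) (L k) / pochhammer (of_nat (m k)) (L k)) ^ M k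
            * exp (- of_real (real (M k) * lam k) * (\<i> * of_real (s k * t)))))
         \<longlonglongrightarrow> inverse (exp (- ((\<i> * of_real t)\<^sup>2 / of_real (2 * \<sigma>\<^sup>2))))" by simp
      moreover have "inverse ((pochhammer (of_nat (m k) + \<i> * of_real (s k * t)) (L k) / pochhammer (of_nat (m k)) (L k)) ^ M k
            * exp (- of_real (real (M k) * lam k) * (\<i> * of_real (s k * t))))
          = (pochhammer (of_nat (m k)) (L k) / pochhammer (of_nat (m k) + \<i> * of_real (s k * t)) (L k)) ^ M k
            * exp (of_real (real (M k) * lam k) * (\<i> * of_real (s k * t)))" for k
      proof -
        have "inverse ((p / r) ^ n * exp (- a)) = (r / p) ^ n * exp a" for p r a :: complex and n
          by (simp only: inverse_mult_distrib exp_minus inverse_inverse_eq power_inverse[symmetric] inverse_divide)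
        then show ?thesis unfolding mult_minus_left .
      qed
      moreover have "inverse (exp (- ((\<i> * of_real t)\<^sup>2 / of_real (2 * \<sigma>\<^sup>2)))) = exp (- of_real (t\<^sup>2 / (2 * \<sigma>\<^sup>2)))"
        by (simp add: power_mult_distrib flip: exp_minus)
      ultimately have 1: "(\<lambda>k. (pochhammer (of_nat (m k)) (L k) / pochhammer (of_nat (m k) + \<i> * of_real (s k * t)) (L k)) ^ M k
            * exp (of_real (real (M k) * lam k) * (\<i> * of_real (s k * t)))) \<longlonglongrightarrow> exp (- of_real (t\<^sup>2 / (2 * \<sigma>\<^sup>2)))"
        by simp
      have 2: "(\<lambda>k. exp (of_real t * (- 2 * \<i> * of_real (s k * Re (b k))))) \<longlonglongrightarrow> exp (of_real t * (- 2 * \<i> * of_real (Re \<beta>)))"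
        by (intro tendsto_intros Re_b)
      show "(\<lambda>k. g k t) \<longlonglongrightarrow> f t"
        unfolding g_def f_def exp_add using tendsto_mult[OF 1 2] .
    qed
  qed
  then have "(\<lambda>k. 1 / (2 * of_real pi) * (\<integral>t. g k t \<partial>lborel)) \<longlonglongrightarrow> 1 / (2 * of_real pi) * (\<integral>t. f t \<partial>lborel)"
    by (rule tendsto_mult_left)
  moreover have "1 / (2 * of_real pi) * (\<integral>t. f t \<partial>lborel) = of_real (\<sigma> / sqrt (2 * pi) * exp (- 2 * \<sigma>\<^sup>2 * (Re \<beta>)\<^sup>2))"
  proof -
    have sq: "(of_real \<sigma> * (- 2 * \<i> * of_real (Re \<beta>)))\<^sup>2 / 2 = complex_of_real (- 2 * \<sigma>\<^sup>2 * (Re \<beta>)\<^sup>2)"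
      by (simp add: power_mult_distrib)
    have "(\<integral>t. f t \<partial>lborel) = of_real (\<sigma> * sqrt (2 * pi)) * of_real (exp (- 2 * \<sigma>\<^sup>2 * (Re \<beta>)\<^sup>2))"
      unfolding f_def gaussian_integral_exp_linear[OF \<sigma>_pos] sq exp_of_real ..
    then have "1 / (2 * of_real pi) * (\<integral>t. f t \<partial>lborel)
        = complex_of_real (1 / (2 * pi) * (\<sigma> * sqrt (2 * pi) * exp (- 2 * \<sigma>\<^sup>2 * (Re \<beta>)\<^sup>2)))" by simp
    also have "1 / (2 * pi) * (\<sigma> * sqrt (2 * pi) * exp (- 2 * \<sigma>\<^sup>2 * (Re \<beta>)\<^sup>2)) = \<sigma> / sqrt (2 * pi) * exp (- 2 * \<sigma>\<^sup>2 * (Re \<beta>)\<^sup>2)"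
    proof -
      define r E where "r = sqrt (2 * pi)" and "E = exp (- 2 * \<sigma>\<^sup>2 * (Re \<beta>)\<^sup>2)"
      have "2 * pi = r * r" "r \<noteq> 0" by (simp_all add: r_def)
      then have "1 / (2 * pi) * (\<sigma> * r * E) = \<sigma> / r * E" by simp
      then show ?thesis unfolding r_def E_def .
    qed
    finally show ?thesis .
  qed
  moreover have "\<forall>\<^sub>F k in sequentially. 1 / (2 * of_real pi) * (\<integral>t. g k t \<partial>lborel)
     = weight c (L k) (M k) (z k) * pochhammer (of_nat (m k)) (L k) ^ M k
             * of_real (cmod (z k)) ^ (2 * m k) / of_real (s k)"
  proof -
    \<comment> \<open>The integral formula requires L M \<ge> 2, which holds eventually because L
      tends to infinity with N.\<close>
    have "\<forall>\<^sub>F k in sequentially. 2 < real (L k)"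
      using L_top[unfolded filterlim_at_top_dense] by blast
    with z eventually_m_gt_1 show ?thesis
    proof eventually_elim
      case (elim k)
      define r where "r = ln (cmod (z k))"
      define h where "h t = exp (- 2 * (of_real (real (m k)) + \<i> * of_real t) * of_real r)
          / pochhammer (of_real (real (m k)) + \<i> * of_real t) (L k) ^ M k" for t
      define A where "A = pochhammer (complex_of_nat (m k)) (L k) ^ M k * of_real (cmod (z k)) ^ (2 * m k)"
      have "2 < L k" using elim by linarith
      then have LM: "2 \<le> L k * M k"
        using mult_le_mono[of 2 "L k" 1 "M k"] M_pos[of k] by simp
      have A: "A = pochhammer (complex_of_nat (m k)) (L k) ^ M k * exp (of_real (2 * real (m k) * r))"
      proof -
        have "complex_of_real (cmod (z k)) ^ (2 * m k) = of_real (exp r ^ (2 * m k))"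
          using elim by (simp add: r_def)
        also have "exp r ^ (2 * m k) = exp (2 * real (m k) * r)"
          by (simp flip: exp_of_nat_mult)
        finally show ?thesis by (simp only: A_def exp_of_real)
      qed
      have hg: "h (s k * t) * A = g k t" for t
      proof -
        have "exp (- 2 * (of_real (real (m k)) + \<i> * of_real (s k * t)) * of_real r) * exp (of_real (2 * real (m k) * r))
          = exp (- (\<i> * of_real (s k * t)) * of_real (2 * r))"
          by (simp add: algebra_simps flip: exp_add)
        also have "\<dots> = exp (of_real (real (M k) * lam k) * (\<i> * of_real (s k * t))) * exp (of_real t * (- 2 * \<i> * of_real (s k * Re (b k))))"
        proof -
          have "2 * r = - (real (M k) * lam k) + 2 * Re (b k)" using elim by (simp add: r_def)
          then show ?thesis by (simp only:) (simp add: algebra_simps flip: exp_add)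
        qed
        finally have e: "exp (- 2 * (of_real (real (m k)) + \<i> * of_real (s k * t)) * of_real r) * exp (of_real (2 * real (m k) * r))
          = exp (of_real (real (M k) * lam k) * (\<i> * of_real (s k * t))) * exp (of_real t * (- 2 * \<i> * of_real (s k * Re (b k))))" .
        have "h (s k * t) * A = (pochhammer (of_nat (m k)) (L k) / pochhammer (of_nat (m k) + \<i> * of_real (s k * t)) (L k)) ^ M k
           * (exp (- 2 * (of_real (real (m k)) + \<i> * of_real (s k * t)) * of_real r) * exp (of_real (2 * real (m k) * r)))"
          unfolding h_def A by (simp add: power_divide)
        then show ?thesis unfolding e g_def by (simp only: mult.assoc)
      qed
      have "weight c (L k) (M k) (z k) = 1 / (2 * of_real pi) * (\<integral>t. h t \<partial>lborel)"
        unfolding h_def r_def using elim LM \<open>c > 0\<close> by (intro weight_eq_integral) auto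
      also have "(\<integral>t. h t \<partial>lborel) = of_real (s k) * (\<integral>t. h (s k * t) \<partial>lborel)"
        using lborel_integral_real_affine[of "s k" h 0] s_pos[of k] by (simp add: scaleR_conv_of_real)
      finally have "weight c (L k) (M k) (z k) * A / of_real (s k) = 1 / (2 * of_real pi) * ((\<integral>t. h (s k * t) \<partial>lborel) * A)"
        using s_pos[of k] by simp
      also have "(\<integral>t. h (s k * t) \<partial>lborel) * A = (\<integral>t. g k t \<partial>lborel)"
        unfolding hg[symmetric] by (rule integral_mult_left_zero[symmetric])
      finally show ?case by (simp only: A_def mult.assoc)
    qed
  qed
  ultimately show ?thesis using Lim_transform_eventually by fastforce
qed

text \<open>Here m + x is the degree plus one. The factor with \<open>lam\<close> comes from |u|^(2
  M x), and \<open>d\<close> stands for the sum of the displacement of one point and the conjugate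
  displacement of the other.\<close>

lemma degree_sum_lim:
  fixes d :: "nat \<Rightarrow> complex"
  assumes d: "(\<lambda>k. of_real (s k) * d k) \<longlonglongrightarrow> \<delta>"
  shows "(\<lambda>k. (\<Sum>x\<in>{1 - int (m k)..int (N k) - int (m k)}.
              (pochhammer (of_nat (m k) + of_int x) (L k) / pochhammer (of_nat (m k)) (L k)) ^ M k
              * exp (- of_real (real (M k) * lam k) * of_int x) * exp (of_int x * d k)) / of_real (s k))
     \<longlonglongrightarrow> of_real (\<sigma> * sqrt (2 * pi)) * exp ((of_real \<sigma> * \<delta>)\<^sup>2 / 2)
         * (if q < 1 then 1 else erfc (of_real \<sigma> * \<delta> / of_real (sqrt 2)) / 2)"
proof -
  define F where "F k x = (pochhammer (of_nat (m k) + of_int x) (L k) / pochhammer (of_nat (m k)) (L k)) ^ M k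
              * exp (- of_real (real (M k) * lam k) * of_int x) * exp (of_int x * d k)" for k and x :: int
  define I where "I k = {1 - int (m k)..int (N k) - int (m k)}" for k
  define g where "g k t = (if \<lfloor>s k * t\<rfloor> \<in> I k then F k \<lfloor>s k * t\<rfloor> else 0)" for k t
  define e where "e t = exp (- of_real (t\<^sup>2 / (2 * \<sigma>\<^sup>2)) + of_real t * \<delta>)" for t :: real
  define f where "f t = indicator (if q < 1 then UNIV else {..<0}) t *\<^sub>R e t" for t :: real
  have [measurable]: "e \<in> borel_measurable borel" unfolding e_def by measurable
  obtain \<kappa> where \<kappa>: "\<kappa> > 0"
    "\<forall>\<^sub>F k in sequentially. \<forall>x::int. 1 \<le> int (m k) + x \<longrightarrow> int (m k) + x \<le> int (N k) \<longrightarrow>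
       norm ((pochhammer (of_nat (m k) + of_int x) (L k) / pochhammer (of_nat (m k)) (L k) :: complex) ^ M k
          * exp (- of_real (real (M k) * lam k) * of_int x))
       \<le> exp (\<bar>of_int x\<bar> / s k - \<kappa> * (of_int x / s k)\<^sup>2)"
    by (rule pochhammer_ratio_horizontal_bound)
  \<comment> \<open>One unit bounds the fluctuation of s d around \<delta>, the other is the linear
    term |x| / s of the horizontal bound. In \<open>w\<close>, half of the Gaussian \<kappa> X^2
    absorbs C |X|, and the other half pays for replacing X = x / s by t, from which it differs by at
    most 1.\<close>
  define C where "C = norm \<delta> + 2"
  define w where "w t = exp (C\<^sup>2 / (2 * \<kappa>) + \<kappa> / 2) * exp (- (\<kappa> / 4) * t\<^sup>2)" for t :: real
  have floor_close: "\<bar>of_int \<lfloor>s k * t\<rfloor> / s k - t\<bar> \<le> 1 / s k" for k t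
  proof -
    have "\<bar>of_int \<lfloor>s k * t\<rfloor> - s k * t\<bar> \<le> 1" by linarith
    then have "\<bar>of_int \<lfloor>s k * t\<rfloor> - s k * t\<bar> / s k \<le> 1 / s k"
      using s_pos[of k] by (intro divide_right_mono) auto
    moreover have "of_int \<lfloor>s k * t\<rfloor> / s k - t = (of_int \<lfloor>s k * t\<rfloor> - s k * t) / s k"
      using s_pos[of k] by (simp add: diff_divide_distrib)
    then have "\<bar>of_int \<lfloor>s k * t\<rfloor> / s k - t\<bar> = \<bar>of_int \<lfloor>s k * t\<rfloor> - s k * t\<bar> / s k"
      by (simp only: abs_divide abs_of_pos[OF s_pos])
    ultimately show ?thesis by (simp only:)
  qed
  have floor_lim: "(\<lambda>k. of_int \<lfloor>s k * t\<rfloor> / s k) \<longlonglongrightarrow> t" for t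
    by (rule Lim_null[THEN iffD2], rule Lim_null_comparison[OF always_eventually inverse_s_lim])
       (use floor_close in auto)
  have "(\<lambda>k. \<integral>t. g k t \<partial>lborel) \<longlonglongrightarrow> (\<integral>t. f t \<partial>lborel)"
  proof (rule dominated_convergence_eventually[where w=w])
    show "f \<in> borel_measurable lborel" unfolding f_def by (cases "q < 1") auto
    show "g k \<in> borel_measurable lborel" for k
      unfolding g_def using measurable_floor_scale[OF s_pos, of "I k" k "F k"] by (simp add: I_def)
    show "integrable lborel w"
      unfolding w_def using integrable_gaussian[of "\<kappa> / 4"] \<kappa>(1) by (intro integrable_mult_right) auto
    have "\<forall>\<^sub>F k in sequentially. norm (of_real (s k) * d k) < norm \<delta> + 1"
      by (rule order_tendstoD[OF tendsto_norm[OF d]]) simp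
    moreover have "\<forall>\<^sub>F k in sequentially. s k > 1"
      using s_top[unfolded filterlim_at_top_dense] by blast
    ultimately show "\<forall>\<^sub>F k in sequentially. \<forall>t. norm (g k t) \<le> w t"
      using \<kappa>(2)
    proof eventually_elim
      case (elim k)
      show ?case
      proof
        fix t
        show "norm (g k t) \<le> w t"
        proof (cases "\<lfloor>s k * t\<rfloor> \<in> I k")
          case False
          then show ?thesis by (simp add: g_def w_def)
        next
          case True
          define x where "x = \<lfloor>s k * t\<rfloor>"
          define X where "X = of_int x / s k"
          have "norm (F k x) = norm ((pochhammer (of_nat (m k) + of_int x) (L k) / pochhammer (of_nat (m k)) (L k) :: complex) ^ M k
                * exp (- of_real (real (M k) * lam k) * of_int x)) * norm (exp (of_int x * d k))"
            by (simp add: F_def norm_mult)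
          also have "\<dots> \<le> exp (\<bar>of_int x\<bar> / s k - \<kappa> * (of_int x / s k)\<^sup>2) * exp ((norm \<delta> + 1) * \<bar>X\<bar>)"
          proof (rule mult_mono)
            show "norm ((pochhammer (of_nat (m k) + of_int x) (L k) / pochhammer (of_nat (m k)) (L k) :: complex) ^ M k
                * exp (- of_real (real (M k) * lam k) * of_int x)) \<le> exp (\<bar>of_int x\<bar> / s k - \<kappa> * (of_int x / s k)\<^sup>2)"
              using elim True unfolding x_def I_def by (intro elim(3)[rule_format]) auto
            have "norm (exp (of_int x * d k)) \<le> exp (norm (of_int x * d k))" by (rule norm_exp)
            also have "norm (of_int x * d k) = norm (of_real (s k) * d k) * \<bar>X\<bar>"
              using s_pos[of k] by (simp add: X_def norm_mult)
            also have "exp \<dots> \<le> exp ((norm \<delta> + 1) * \<bar>X\<bar>)"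
              using elim by (simp add: mult_right_mono)
            finally show "norm (exp (of_int x * d k)) \<le> exp ((norm \<delta> + 1) * \<bar>X\<bar>)" .
          qed auto
          also have "\<dots> = exp (C * \<bar>X\<bar> - \<kappa> * X\<^sup>2)"
          proof -
            have "\<bar>of_int x\<bar> / s k = \<bar>X\<bar>" using s_pos[of k] by (simp add: X_def)
            then have "\<bar>of_int x\<bar> / s k - \<kappa> * (of_int x / s k)\<^sup>2 + (norm \<delta> + 1) * \<bar>X\<bar> = C * \<bar>X\<bar> - \<kappa> * X\<^sup>2"
              unfolding X_def[symmetric] C_def by (simp add: distrib_right)
            then show ?thesis by (simp only: exp_add[symmetric])
          qed
          also have "\<dots> \<le> exp (C\<^sup>2 / (2 * \<kappa>) + \<kappa> / 2 + - (\<kappa> / 4) * t\<^sup>2)"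
          proof -
            have "0 \<le> (\<kappa> * \<bar>X\<bar> - C)\<^sup>2 / (2 * \<kappa>)" using \<kappa>(1) by simp
            also have "\<dots> = \<kappa> / 2 * X\<^sup>2 - C * \<bar>X\<bar> + C\<^sup>2 / (2 * \<kappa>)"
              using \<kappa>(1) by (simp add: power2_diff power_mult_distrib field_simps power2_eq_square)
            finally have 1: "C * \<bar>X\<bar> \<le> \<kappa> / 2 * X\<^sup>2 + C\<^sup>2 / (2 * \<kappa>)" by simp
            have "1 / s k \<le> 1" using elim by simp
            then have "\<bar>X - t\<bar> \<le> 1"
              using floor_close[of k t] unfolding X_def x_def by linarith
            then have "(X - t)\<^sup>2 \<le> 1" by (simp add: abs_square_le_1)
            moreover have "t\<^sup>2 \<le> 2 * X\<^sup>2 + 2 * (X - t)\<^sup>2"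
              using zero_le_power2[of "2 * X - t"] by (simp add: power2_eq_square algebra_simps)
            ultimately have "t\<^sup>2 / 2 - 1 \<le> X\<^sup>2" by linarith
            then have "\<kappa> / 2 * (t\<^sup>2 / 2 - 1) \<le> \<kappa> / 2 * X\<^sup>2"
              using \<kappa>(1) by (intro mult_left_mono) auto
            then have "\<kappa> / 4 * t\<^sup>2 - \<kappa> / 2 \<le> \<kappa> / 2 * X\<^sup>2" by (simp add: right_diff_distrib)
            moreover have "\<kappa> * X\<^sup>2 = \<kappa> / 2 * X\<^sup>2 + \<kappa> / 2 * X\<^sup>2" by simp
            ultimately have "C * \<bar>X\<bar> - \<kappa> * X\<^sup>2 \<le> C\<^sup>2 / (2 * \<kappa>) + \<kappa> / 2 + - (\<kappa> / 4) * t\<^sup>2"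
              using 1 by linarith
            then show ?thesis by (rule exp_le_cancel_iff[THEN iffD2])
          qed
          also have "\<dots> = w t" by (simp only: w_def exp_add)
          finally show ?thesis using True by (simp add: g_def x_def)
        qed
      qed
    qed
    \<comment> \<open>The point t = 0 is left out: for q = 1 the top degree sits exactly there,
      where \<open>g k 0\<close> is 1 while \<open>f 0\<close> is 0.\<close>
    show "AE t in lborel. (\<lambda>k. g k t) \<longlonglongrightarrow> f t"
      using AE_lborel_singleton[of 0]
    proof eventually_elim
      fix t :: real assume t: "t \<noteq> 0"
      have "(\<lambda>k. complex_of_real (of_int \<lfloor>s k * t\<rfloor> / s k)) \<longlonglongrightarrow> of_real t"
        by (intro tendsto_of_real floor_lim)
      then have fl: "(\<lambda>k. of_int \<lfloor>s k * t\<rfloor> / of_real (s k)) \<longlonglongrightarrow> complex_of_real t" by simp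
      have 2: "(\<lambda>k. exp (of_int \<lfloor>s k * t\<rfloor> / of_real (s k) * (of_real (s k) * d k))) \<longlonglongrightarrow> exp (of_real t * \<delta>)"
        by (intro tendsto_intros fl d)
      have 3: "(\<lambda>k. F k \<lfloor>s k * t\<rfloor>) \<longlonglongrightarrow> e t"
      proof -
        have "of_int \<lfloor>s k * t\<rfloor> / of_real (s k) * (of_real (s k) * d k) = of_int \<lfloor>s k * t\<rfloor> * d k" for k
          using s_pos[of k] by simp
        with tendsto_mult[OF pochhammer_ratio_lim[OF fl] 2] show ?thesis
          unfolding F_def e_def exp_add by simp
      qed
      have small: "(\<lambda>k. of_int \<lfloor>s k * t\<rfloor> / real (m k)) \<longlonglongrightarrow> 0"
      proof -
        have eq: "of_int \<lfloor>s k * t\<rfloor> / s k * (s k / real (m k)) = of_int \<lfloor>s k * t\<rfloor> / real (m k)" for k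
          using s_pos[of k] by simp
        from tendsto_mult[OF floor_lim s_m_lim, of t] show ?thesis by (simp only: eq mult_zero_right)
      qed
      have "\<forall>\<^sub>F k in sequentially. - 1 / 2 < of_int \<lfloor>s k * t\<rfloor> / real (m k)"
        by (rule order_tendstoD(1)[OF small]) simp
      then have lower: "\<forall>\<^sub>F k in sequentially. 1 - int (m k) \<le> \<lfloor>s k * t\<rfloor>"
        using eventually_m_gt_1
      proof eventually_elim
        fix k assume a: "- 1 / 2 < of_int \<lfloor>s k * t\<rfloor> / real (m k)" and b: "1 < real (m k)"
        from a b have "- real (m k) / 2 < of_int \<lfloor>s k * t\<rfloor>" by (simp add: field_simps)
        with b have "- real (m k) < of_int \<lfloor>s k * t\<rfloor>" by linarith
        then show "1 - int (m k) \<le> \<lfloor>s k * t\<rfloor>" by linarith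
      qed
      show "(\<lambda>k. g k t) \<longlonglongrightarrow> f t"
      proof (cases "q < 1 \<or> t < 0")
        case True
        have "\<forall>\<^sub>F k in sequentially. \<lfloor>s k * t\<rfloor> \<le> int (N k) - int (m k)"
        proof (cases "q < 1")
          case True
          have "(\<lambda>k. of_int \<lfloor>s k * t\<rfloor> / s k * (s k / real (N k)) + real (m k) / real (N k)) \<longlonglongrightarrow> t * 0 + q"
            by (intro tendsto_intros floor_lim s_N_lim m_N_lim)
          then have "\<forall>\<^sub>F k in sequentially. of_int \<lfloor>s k * t\<rfloor> / s k * (s k / real (N k)) + real (m k) / real (N k) < 1"
            using True by (intro order_tendstoD) auto
          then show ?thesis
          proof eventually_elim
            fix k assume "of_int \<lfloor>s k * t\<rfloor> / s k * (s k / real (N k)) + real (m k) / real (N k) < 1"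
            then have "(of_int \<lfloor>s k * t\<rfloor> + real (m k)) / real (N k) < 1"
              using s_pos[of k] by (simp add: add_divide_distrib)
            then have "of_int \<lfloor>s k * t\<rfloor> + real (m k) < real (N k)" by (simp add: divide_less_eq)
            then show "\<lfloor>s k * t\<rfloor> \<le> int (N k) - int (m k)" by linarith
          qed
        next
          case False
          then have "t < 0" using \<open>q < 1 \<or> t < 0\<close> by simp
          show ?thesis
          proof (rule always_eventually, rule allI)
            fix k
            have "s k * t < 0" using s_pos[of k] \<open>t < 0\<close> by (simp add: mult_pos_neg)
            then have "\<lfloor>s k * t\<rfloor> < 0" by simp
            then show "\<lfloor>s k * t\<rfloor> \<le> int (N k) - int (m k)" using m_le_N[of k] by linarith
          qed
        qed
        with lower have "\<forall>\<^sub>F k in sequentially. F k \<lfloor>s k * t\<rfloor> = g k t"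
          by eventually_elim (simp add: g_def I_def)
        moreover have "f t = e t" using True by (auto simp: f_def)
        ultimately show ?thesis using 3 by (simp add: Lim_transform_eventually)
      next
        case False
        then have q: "q = 1" and "t > 0" using q_le t by auto
        \<comment> \<open>For q = 1 no rounding occurs, so the largest displacement is exactly 0 and
          the integrand dies as soon as s t reaches 1.\<close>
        have mN: "m k = N k" for k unfolding m_def by (simp add: q)
        have "filterlim (\<lambda>k. t * s k) at_top sequentially"
          by (rule filterlim_tendsto_pos_mult_at_top[OF tendsto_const \<open>t > 0\<close> s_top])
        then have "\<forall>\<^sub>F k in sequentially. t * s k > 1"
          by (simp only: filterlim_at_top_dense)
        then have "\<forall>\<^sub>F k in sequentially. g k t = 0"
        proof eventually_elim
          fix k assume "t * s k > 1"
          then have "\<lfloor>s k * t\<rfloor> \<ge> 1" by (simp add: mult.commute)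
          then show "g k t = 0" by (simp add: g_def I_def mN)
        qed
        moreover have "f t = 0" using False q by (auto simp: f_def)
        ultimately show ?thesis by (simp add: tendsto_eventually)
      qed
    qed
  qed
  moreover have "(\<integral>t. f t \<partial>lborel) = of_real (\<sigma> * sqrt (2 * pi)) * exp ((of_real \<sigma> * \<delta>)\<^sup>2 / 2)
         * (if q < 1 then 1 else erfc (of_real \<sigma> * \<delta> / of_real (sqrt 2)) / 2)"
    using gaussian_integral_exp_linear[OF \<sigma>_pos, of \<delta>] gaussian_half_integral_exp_linear[OF \<sigma>_pos, of \<delta>]
    by (simp add: f_def e_def)
  moreover have "(\<integral>t. g k t \<partial>lborel) = (\<Sum>x\<in>I k. F k x) / of_real (s k)" for k
    unfolding g_def by (rule integral_floor_scale[OF s_pos]) (simp add: I_def)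
  ultimately show ?thesis by (simp add: I_def F_def)
qed

text \<open>The square root of the two weights contributes s |z z'|^(-m) and the constant \<sigma> /
  sqrt(2 pi), the degree sum contributes another s and \<sigma> sqrt(2 pi); this explains 1 / s^2 on
  the left and \<sigma>^2 / pi on the right. The sum has degree m - 1 at the saddle, so one factor
  |z z'| is missing and is supplied in front, and the powers of \<open>sgn\<close> remove the phase
  of (z * cnj z')^(m - 1).\<close>

lemma kernel_lim:
  fixes b b' z z' u :: "nat \<Rightarrow> complex"
  assumes "c > 0"
    and b: "(\<lambda>k. of_real (s k) * b k) \<longlonglongrightarrow> \<beta>" and b': "(\<lambda>k. of_real (s k) * b' k) \<longlonglongrightarrow> \<beta>'"
    and u: "\<And>k. (cmod (u k))\<^sup>2 = exp (- lam k)"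
    and z: "\<forall>\<^sub>F k in sequentially. z k = u k ^ M k * exp (b k)"
    and z': "\<forall>\<^sub>F k in sequentially. z' k = u k ^ M k * exp (b' k)"
  shows "(\<lambda>k. of_real (cmod (z k) * cmod (z' k) / (s k)\<^sup>2) * K_trunc c (L k) (M k) (N k) (z k) (z' k)
              * (cnj (sgn (z k)) * sgn (z' k)) ^ (m k - 1))
       \<longlonglongrightarrow> of_real (\<sigma>\<^sup>2 / pi) * exp ((of_real \<sigma> * (\<beta> + cnj \<beta>'))\<^sup>2 / 2 - of_real (\<sigma>\<^sup>2 * ((Re \<beta>)\<^sup>2 + (Re \<beta>')\<^sup>2)))
           * (if q < 1 then 1 else erfc (of_real \<sigma> * (\<beta> + cnj \<beta>') / of_real (sqrt 2)) / 2)"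
proof -
  have u_nz: "u k \<noteq> 0" for k
  proof
    assume "u k = 0"
    then show False using u[of k] by simp
  qed
  have ln_z: "y \<noteq> 0 \<and> 2 * ln (cmod y) = - (real (M k) * lam k) + 2 * Re a" if "y = u k ^ M k * exp a" for y a k
  proof -
    have "2 * ln (cmod (u k)) = ln ((cmod (u k))\<^sup>2)" using u_nz[of k] by (simp add: ln_realpow)
    then have "2 * ln (cmod (u k)) = - lam k" by (simp add: u)
    moreover have "ln (cmod y) = real (M k) * ln (cmod (u k)) + Re a"
      using u_nz[of k] that by (simp add: norm_mult norm_power ln_mult ln_realpow)
    ultimately show ?thesis using u_nz[of k] that by (simp add: algebra_simps)
  qed
  define P where "P k = pochhammer (real (m k)) (L k) ^ M k" for k
  have P: "pochhammer (of_nat (m k)) (L k) ^ M k = complex_of_real (P k)" for k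
  proof -
    have "pochhammer (of_nat (m k)) (L k) = complex_of_real (pochhammer (real (m k)) (L k))"
      using pochhammer_of_real[of "real (m k)" "L k", where 'a=complex] by simp
    then show ?thesis by (simp only: P_def of_real_power)
  qed
  define W where "W k y = weight c (L k) (M k) y * of_real (P k) * of_real (cmod y) ^ (2 * m k) / of_real (s k)" for k y
  have W: "(\<lambda>k. W k (y k)) \<longlonglongrightarrow> of_real (\<sigma> / sqrt (2 * pi) * exp (- 2 * \<sigma>\<^sup>2 * (Re \<gamma>)\<^sup>2))"
    if "(\<lambda>k. of_real (s k) * a k) \<longlonglongrightarrow> \<gamma>" "\<forall>\<^sub>F k in sequentially. y k = u k ^ M k * exp (a k)" for y a \<gamma>
  proof -
    have "\<forall>\<^sub>F k in sequentially. y k \<noteq> 0 \<and> 2 * ln (cmod (y k)) = - (real (M k) * lam k) + 2 * Re (a k)"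
      using that(2) by eventually_elim (rule ln_z)
    from weight_lim[OF \<open>c > 0\<close> that(1) this] show ?thesis
      by (simp add: W_def P)
  qed
  define V where "V = \<sigma>\<^sup>2 / (2 * pi) * exp (- 2 * \<sigma>\<^sup>2 * ((Re \<beta>)\<^sup>2 + (Re \<beta>')\<^sup>2))"
  have V_pos: "V > 0" using \<sigma>_pos by (simp add: V_def)
  have "(\<lambda>k. W k (z k) * W k (z' k)) \<longlonglongrightarrow> of_real (\<sigma> / sqrt (2 * pi) * exp (- 2 * \<sigma>\<^sup>2 * (Re \<beta>)\<^sup>2))
      * of_real (\<sigma> / sqrt (2 * pi) * exp (- 2 * \<sigma>\<^sup>2 * (Re \<beta>')\<^sup>2))"
    by (intro tendsto_mult W[OF b z] W[OF b' z'])
  also have "of_real (\<sigma> / sqrt (2 * pi) * exp (- 2 * \<sigma>\<^sup>2 * (Re \<beta>)\<^sup>2))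
      * of_real (\<sigma> / sqrt (2 * pi) * exp (- 2 * \<sigma>\<^sup>2 * (Re \<beta>')\<^sup>2)) = complex_of_real V"
  proof -
    have "\<sigma> / sqrt (2 * pi) * exp (- 2 * \<sigma>\<^sup>2 * (Re \<beta>)\<^sup>2) * (\<sigma> / sqrt (2 * pi) * exp (- 2 * \<sigma>\<^sup>2 * (Re \<beta>')\<^sup>2))
        = (\<sigma> * \<sigma>) / (sqrt (2 * pi) * sqrt (2 * pi)) * (exp (- 2 * \<sigma>\<^sup>2 * (Re \<beta>)\<^sup>2) * exp (- 2 * \<sigma>\<^sup>2 * (Re \<beta>')\<^sup>2))"
      by simp
    also have "\<dots> = V"
      unfolding V_def by (simp only: exp_add[symmetric] distrib_left power2_eq_square[of \<sigma>]) simp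
    finally show ?thesis by (simp only: of_real_mult[symmetric])
  qed
  \<comment> \<open>The limit \<open>V\<close> is positive, hence off the branch cut, and
    \<open>csqrt\<close> is continuous there.\<close>
  finally have "(\<lambda>k. csqrt (W k (z k) * W k (z' k))) \<longlonglongrightarrow> csqrt (of_real V)"
    using V_pos by (intro isCont_tendsto_compose[OF continuous_at_csqrt]) auto
  then have sqrt_lim: "(\<lambda>k. csqrt (W k (z k) * W k (z' k))) \<longlonglongrightarrow> of_real (sqrt V)"
    using V_pos by simp
  define Q where "Q k = (\<Sum>x\<in>{1 - int (m k)..int (N k) - int (m k)}.
              (pochhammer (of_nat (m k) + of_int x) (L k) / pochhammer (of_nat (m k)) (L k)) ^ M k
              * exp (- of_real (real (M k) * lam k) * of_int x) * exp (of_int x * (b k + cnj (b' k)))) / of_real (s k)" for k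
  define B where "B = of_real (\<sigma> * sqrt (2 * pi)) * exp ((of_real \<sigma> * (\<beta> + cnj \<beta>'))\<^sup>2 / 2)
         * (if q < 1 then 1 else erfc (of_real \<sigma> * (\<beta> + cnj \<beta>') / of_real (sqrt 2)) / 2)"
  have "(\<lambda>k. of_real (s k) * b k + cnj (of_real (s k) * b' k)) \<longlonglongrightarrow> \<beta> + cnj \<beta>'"
    by (intro tendsto_intros b b')
  then have "(\<lambda>k. of_real (s k) * (b k + cnj (b' k))) \<longlonglongrightarrow> \<beta> + cnj \<beta>'"
    by (simp add: distrib_left)
  from degree_sum_lim[OF this] have Q_lim: "Q \<longlonglongrightarrow> B" unfolding Q_def B_def .
  have "(\<lambda>k. 1 / of_real pi * csqrt (W k (z k) * W k (z' k)) * Q k) \<longlonglongrightarrow> 1 / of_real pi * of_real (sqrt V) * B"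
    by (intro tendsto_intros sqrt_lim Q_lim)
  moreover have "1 / of_real pi * of_real (sqrt V) * B
      = of_real (\<sigma>\<^sup>2 / pi) * exp ((of_real \<sigma> * (\<beta> + cnj \<beta>'))\<^sup>2 / 2 - of_real (\<sigma>\<^sup>2 * ((Re \<beta>)\<^sup>2 + (Re \<beta>')\<^sup>2)))
           * (if q < 1 then 1 else erfc (of_real \<sigma> * (\<beta> + cnj \<beta>') / of_real (sqrt 2)) / 2)"
  proof -
    have "V = (\<sigma> / sqrt (2 * pi) * exp (- (\<sigma>\<^sup>2 * ((Re \<beta>)\<^sup>2 + (Re \<beta>')\<^sup>2))))\<^sup>2"
      unfolding V_def by (simp add: power_mult_distrib power_divide flip: exp_double)
    then have "sqrt V = \<sigma> / sqrt (2 * pi) * exp (- (\<sigma>\<^sup>2 * ((Re \<beta>)\<^sup>2 + (Re \<beta>')\<^sup>2)))"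
      using \<sigma>_pos by (simp only: real_sqrt_abs) simp
    then have "1 / pi * sqrt V * (\<sigma> * sqrt (2 * pi)) = \<sigma>\<^sup>2 / pi * exp (- (\<sigma>\<^sup>2 * ((Re \<beta>)\<^sup>2 + (Re \<beta>')\<^sup>2)))"
      by (simp add: power2_eq_square)
    then have 1: "complex_of_real (1 / pi * sqrt V * (\<sigma> * sqrt (2 * pi)))
        = of_real (\<sigma>\<^sup>2 / pi) * of_real (exp (- (\<sigma>\<^sup>2 * ((Re \<beta>)\<^sup>2 + (Re \<beta>')\<^sup>2))))"
      by (simp only: of_real_mult)
    have 2: "exp (A - of_real r) = exp A * complex_of_real (exp (- r))" for A r
      by (simp add: exp_diff exp_minus divide_inverse exp_of_real)
    have "1 / of_real pi * of_real (sqrt V) * B = complex_of_real (1 / pi * sqrt V * (\<sigma> * sqrt (2 * pi)))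
        * (exp ((of_real \<sigma> * (\<beta> + cnj \<beta>'))\<^sup>2 / 2)
         * (if q < 1 then 1 else erfc (of_real \<sigma> * (\<beta> + cnj \<beta>') / of_real (sqrt 2)) / 2))"
      unfolding B_def of_real_mult of_real_divide of_real_1 by (simp only: mult.assoc)
    then show ?thesis
      unfolding 1 2 by (simp only: mult_ac)
  qed
  moreover have "\<forall>\<^sub>F k in sequentially. 1 / of_real pi * csqrt (W k (z k) * W k (z' k)) * Q k
      = of_real (cmod (z k) * cmod (z' k) / (s k)\<^sup>2) * K_trunc c (L k) (M k) (N k) (z k) (z' k)
              * (cnj (sgn (z k)) * sgn (z' k)) ^ (m k - 1)"
    using z z' eventually_m_gt_1
  proof eventually_elim
    case (elim k)
    define x y where "x = cmod (z k)" and "y = cmod (z' k)"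
    have nz: "z k \<noteq> 0" "z' k \<noteq> 0" using elim u_nz[of k] by auto
    then have xy: "x > 0" "y > 0" by (auto simp: x_def y_def)
    obtain j where j: "m k = Suc j" using elim(3) by (cases "m k") auto
    have P_pos: "P k > 0" using elim by (simp add: P_def pochhammer_pos)
    define e where "e = - of_real (real (M k) * lam k) + (b k + cnj (b' k))"
    have zz: "z k * cnj (z' k) = exp e"
    proof -
      have "u k * cnj (u k) = exp (- of_real (lam k))"
        using u[of k] by (simp add: complex_norm_square[symmetric] flip: exp_of_real of_real_power)
      then have "(u k * cnj (u k)) ^ M k = exp (- of_real (real (M k) * lam k))"
        by (simp flip: exp_of_nat_mult)
      then show ?thesis
        unfolding elim e_def exp_add by (simp add: exp_cnj power_mult_distrib mult_ac)
    qed
    have csq: "csqrt (W k (z k) * W k (z' k)) = of_real (P k * x ^ m k * y ^ m k / s k) * csqrt (weight c (L k) (M k) (z k) * weight c (L k) (M k) (z' k))"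
    proof -
      have "W k (z k) * W k (z' k) = of_real ((P k * x ^ m k * y ^ m k / s k)\<^sup>2) * (weight c (L k) (M k) (z k) * weight c (L k) (M k) (z' k))"
        by (simp add: W_def x_def y_def power_mult_distrib power_divide power2_eq_square power_mult mult_2 power_add)
      moreover have "P k * x ^ m k * y ^ m k / s k > 0" using P_pos xy s_pos[of k] by simp
      ultimately show ?thesis by (simp only: csqrt_scale)
    qed
    have sum: "(\<Sum>i<N k. pochhammer (of_nat (i + 1)) (L k) ^ M k * (z k * cnj (z' k)) ^ i)
        = of_real (P k * s k) * (z k * cnj (z' k)) ^ j * Q k"
    proof -
      \<comment> \<open>Degree i carries A(i + 1)^M, so its displacement from the saddle is x = i +
        1 - m, and the power of degree j = m - 1 is common to all terms.\<close>
      have "(\<Sum>i<N k. pochhammer (of_nat (i + 1)) (L k) ^ M k * (z k * cnj (z' k)) ^ i)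
          = (\<Sum>x\<in>{1 - int (m k)..int (N k) - int (m k)}. pochhammer (of_nat (m k) + of_int x) (L k) ^ M k * (exp (of_int x * e) * exp e ^ j))"
      proof (rule sum.reindex_bij_witness[of _ "\<lambda>x. nat (int (m k) + x - 1)" "\<lambda>i. int i + 1 - int (m k)"])
        fix i assume "i \<in> {..<N k}"
        have "exp (of_int (int i + 1 - int (m k)) * e) * exp e ^ j = exp (of_nat i * e)"
          using j by (simp add: algebra_simps flip: exp_of_nat_mult exp_add)
        then show "pochhammer (of_nat (m k) + of_int (int i + 1 - int (m k))) (L k) ^ M k
            * (exp (of_int (int i + 1 - int (m k)) * e) * exp e ^ j)
          = pochhammer (of_nat (i + 1)) (L k) ^ M k * (z k * cnj (z' k)) ^ i"
          unfolding zz by (simp add: exp_of_nat_mult add.commute)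
      qed auto
      also have "\<dots> = of_real (P k) * (\<Sum>x\<in>{1 - int (m k)..int (N k) - int (m k)}.
              (pochhammer (of_nat (m k) + of_int x) (L k) / pochhammer (of_nat (m k)) (L k)) ^ M k
              * exp (- of_real (real (M k) * lam k) * of_int x) * exp (of_int x * (b k + cnj (b' k)))) * exp e ^ j"
        unfolding sum_distrib_left sum_distrib_right
      proof (intro sum.cong refl)
        fix x :: int
        have "exp (of_int x * e) = exp (- of_real (real (M k) * lam k) * of_int x) * exp (of_int x * (b k + cnj (b' k)))"
          unfolding e_def exp_add[symmetric] by (simp add: algebra_simps)
        moreover have "pochhammer (of_nat (m k) + of_int x :: complex) (L k) ^ M k
           = of_real (P k) * (pochhammer (of_nat (m k) + of_int x) (L k) / pochhammer (of_nat (m k)) (L k)) ^ M k"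
          unfolding power_divide P using P_pos by simp
        ultimately show "pochhammer (of_nat (m k) + of_int x) (L k) ^ M k * (exp (of_int x * e) * exp e ^ j)
          = of_real (P k) * ((pochhammer (of_nat (m k) + of_int x) (L k) / pochhammer (of_nat (m k)) (L k)) ^ M k
              * exp (- of_real (real (M k) * lam k) * of_int x) * exp (of_int x * (b k + cnj (b' k)))) * exp e ^ j"
          by (simp only: mult.assoc)
      qed
      also have "\<dots> = of_real (P k * s k) * exp e ^ j * Q k"
        unfolding Q_def using s_pos[of k] by simp
      finally show ?thesis unfolding zz .
    qed
    have phase: "(z k * cnj (z' k)) ^ j * (cnj (sgn (z k)) * sgn (z' k)) ^ j = of_real ((x * y) ^ j)"
    proof -
      have "z k * cnj (sgn (z k)) = of_real x" "cnj (z' k) * sgn (z' k) = of_real y"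
        using nz by (simp_all add: sgn_eq x_def y_def complex_norm_square[symmetric] mult.commute[of "cnj (z' k)"] power2_eq_square)
      then have "(z k * cnj (z' k)) * (cnj (sgn (z k)) * sgn (z' k)) = of_real (x * y)"
        by (metis (no_types, lifting) mult.assoc mult.commute of_real_mult)
      then show ?thesis by (metis power_mult_distrib of_real_power)
    qed
    define w where "w = csqrt (weight c (L k) (M k) (z k) * weight c (L k) (M k) (z' k))"
    have "of_real (cmod (z k) * cmod (z' k) / (s k)\<^sup>2) * K_trunc c (L k) (M k) (N k) (z k) (z' k)
              * (cnj (sgn (z k)) * sgn (z' k)) ^ (m k - 1)
        = of_real (x * y / (s k)\<^sup>2) * (1 / of_real pi * w * (of_real (P k * s k) * (z k * cnj (z' k)) ^ j * Q k))
            * (cnj (sgn (z k)) * sgn (z' k)) ^ j"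
      unfolding K_trunc_eq_pochhammer sum w_def x_def y_def j by simp
    also have "\<dots> = of_real (x * y / (s k)\<^sup>2) * (1 / of_real pi * w * (of_real (P k * s k) * Q k))
            * ((z k * cnj (z' k)) ^ j * (cnj (sgn (z k)) * sgn (z' k)) ^ j)"
      by (simp only: mult_ac)
    also have "\<dots> = 1 / of_real pi * (of_real (P k * x ^ m k * y ^ m k / s k) * w) * Q k"
      unfolding phase j using s_pos[of k] by (simp add: power_mult_distrib power2_eq_square field_simps)
    also have "\<dots> = 1 / of_real pi * csqrt (W k (z k) * W k (z' k)) * Q k"
      unfolding csq w_def ..
    finally show ?case ..
  qed
  ultimately show ?thesis using Lim_transform_eventually by fastforce
qed

end

section \<open>Convergence to the Ginibre kernels\<close>

locale ginibre_point = ginibre_scaling +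
  fixes u :: "nat \<Rightarrow> complex" and \<rho> :: "nat \<Rightarrow> real" and \<theta> c :: real
  assumes c_pos: "c > 0"
    and u_polar: "\<And>k. u k = of_real (cmod (u k)) * exp (\<i> * of_real \<theta>)"
    and u_eq: "\<And>k. (1 + real (L k) / (q * real (N k))) * (cmod (u k))\<^sup>2 - 1 = 0"
    and \<rho>_eq: "\<And>k. \<rho> k = sqrt \<tau> / (1 - (cmod (u k))\<^sup>2)"
begin

lemma u_sq: "(cmod (u k))\<^sup>2 = 1 / (1 + real (L k) / (q * real (N k)))"
proof -
  have "1 + real (L k) / (q * real (N k)) > 0" using q_pos by (intro add_pos_nonneg) auto
  then show ?thesis using u_eq[of k] by (simp add: field_simps)
qed

lemma u_sq_exp: "(cmod (u k))\<^sup>2 = exp (- lam k)"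
proof -
  have "1 + real (L k) / (q * real (N k)) > 0" using q_pos by (intro add_pos_nonneg) auto
  then show ?thesis by (simp add: u_sq lam_def exp_minus inverse_eq_divide)
qed

lemma u_nonzero: "u k \<noteq> 0"
  using u_eq[of k] by auto

text \<open>|u|^2 tends to q / (q + \<tau>), and \<rho> is chosen to match the saddle width: the
  scaled displacement s b tends to \<open>a v / \<sigma>\<close>, so that \<sigma> drops out of the
  limiting kernel.\<close>

lemma \<rho>_u_lim: "(\<lambda>k. \<rho> k * cmod (u k)) \<longlonglongrightarrow> \<sigma>"
proof -
  define X where "X = 1 / (1 + \<tau> / q)"
  have X: "X = q / (q + \<tau>)" "1 - X = \<tau> / (q + \<tau>)"
    using q_pos \<tau>_pos by (auto simp: X_def field_simps)
  have "(\<lambda>k. 1 / (1 + real (L k) / real (N k) / q)) \<longlonglongrightarrow> X"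
    unfolding X_def using q_pos \<tau>_pos by (intro tendsto_intros LN_lim) (auto simp: add_eq_0_iff field_simps)
  then have u_lim: "(\<lambda>k. (cmod (u k))\<^sup>2) \<longlonglongrightarrow> X"
    by (simp add: u_sq mult.commute)
  from tendsto_real_sqrt[OF this] have "(\<lambda>k. cmod (u k)) \<longlonglongrightarrow> sqrt X" by simp
  then have "(\<lambda>k. \<rho> k * cmod (u k)) \<longlonglongrightarrow> sqrt \<tau> / (1 - X) * sqrt X"
    unfolding \<rho>_eq using u_lim X(2) q_pos \<tau>_pos by (intro tendsto_intros) auto
  moreover have "sqrt \<tau> / (1 - X) * sqrt X = \<sigma>"
    unfolding \<sigma>_def
  proof (rule real_sqrt_unique[symmetric])
    have "X \<ge> 0" using X(1) q_pos \<tau>_pos by simp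
    then have "(sqrt \<tau> / (1 - X) * sqrt X)\<^sup>2 = \<tau> / (1 - X)\<^sup>2 * X"
      using \<tau>_pos by (simp add: power_mult_distrib power_divide)
    also have "\<dots> = q * (\<tau> + q) / \<tau>"
      unfolding X(2) unfolding X(1) using q_pos \<tau>_pos by (simp add: power2_eq_square add.commute)
    finally show "(sqrt \<tau> / (1 - X) * sqrt X)\<^sup>2 = q * (\<tau> + q) / \<tau>" .
    show "0 \<le> sqrt \<tau> / (1 - X) * sqrt X"
      unfolding X using q_pos \<tau>_pos by simp
  qed
  ultimately show ?thesis by simp
qed

definition "w k v = v / (of_real (\<rho> k) * u k * of_real (sqrt (real (M k) * real (N k))))"
definition "Z k v = u k ^ M k * (1 + w k v) ^ M k"
text \<open>Rotating by -\<theta> makes \<open>u\<close> positive. The real part of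
  \<open>a v\<close> is the radial displacement, the only one that the weight sees in the
  limit.\<close>

definition "a v = exp (- \<i> * of_real \<theta>) * v"
text \<open>A gauge factor: Re x * Im x is the imaginary part of x^2 / 2, which is left over in the
  limit of the kernel at x = \<open>a v\<close>.\<close>

definition "\<psi> v = exp (\<i> * of_real (Re (a v) * Im (a v)))"
definition "\<phi> k v = cnj (sgn (Z k v)) ^ (m k - 1) * cnj (\<psi> v)"
text \<open>The phase factors \<open>\<phi>\<close> cancel in the determinant, but without them the kernel itself has no limit.\<close>

definition "En k v v' = of_real (real (M k) / ((\<rho> k)\<^sup>2 * (cmod (u k))\<^sup>2 * real (N k)) * cmod (Z k v) * cmod (Z k v'))
   * K_trunc c (L k) (M k) (N k) (Z k v) (Z k v') * \<phi> k v * cnj (\<phi> k v')"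
definition "K_lim v v' = (if q < 1 then K_bulk v v' else K_edge \<theta> v v')"

lemma w_eq: "w k v = a v / of_real (\<rho> k * cmod (u k)) / of_real (s k * real (M k))"
proof -
  have "sqrt (real (M k) * real (N k)) = s k * real (M k)"
    unfolding s_sq[symmetric] using s_pos[of k] by (simp add: real_sqrt_mult flip: power2_eq_square)
  moreover have "v / (of_real (\<rho> k) * u k) = a v / of_real (\<rho> k * cmod (u k))"
    by (subst u_polar) (simp add: a_def exp_minus divide_simps)
  ultimately show ?thesis
    unfolding w_def by (simp only: divide_divide_eq_left[symmetric])
qed

lemma sM_inverse_lim: "(\<lambda>k. 1 / (s k * real (M k))) \<longlonglongrightarrow> 0"
proof (rule Lim_null_comparison[OF always_eventually inverse_s_lim], rule allI)
  fix k
  have "1 * s k \<le> real (M k) * s k" using s_pos[of k] M_pos[of k] by (intro mult_right_mono) auto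
  then have "1 / (s k * real (M k)) \<le> 1 / s k"
    using s_pos[of k] by (intro divide_left_mono) (auto simp: mult.commute)
  then show "norm (1 / (s k * real (M k))) \<le> 1 / s k" using s_pos[of k] by simp
qed

text \<open>\<open>w\<close> is of order 1 / (s M), so M Ln(1 + w) serves as the displacement
  \<open>b\<close> in z = u^M e^b. Scaled by s it equals s M w up to the quadratic remainder of the
  logarithm, which is of order 1 / (s M). The logarithm is usable once 1 + w is nonzero, hence only
  eventually.\<close>

lemma
  assumes v: "v \<longlonglongrightarrow> x"
  shows w_lim: "(\<lambda>k. w k (v k)) \<longlonglongrightarrow> 0"
    and scaled_Ln_lim: "(\<lambda>k. of_real (s k) * (of_nat (M k) * Ln (1 + w k (v k)))) \<longlonglongrightarrow> a x / of_real \<sigma>"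
    and eventually_Z: "\<forall>\<^sub>F k in sequentially. Z k (v k) = u k ^ M k * exp (of_nat (M k) * Ln (1 + w k (v k)))"
proof -
  define y where "y k = a (v k) / of_real (\<rho> k * cmod (u k))" for k
  have y: "y \<longlonglongrightarrow> a x / of_real \<sigma>"
    unfolding y_def a_def using \<sigma>_pos by (intro tendsto_intros v \<rho>_u_lim) auto
  have w: "w k (v k) = y k * of_real (1 / (s k * real (M k)))" for k
    by (simp add: w_eq y_def)
  have "(\<lambda>k. y k * of_real (1 / (s k * real (M k)))) \<longlonglongrightarrow> a x / of_real \<sigma> * of_real 0"
    by (intro tendsto_intros y sM_inverse_lim)
  then show w0: "(\<lambda>k. w k (v k)) \<longlonglongrightarrow> 0" by (simp add: w)
  have small: "\<forall>\<^sub>F k in sequentially. norm (w k (v k)) < 1 / 2"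
    by (rule order_tendstoD(2)[OF tendsto_norm_zero[OF w0]]) simp
  show "\<forall>\<^sub>F k in sequentially. Z k (v k) = u k ^ M k * exp (of_nat (M k) * Ln (1 + w k (v k)))"
    using small
  proof eventually_elim
    case (elim k)
    have "1 + w k (v k) \<noteq> 0"
    proof
      assume "1 + w k (v k) = 0"
      then have "w k (v k) = - 1" by (simp add: add_eq_0_iff)
      then show False using elim by simp
    qed
    then show ?case by (simp add: Z_def exp_of_nat_mult)
  qed
  have err: "(\<lambda>k. of_real (s k) * (of_nat (M k) * Ln (1 + w k (v k))) - y k) \<longlonglongrightarrow> 0"
  proof (rule Lim_null_comparison)
    have "(\<lambda>k. 2 * (norm (y k))\<^sup>2 * (1 / (s k * real (M k)))) \<longlonglongrightarrow> 2 * (norm (a x / of_real \<sigma>))\<^sup>2 * 0"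
      by (intro tendsto_intros y sM_inverse_lim)
    then show "(\<lambda>k. 2 * (norm (y k))\<^sup>2 * (1 / (s k * real (M k)))) \<longlonglongrightarrow> 0" by simp
    show "\<forall>\<^sub>F k in sequentially. norm (of_real (s k) * (of_nat (M k) * Ln (1 + w k (v k))) - y k)
        \<le> 2 * (norm (y k))\<^sup>2 * (1 / (s k * real (M k)))"
      using small
    proof eventually_elim
      case (elim k)
      define t where "t = s k * real (M k)"
      have t: "t > 0" using s_pos[of k] by (simp add: t_def)
      have wt: "w k (v k) = y k * of_real (1 / t)" using w[of k] by (simp add: t_def)
      have "norm (Ln (1 + w k (v k)) - w k (v k)) \<le> (norm (w k (v k)))\<^sup>2 / (1 - norm (w k (v k)))"
        using elim by (intro Ln_approx_linear) simp
      also have "\<dots> \<le> (norm (w k (v k)))\<^sup>2 / (1 / 2)"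
        using elim by (intro divide_left_mono) auto
      finally have "t * norm (Ln (1 + w k (v k)) - w k (v k)) \<le> t * (2 * (norm (w k (v k)))\<^sup>2)"
        using t by (intro mult_left_mono) auto
      also have "\<dots> = 2 * (norm (y k))\<^sup>2 * (1 / t)"
        using t unfolding wt by (simp add: norm_mult norm_divide power_mult_distrib power_divide power2_eq_square)
      finally have le: "t * norm (Ln (1 + w k (v k)) - w k (v k)) \<le> 2 * (norm (y k))\<^sup>2 * (1 / t)" .
      have "of_real (s k) * (of_nat (M k) * Ln (1 + w k (v k))) - y k = of_real t * (Ln (1 + w k (v k)) - w k (v k))"
      proof -
        have "y k = of_real t * w k (v k)" using t unfolding wt by simp
        then show ?thesis by (simp add: t_def right_diff_distrib)
      qed
      then show ?case using le t by (simp add: norm_mult t_def[symmetric])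
    qed
  qed
  from tendsto_add[OF err y] show "(\<lambda>k. of_real (s k) * (of_nat (M k) * Ln (1 + w k (v k)))) \<longlonglongrightarrow> a x / of_real \<sigma>"
    by simp
qed

text \<open>x^2 / 2 - (Re x)^2 equals -|x|^2 / 2 + i Re x Im x, and the conjugate identity holds for
  y. The two phases cancel the imaginary parts, and the mixed term of the square is x * cnj
  y.\<close>

lemma ginibre_exponent:
  fixes x y :: complex
  shows "exp ((x + cnj y)\<^sup>2 / 2 - of_real ((Re x)\<^sup>2 + (Re y)\<^sup>2)) * cnj (exp (\<i> * of_real (Re x * Im x))) * exp (\<i> * of_real (Re y * Im y))
    = exp (- (1/2) * (of_real ((cmod x)\<^sup>2) + of_real ((cmod y)\<^sup>2) - 2 * x * cnj y))"
proof -
  have "(x + cnj y)\<^sup>2 / 2 - of_real ((Re x)\<^sup>2 + (Re y)\<^sup>2) + cnj (\<i> * of_real (Re x * Im x)) + \<i> * of_real (Re y * Im y)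
    = - (1/2) * (of_real ((cmod x)\<^sup>2) + of_real ((cmod y)\<^sup>2) - 2 * x * cnj y)"
    unfolding cmod_power2 by (simp add: complex_eq_iff power2_eq_square algebra_simps add_divide_distrib diff_divide_distrib)
  then show ?thesis by (simp only: exp_cnj exp_add[symmetric])
qed

text \<open>The arguments are arbitrary convergent sequences rather than fixed points, which is the
  form that compactness upgrades to uniform convergence.\<close>

lemma En_lim:
  assumes v: "v \<longlonglongrightarrow> x" and v': "v' \<longlonglongrightarrow> x'"
  shows "(\<lambda>k. En k (v k) (v' k)) \<longlonglongrightarrow> K_lim x x'"
proof -
  let ?b = "\<lambda>v k. of_nat (M k) * Ln (1 + w k (v k))"
  have sig: "of_real \<sigma> * (a x / of_real \<sigma> + cnj (a x' / of_real \<sigma>)) = a x + cnj (a x')"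
    using \<sigma>_pos by (simp add: distrib_left)
  have re: "\<sigma>\<^sup>2 * ((Re (a x / of_real \<sigma>))\<^sup>2 + (Re (a x' / of_real \<sigma>))\<^sup>2) = (Re (a x))\<^sup>2 + (Re (a x'))\<^sup>2"
    using \<sigma>_pos by (simp add: distrib_left power_divide)
  define E where "E = (if q < 1 then 1 else erfc ((a x + cnj (a x')) / of_real (sqrt 2)) / 2)"
  define G where "G k = of_real (cmod (Z k (v k)) * cmod (Z k (v' k)) / (s k)\<^sup>2) * K_trunc c (L k) (M k) (N k) (Z k (v k)) (Z k (v' k))
              * (cnj (sgn (Z k (v k))) * sgn (Z k (v' k))) ^ (m k - 1)" for k
  have G: "G \<longlonglongrightarrow> of_real (\<sigma>\<^sup>2 / pi) * exp ((a x + cnj (a x'))\<^sup>2 / 2 - of_real ((Re (a x))\<^sup>2 + (Re (a x'))\<^sup>2)) * E"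
    using kernel_lim[OF c_pos scaled_Ln_lim[OF v] scaled_Ln_lim[OF v'] u_sq_exp eventually_Z[OF v] eventually_Z[OF v']]
    unfolding sig re G_def E_def .
  have "(\<lambda>k. of_real (1 / (\<rho> k * cmod (u k))\<^sup>2) * G k * cnj (\<psi> (v k)) * \<psi> (v' k))
     \<longlonglongrightarrow> of_real (1 / \<sigma>\<^sup>2) * (of_real (\<sigma>\<^sup>2 / pi) * exp ((a x + cnj (a x'))\<^sup>2 / 2 - of_real ((Re (a x))\<^sup>2 + (Re (a x'))\<^sup>2)) * E)
         * cnj (\<psi> x) * \<psi> x'"
    unfolding \<psi>_def a_def using \<sigma>_pos G[unfolded a_def]
    by (intro tendsto_intros v v' \<rho>_u_lim) auto
  moreover have "of_real (1 / (\<rho> k * cmod (u k))\<^sup>2) * G k * cnj (\<psi> (v k)) * \<psi> (v' k) = En k (v k) (v' k)" for k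
  proof -
    \<comment> \<open>Identifies the prefactor of the theorem with the 1 / s^2 of
      \<open>kernel_lim\<close>; the remaining 1 / (\<rho> |u|)^2 tends to 1 / \<sigma>^2 and
      cancels the \<sigma>^2 there.\<close>
    have MN: "real (M k) / real (N k) = 1 / (s k)\<^sup>2"
      using s_pos[of k] by (simp flip: s_sq)
    have "real (M k) / ((\<rho> k)\<^sup>2 * (cmod (u k))\<^sup>2 * real (N k)) = 1 / (\<rho> k * cmod (u k))\<^sup>2 * (real (M k) / real (N k))"
      by (simp add: power_mult_distrib)
    then have *: "real (M k) / ((\<rho> k)\<^sup>2 * (cmod (u k))\<^sup>2 * real (N k)) * cmod (Z k (v k)) * cmod (Z k (v' k))
       = 1 / (\<rho> k * cmod (u k))\<^sup>2 * (cmod (Z k (v k)) * cmod (Z k (v' k)) / (s k)\<^sup>2)"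
      unfolding MN by simp
    show ?thesis
      unfolding En_def * G_def \<phi>_def of_real_mult[of "1 / (\<rho> k * cmod (u k))\<^sup>2"]
      by (simp only: complex_cnj_mult complex_cnj_power complex_cnj_cnj power_mult_distrib mult_ac)
  qed
  moreover have "of_real (1 / \<sigma>\<^sup>2) * (of_real (\<sigma>\<^sup>2 / pi) * exp ((a x + cnj (a x'))\<^sup>2 / 2 - of_real ((Re (a x))\<^sup>2 + (Re (a x'))\<^sup>2)) * E)
         * cnj (\<psi> x) * \<psi> x' = K_lim x x'"
  proof -
    have norm_a: "cmod (a y) = cmod y" for y
      by (simp add: a_def norm_mult)
    have aa: "2 * a x * cnj (a x') = 2 * x * cnj x'"
      by (simp add: a_def exp_cnj exp_minus)
    have arg: "(a x + cnj (a x')) / of_real (sqrt 2)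
        = 1 / of_real (sqrt 2) * (exp (- \<i> * of_real \<theta>) * x + exp (\<i> * of_real \<theta>) * cnj x')"
      by (simp add: a_def exp_cnj)
    have "of_real (1 / \<sigma>\<^sup>2) * (of_real (\<sigma>\<^sup>2 / pi) * exp ((a x + cnj (a x'))\<^sup>2 / 2 - of_real ((Re (a x))\<^sup>2 + (Re (a x'))\<^sup>2)) * E)
         * cnj (\<psi> x) * \<psi> x'
       = of_real (1 / \<sigma>\<^sup>2) * of_real (\<sigma>\<^sup>2 / pi) * (exp ((a x + cnj (a x'))\<^sup>2 / 2 - of_real ((Re (a x))\<^sup>2 + (Re (a x'))\<^sup>2))
         * cnj (\<psi> x) * \<psi> x') * E"
      by (simp only: mult_ac)
    also have "\<dots> = 1 / of_real pi * exp (- (1/2) * (of_real ((cmod x)\<^sup>2) + of_real ((cmod x')\<^sup>2) - 2 * x * cnj x')) * E"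
      unfolding \<psi>_def ginibre_exponent norm_a aa using \<sigma>_pos by simp
    also have "\<dots> = K_lim x x'"
      unfolding K_lim_def K_bulk_def K_edge_def E_def arg by simp
    finally show ?thesis .
  qed
  ultimately show ?thesis by simp
qed

section \<open>Uniformity on compact sets\<close>

lemma continuous_on_K_lim: "continuous_on A (\<lambda>(v, v'). K_lim v v')"
  unfolding K_lim_def using continuous_on_K_bulk continuous_on_K_edge
  by (cases "q < 1") (auto intro: continuous_on_subset)

lemma uniform_limit_En:
  assumes "compact S"
  shows "uniform_limit (S \<times> S) (\<lambda>k (v, v'). En k v v') (\<lambda>(v, v'). K_lim v v') sequentially"
proof (rule uniform_limit_compactI[OF compact_Times[OF assms assms] continuous_on_K_lim])
  fix p and y :: "complex \<times> complex" assume "p \<longlonglongrightarrow> y"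
  then have "(\<lambda>k. fst (p k)) \<longlonglongrightarrow> fst y" "(\<lambda>k. snd (p k)) \<longlonglongrightarrow> snd y"
    by (auto intro: tendsto_fst tendsto_snd)
  from En_lim[OF this] show "(\<lambda>k. case p k of (v, v') \<Rightarrow> En k v v') \<longlonglongrightarrow> (case y of (v, v') \<Rightarrow> K_lim v v')"
    by (simp add: case_prod_unfold)
qed

text \<open>The phases have modulus one only at nonzero points, and this must hold for all of
  \<open>S\<close> at once. The modulus of \<open>w k v\<close> depends on v only through |v|, so a
  single point \<open>B\<close> bounding \<open>S\<close> suffices.\<close>

lemma eventually_Z_nonzero:
  assumes "bounded S"
  shows "\<forall>\<^sub>F k in sequentially. \<forall>v\<in>S. Z k v \<noteq> 0"
proof -
  obtain B where B: "\<And>v. v \<in> S \<Longrightarrow> norm v \<le> B" using assms unfolding bounded_iff by blast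
  have "\<forall>\<^sub>F k in sequentially. norm (w k (of_real B)) < 1"
    using order_tendstoD(2)[OF tendsto_norm_zero[OF w_lim[OF tendsto_const[of "of_real B"]]]] by simp
  then show ?thesis
  proof eventually_elim
    case (elim k)
    show ?case
    proof
      fix v assume "v \<in> S"
      from B[OF this] have "norm v \<le> norm (complex_of_real B)" by simp
      then have "norm (w k v) \<le> norm (w k (of_real B))"
        unfolding w_def norm_divide by (intro divide_right_mono) auto
      then have "norm (w k v) < 1" using elim by simp
      then have "1 + w k v \<noteq> 0"
        by (metis add_eq_0_iff2 norm_minus_cancel norm_one less_irrefl add.commute add_eq_0_iff)
      then show "Z k v \<noteq> 0" by (simp add: Z_def u_nonzero)
    qed
  qed
qed

lemma norm_\<phi>: "Z k v \<noteq> 0 \<Longrightarrow> cmod (\<phi> k v) = 1"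
  by (simp add: \<phi>_def \<psi>_def norm_mult norm_power norm_sgn)

end

theorem theorem3p3:
  fixes n :: nat
    and L M N :: "nat \<Rightarrow> nat"
    and \<tau> q \<theta> c :: real
    and P :: "nat \<Rightarrow> 'w measure"
    and X :: "nat \<Rightarrow> nat \<Rightarrow> 'w \<Rightarrow> complex mat"
    and R :: "nat \<Rightarrow> (nat \<Rightarrow> complex) \<Rightarrow> real"
    and u :: "nat \<Rightarrow> complex"
    and \<rho> :: "nat \<Rightarrow> real"
    and z :: "nat \<Rightarrow> (nat \<Rightarrow> complex) \<Rightarrow> nat \<Rightarrow> complex"
    and S :: "complex set"
  assumes "n \<ge> 1"
    and "\<And>k. L k \<ge> 1" "\<And>k. M k \<ge> 1" "\<And>k. N k \<ge> 1"
    and "filterlim (\<lambda>k. M k + N k) at_top sequentially"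
    and "(\<lambda>k. real (M k) / real (N k)) \<longlonglongrightarrow> 0"
    and "(\<lambda>k. real (L k) / real (N k)) \<longlonglongrightarrow> \<tau>" "\<tau> > 0"
    and "\<And>k. iid_truncated_unitary (P k) (N k) (L k) (M k) (X k)"
    and "\<And>k. is_correlation_function (P k)
           (\<lambda>\<omega>. eigenvalues_mset (mat_product (N k) (\<lambda>i. X k i \<omega>) (M k))) n (R k)"
    and "c > 0"
    and "\<And>k x. x \<in> {..<n} \<rightarrow>\<^sub>E UNIV \<Longrightarrow>
           complex_of_real (R k x) = kernel_det n (K_trunc c (L k) (M k) (N k)) x"
    and "0 < q" "q \<le> 1"
    and "- pi < \<theta>" "\<theta> \<le> pi"
    and "\<And>k. u k = of_real (cmod (u k)) * exp (\<i> * of_real \<theta>)"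
    and "\<And>k. (1 + real (L k) / (q * real (N k))) * (cmod (u k))\<^sup>2 - 1 = 0"
    and "\<And>k. \<rho> k = sqrt \<tau> / (1 - (cmod (u k))\<^sup>2)"
    and "\<And>k v j. z k v j = u k ^ M k *
           (1 + v j / (of_real (\<rho> k) * u k * of_real (sqrt (real (M k) * real (N k))))) ^ M k"
    and "compact S"
  shows "uniform_limit ({..<n} \<rightarrow> S)
    (\<lambda>k v. complex_of_real
       ((real (M k) / ((\<rho> k)\<^sup>2 * (cmod (u k))\<^sup>2 * real (N k))) ^ n *
        (cmod (\<Prod>j<n. z k v j))\<^sup>2 * R k (\<lambda>j\<in>{..<n}. z k v j)))
    (\<lambda>v. if q < 1 then kernel_det n K_bulk v else kernel_det n (K_edge \<theta>) v)
    sequentially"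
proof -
  interpret ginibre_point L M N \<tau> q u \<rho> \<theta> c
    by unfold_locales (fact assms)+
  have z: "z k v j = Z k (v j)" for k v j
    unfolding Z_def w_def by (fact assms)
  have "bounded ((\<lambda>(v, v'). K_lim v v') ` (S \<times> S))"
    using \<open>compact S\<close> by (intro compact_imp_bounded compact_continuous_image continuous_on_K_lim compact_Times)
  then obtain B where B: "\<And>v v'. v \<in> S \<Longrightarrow> v' \<in> S \<Longrightarrow> norm (K_lim v v') \<le> B"
    unfolding bounded_iff by fastforce
  have unif: "uniform_limit ({..<n} \<rightarrow> S)
      (\<lambda>k v. Determinant.det (Matrix.mat n n (\<lambda>(i, j). En k (v i) (v j))))
      (\<lambda>v. Determinant.det (Matrix.mat n n (\<lambda>(i, j). K_lim (v i) (v j)))) sequentially"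
  proof (rule uniform_limit_det)
    fix i j assume ij: "i < n" "j < n"
    show "uniform_limit ({..<n} \<rightarrow> S) (\<lambda>k v. En k (v i) (v j)) (\<lambda>v. K_lim (v i) (v j)) sequentially"
    proof (rule uniform_limitI)
      fix e :: real assume "e > 0"
      with uniform_limit_En[OF \<open>compact S\<close>]
      have "\<forall>\<^sub>F k in sequentially. \<forall>p\<in>S \<times> S. dist (case p of (v, v') \<Rightarrow> En k v v') (case p of (v, v') \<Rightarrow> K_lim v v') < e"
        by (rule uniform_limitD)
      then show "\<forall>\<^sub>F k in sequentially. \<forall>v\<in>{..<n} \<rightarrow> S. dist (En k (v i) (v j)) (K_lim (v i) (v j)) < e"
        by eventually_elim (use ij in \<open>auto simp: Pi_iff\<close>)
    qed
    show "bounded ((\<lambda>v. K_lim (v i) (v j)) ` ({..<n} \<rightarrow> S))"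
      unfolding bounded_iff using ij by (intro exI[of _ B]) (auto simp: Pi_iff B)
  qed
  \<comment> \<open>For large k this is an exact identity: the phases in \<open>En\<close> cancel,
    and the rows and columns release the n-th power of the prefactor and the squared moduli of the
    points.\<close>
  have "\<forall>\<^sub>F k in sequentially. \<forall>v\<in>{..<n} \<rightarrow> S.
      Determinant.det (Matrix.mat n n (\<lambda>(i, j). En k (v i) (v j)))
    = complex_of_real
       ((real (M k) / ((\<rho> k)\<^sup>2 * (cmod (u k))\<^sup>2 * real (N k))) ^ n *
        (cmod (\<Prod>j<n. z k v j))\<^sup>2 * R k (\<lambda>j\<in>{..<n}. z k v j))"
    using eventually_Z_nonzero[OF compact_imp_bounded[OF \<open>compact S\<close>]]
  proof eventually_elim
    case (elim k)
    show ?case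
    proof
      fix v assume v: "v \<in> {..<n} \<rightarrow> S"
      have "complex_of_real (R k (\<lambda>j\<in>{..<n}. z k v j)) = kernel_det n (K_trunc c (L k) (M k) (N k)) (\<lambda>j\<in>{..<n}. z k v j)"
        by (rule assms) auto
      also have "\<dots> = Determinant.det (Matrix.mat n n (\<lambda>(i, j). K_trunc c (L k) (M k) (N k) (Z k (v i)) (Z k (v j))))"
        unfolding kernel_det_def by (intro arg_cong[of _ _ Determinant.det] eq_matI) (auto simp: z)
      finally have R: "complex_of_real (R k (\<lambda>j\<in>{..<n}. z k v j))
         = Determinant.det (Matrix.mat n n (\<lambda>(i, j). K_trunc c (L k) (M k) (N k) (Z k (v i)) (Z k (v j))))" .
      have "Determinant.det (Matrix.mat n n (\<lambda>(i, j). En k (v i) (v j)))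
         = of_real ((real (M k) / ((\<rho> k)\<^sup>2 * (cmod (u k))\<^sup>2 * real (N k))) ^ n * (\<Prod>i<n. cmod (Z k (v i)))\<^sup>2)
           * Determinant.det (Matrix.mat n n (\<lambda>(i, j). K_trunc c (L k) (M k) (N k) (Z k (v i)) (Z k (v j))))"
        unfolding En_def using v elim by (intro det_conjugate_phases norm_\<phi>) auto
      also have "(\<Prod>i<n. cmod (Z k (v i))) = cmod (\<Prod>j<n. z k v j)"
        by (simp add: z prod_norm)
      finally show "Determinant.det (Matrix.mat n n (\<lambda>(i, j). En k (v i) (v j)))
        = complex_of_real ((real (M k) / ((\<rho> k)\<^sup>2 * (cmod (u k))\<^sup>2 * real (N k))) ^ n *
            (cmod (\<Prod>j<n. z k v j))\<^sup>2 * R k (\<lambda>j\<in>{..<n}. z k v j))"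
        by (simp only: R[symmetric] of_real_mult)
    qed
  qed
  moreover have "Determinant.det (Matrix.mat n n (\<lambda>(i, j). K_lim (v i) (v j)))
     = (if q < 1 then kernel_det n K_bulk v else kernel_det n (K_edge \<theta>) v)" for v
    by (simp add: K_lim_def kernel_det_def)
  ultimately show ?thesis
    using unif by (subst (asm) uniform_limit_cong) auto
qed

end
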